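(* Let $\eta\in H_+$ and let $x^*(\cdot)$ be a solution on $[0,+\infty)$ of the closed-loop equation $$\begin{cases} x'(t)=rx(t)+f_0\left(x(t),\int_{-T}^0a(\xi)x(t+\xi)\,d\xi\right)-C\left((x(t),x(t+\xi)|_{\xi\in[-T,0]})\right),\\ x(0)=\eta_0,\quad x(s)=\eta_1(s),\ s\in[-T,0), \end{cases}$$ such that $x^*(\cdot)>0$ on $[0,+\infty)$. Let $$c^*(t):=C\left((x^*(t),x^*(t+\xi)|_{\xi\in[-T,0]})\right),\qquad t\ge 0.$$ Then $c^*(\cdot)$ is admissible and optimal for the problem with initial state $\eta$, i.e. $c^*(\cdot)\in\mathcal{C}(\eta)$ and $J(\eta;c^*(\cdot))=V(\eta)$.
   Context: Setting. Fix $T>0$, $\rho>0$, $r>0$. Put $L^2_{-T}=L^2([-T,0];\mathbb{R})$, $W^{1,2}_{-T}=W^{1,2}([-T,0];\mathbb{R})$, $H=\mathbb{R}\times L^2_{-T}$ with its Hilbert product norm $\|\cdot\|$, elements $\eta=(\eta_0,\eta_1(\cdot))$, and $H_+=(0,+\infty)\times L^2_{-T}$. $\mathbb{R}^+=[0,+\infty)$. Assumptions on $a,f_0$: $a\in W^{1,2}_{-T}$, $a\ge 0$, $a(-T)=0$; $f_0:[0,\infty)\times\mathbb{R}\to\mathbb{R}$ is jointly concave, nondecreasing in the second variable, Lipschitz continuous with constant $C_{f_0}$, and $f_0(0,y)>0$ for all $y>0$. To make sense of trajectories that become negative, $f_0$ is extended by $f_0(x,y)=f_0(0,y)$ for $x<0$.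 Assumptions on utilities: $U_1\in C([0,\infty))\cap C^2((0,\infty))$ is bounded, $U_1'>0$, $U_1'(0^+)=+\infty$, $U_1''<0$; $U_2\in C((0,\infty))$ is increasing (not necessarily strictly; $U_2\equiv 0$ is allowed), concave, bounded from above, and $\int_0^{\infty}e^{-\rho t}U_2(e^{-C_{f_0}t})\,dt>-\infty$. For $\eta\in H_+$ and $c\in L^1_{loc}([0,\infty);\mathbb{R}^+)$, $x(\cdot;\eta,c)$ is the unique solution, absolutely continuous on $[0,\infty)$, of $x(t)=\eta_0+\int_0^t\big[rx(s)+f_0(x(s),\int_{-T}^0a(\xi)x(s+\xi)d\xi)-c(s)\big]ds$, $t\ge0$, with $x=\eta_1$ on $[-T,0)$. Solutions of delay equations are understood in this integral sense. Admissible controls: $\mathcal{C}(\eta)=\{c\in L^1_{loc}([0,\infty);\mathbb{R}^+): x(t;\eta,c)>0\ \forall t\ge0\}$. Objective: $J(\eta;c)=\int_0^\infty e^{-\rho t}[U_1(c(t))+U_2(x(t;\eta,c))]dt$. Value function: $V(\eta)=\sup_{c\in\mathcal{C}(\eta)}J(\eta;c)$ (with $\sup\emptyset=-\infty$), with domain $\mathcal{D}(V)=\{\eta\in H_+: V(\eta)>-\infty\}$. Known facts making the feedback map well defined: $\mathcal{D}(V)$ is an open convex subset of $H$, $V$ is concave on $\mathcal{D}(V)$ and strictly increasing in $\eta_0$, and $V$ is differentiable at every point of $\mathcal{D}(V)$ in the direction $(1,0)$, with derivative $V_{\eta_0}:\mathcal{D}(V)\to(0,\infty)$ continuous. The feedback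 map is $C(\eta)=\mathrm{argmax}_{c\ge0}\,(U_1(c)-c\,V_{\eta_0}(\eta))$, $\eta\in\mathcal{D}(V)$ (single-valued and continuous). A strictly positive solution $x^*$ of the closed-loop equation is understood to satisfy $(x^*(t),x^*(t+\xi)|_{\xi\in[-T,0]})\in\mathcal{D}(V)$ for all $t\ge0$, so that the term with $C$ makes sense. *)

theory Defs
  imports "HOL-Analysis.Analysis"
begin

text \<open>
  A state is a pair of a present value and a past profile on \<open>[-T,0]\<close>. Profiles are represented
  by functions rather than by classes modulo null sets; the quantities defined below depend
  on the profile only through its class. All measurability is with respect to
  Lebesgue measure.
\<close>

type_synonym state = "real \<times> (real \<Rightarrow> real)"

definition L2_past :: "real \<Rightarrow> (real \<Rightarrow> real) set" where
  "L2_past T = {g \<in> borel_measurable (lebesgue_on {-T..0}).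
                  integrable (lebesgue_on {-T..0}) (\<lambda>s. (g s)\<^sup>2)}"

definition H_space :: "real \<Rightarrow> state set" where
  "H_space T = UNIV \<times> L2_past T"

definition H_plus :: "real \<Rightarrow> state set" where
  "H_plus T = {0<..} \<times> L2_past T"

definition H_dist :: "real \<Rightarrow> state \<Rightarrow> state \<Rightarrow> real" where
  "H_dist T \<eta> \<zeta> =
     sqrt ((fst \<eta> - fst \<zeta>)\<^sup>2 + (LINT s|lebesgue_on {-T..0}. (snd \<eta> s - snd \<zeta> s)\<^sup>2))"

definition H_mix :: "real \<Rightarrow> state \<Rightarrow> state \<Rightarrow> state" where
  "H_mix u \<eta> \<zeta> =
     ((1 - u) * fst \<eta> + u * fst \<zeta>, \<lambda>s. (1 - u) * snd \<eta> s + u * snd \<zeta> s)"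

text \<open>
  The Sobolev space \<open>W\<^sup>1\<^sup>,\<^sup>2(-T,0)\<close>, through weak derivatives tested against compactly supported
  \<open>C\<^sup>1\<close> functions. Continuity selects the continuous representative, which is what the boundary
  value \<open>a (-T)\<close> refers to.
\<close>

definition W12_past :: "real \<Rightarrow> (real \<Rightarrow> real) set" where
  "W12_past T = {a \<in> L2_past T. continuous_on {-T..0} a \<and>
     (\<exists>a' \<in> L2_past T. \<forall>\<phi> \<phi>'.
        (\<forall>s. (\<phi> has_real_derivative \<phi>' s) (at s)) \<and> continuous_on UNIV \<phi>' \<and>
        (\<exists>d>0. \<forall>s. s \<notin> {-T + d..-d} \<longrightarrow> \<phi> s = 0) \<longrightarrow>
        (LINT s|lebesgue_on {-T..0}. a s * \<phi>' s) =
          - (LINT s|lebesgue_on {-T..0}. a' s * \<phi> s))}"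

definition dynamics_assms ::
    "real \<Rightarrow> (real \<Rightarrow> real) \<Rightarrow> (real \<Rightarrow> real \<Rightarrow> real) \<Rightarrow> real \<Rightarrow> bool" where
  "dynamics_assms T a f\<^sub>0 C\<^sub>f \<longleftrightarrow>
     a \<in> W12_past T \<and> (\<forall>s\<in>{-T..0}. 0 \<le> a s) \<and> a (-T) = 0 \<and>
     concave_on ({0..} \<times> UNIV) (\<lambda>(x, y). f\<^sub>0 x y) \<and>
     (\<forall>x\<ge>0. mono (f\<^sub>0 x)) \<and>
     C\<^sub>f-lipschitz_on ({0..} \<times> UNIV) (\<lambda>(x, y). f\<^sub>0 x y) \<and>
     (\<forall>y>0. f\<^sub>0 0 y > 0)"

text \<open>
  Lebesgue integral with values in \<open>[-\<infinity>,\<infinity>]\<close>; \<open>ennreal\<close> truncates negative arguments to \<open>0\<close>,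
  so these are the integrals of the positive and negative parts. It is applied to integrands
  whose positive part has finite integral.
\<close>

definition ext_integral_halfline :: "(real \<Rightarrow> real) \<Rightarrow> ereal" where
  "ext_integral_halfline g =
     enn2ereal (\<integral>\<^sup>+t. ennreal (g t) \<partial>lebesgue_on {0..}) -
     enn2ereal (\<integral>\<^sup>+t. ennreal (- g t) \<partial>lebesgue_on {0..})"

definition consumption_utility :: "(real \<Rightarrow> real) \<Rightarrow> bool" where
  "consumption_utility U\<^sub>1 \<longleftrightarrow>
     continuous_on {0..} U\<^sub>1 \<and> bounded (U\<^sub>1 ` {0..}) \<and>
     (\<forall>c>0. U\<^sub>1 field_differentiable (at c) \<and> deriv U\<^sub>1 field_differentiable (at c)) \<and>
     continuous_on {0<..} (deriv (deriv U\<^sub>1)) \<and>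
     (\<forall>c>0. deriv U\<^sub>1 c > 0 \<and> deriv (deriv U\<^sub>1) c < 0) \<and>
     filterlim (deriv U\<^sub>1) at_top (at_right 0)"

definition state_utility :: "real \<Rightarrow> real \<Rightarrow> (real \<Rightarrow> real) \<Rightarrow> bool" where
  "state_utility \<rho> C\<^sub>f U\<^sub>2 \<longleftrightarrow>
     continuous_on {0<..} U\<^sub>2 \<and> mono_on {0<..} U\<^sub>2 \<and> concave_on {0<..} U\<^sub>2 \<and>
     bdd_above (U\<^sub>2 ` {0<..}) \<and>
     ext_integral_halfline (\<lambda>t. exp (-\<rho> * t) * U\<^sub>2 (exp (-C\<^sub>f * t))) > -\<infinity>"

definition delay_term :: "real \<Rightarrow> (real \<Rightarrow> real) \<Rightarrow> (real \<Rightarrow> real) \<Rightarrow> real \<Rightarrow> real" where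
  "delay_term T a x t = (LINT \<xi>|lebesgue_on {-T..0}. a \<xi> * x (t + \<xi>))"

text \<open>
  \<open>max 0\<close> implements the extension \<open>f\<^sub>0(x,y) = f\<^sub>0(0,y)\<close> for \<open>x < 0\<close>. A function satisfying this
  integral equation is locally absolutely continuous on \<open>[0,\<infinity>)\<close>, being an indefinite integral.
\<close>

definition delay_rhs ::
    "real \<Rightarrow> real \<Rightarrow> (real \<Rightarrow> real) \<Rightarrow> (real \<Rightarrow> real \<Rightarrow> real) \<Rightarrow>
     (real \<Rightarrow> real) \<Rightarrow> (real \<Rightarrow> real) \<Rightarrow> real \<Rightarrow> real" where
  "delay_rhs T r a f\<^sub>0 c x s = r * x s + f\<^sub>0 (max 0 (x s)) (delay_term T a x s) - c s"

definition delay_solution ::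
    "real \<Rightarrow> real \<Rightarrow> (real \<Rightarrow> real) \<Rightarrow> (real \<Rightarrow> real \<Rightarrow> real) \<Rightarrow>
     state \<Rightarrow> (real \<Rightarrow> real) \<Rightarrow> (real \<Rightarrow> real) \<Rightarrow> bool" where
  "delay_solution T r a f\<^sub>0 \<eta> c x \<longleftrightarrow>
     (\<forall>s\<in>{-T..<0}. x s = snd \<eta> s) \<and>
     (\<forall>t\<ge>0. delay_rhs T r a f\<^sub>0 c x absolutely_integrable_on {0..t} \<and>
            x t = fst \<eta> + (LINT s:{0..t}|lebesgue. delay_rhs T r a f\<^sub>0 c x s))"

text \<open>
  The value at time \<open>t\<close> of the unique solution. The description operator is applied
  to the value and not to the solution as a function, since nothing is prescribed
  before time \<open>-T\<close>.
\<close>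

definition trajectory ::
    "real \<Rightarrow> real \<Rightarrow> (real \<Rightarrow> real) \<Rightarrow> (real \<Rightarrow> real \<Rightarrow> real) \<Rightarrow>
     state \<Rightarrow> (real \<Rightarrow> real) \<Rightarrow> real \<Rightarrow> real" where
  "trajectory T r a f\<^sub>0 \<eta> c t = (THE v. \<exists>x. delay_solution T r a f\<^sub>0 \<eta> c x \<and> x t = v)"

definition segment :: "(real \<Rightarrow> real) \<Rightarrow> real \<Rightarrow> state" where
  "segment x t = (x t, \<lambda>\<xi>. x (t + \<xi>))"

definition admissible ::
    "real \<Rightarrow> real \<Rightarrow> (real \<Rightarrow> real) \<Rightarrow> (real \<Rightarrow> real \<Rightarrow> real) \<Rightarrow> state \<Rightarrow> (real \<Rightarrow> real) set" where
  "admissible T r a f\<^sub>0 \<eta> =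
     {c. (\<forall>t\<ge>0. 0 \<le> c t) \<and> (\<forall>t\<ge>0. c absolutely_integrable_on {0..t}) \<and>
         (\<forall>t\<ge>0. trajectory T r a f\<^sub>0 \<eta> c t > 0)}"

definition objective ::
    "real \<Rightarrow> real \<Rightarrow> real \<Rightarrow> (real \<Rightarrow> real) \<Rightarrow> (real \<Rightarrow> real \<Rightarrow> real) \<Rightarrow>
     (real \<Rightarrow> real) \<Rightarrow> (real \<Rightarrow> real) \<Rightarrow> state \<Rightarrow> (real \<Rightarrow> real) \<Rightarrow> ereal" where
  "objective T \<rho> r a f\<^sub>0 U\<^sub>1 U\<^sub>2 \<eta> c =
     ext_integral_halfline
       (\<lambda>t. exp (-\<rho> * t) * (U\<^sub>1 (c t) + U\<^sub>2 (trajectory T r a f\<^sub>0 \<eta> c t)))"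

definition value_fun ::
    "real \<Rightarrow> real \<Rightarrow> real \<Rightarrow> (real \<Rightarrow> real) \<Rightarrow> (real \<Rightarrow> real \<Rightarrow> real) \<Rightarrow>
     (real \<Rightarrow> real) \<Rightarrow> (real \<Rightarrow> real) \<Rightarrow> state \<Rightarrow> ereal" where
  "value_fun T \<rho> r a f\<^sub>0 U\<^sub>1 U\<^sub>2 \<eta> =
     (SUP c \<in> admissible T r a f\<^sub>0 \<eta>. objective T \<rho> r a f\<^sub>0 U\<^sub>1 U\<^sub>2 \<eta> c)"

definition value_dom ::
    "real \<Rightarrow> real \<Rightarrow> real \<Rightarrow> (real \<Rightarrow> real) \<Rightarrow> (real \<Rightarrow> real \<Rightarrow> real) \<Rightarrow>
     (real \<Rightarrow> real) \<Rightarrow> (real \<Rightarrow> real) \<Rightarrow> state set" where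
  "value_dom T \<rho> r a f\<^sub>0 U\<^sub>1 U\<^sub>2 = {\<eta> \<in> H_plus T. value_fun T \<rho> r a f\<^sub>0 U\<^sub>1 U\<^sub>2 \<eta> > -\<infinity>}"

definition present_deriv :: "(state \<Rightarrow> ereal) \<Rightarrow> state \<Rightarrow> real" where
  "present_deriv W \<eta> = deriv (\<lambda>x. real_of_ereal (W (x, snd \<eta>))) (fst \<eta>)"

definition feedback ::
    "real \<Rightarrow> real \<Rightarrow> real \<Rightarrow> (real \<Rightarrow> real) \<Rightarrow> (real \<Rightarrow> real \<Rightarrow> real) \<Rightarrow>
     (real \<Rightarrow> real) \<Rightarrow> (real \<Rightarrow> real) \<Rightarrow> state \<Rightarrow> real" where
  "feedback T \<rho> r a f\<^sub>0 U\<^sub>1 U\<^sub>2 \<eta> =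
     arg_max_on (\<lambda>c. U\<^sub>1 c - c * present_deriv (value_fun T \<rho> r a f\<^sub>0 U\<^sub>1 U\<^sub>2) \<eta>) {0..}"

text \<open>
  The known facts under which \<open>feedback\<close> is well defined, to be read with \<open>W\<close> the value
  function and \<open>D\<close> its domain. Openness is in \<open>H\<close>, whose topology is that of \<open>H_dist\<close>.
\<close>

definition feedback_regularity :: "real \<Rightarrow> (state \<Rightarrow> ereal) \<Rightarrow> state set \<Rightarrow> bool" where
  "feedback_regularity T W D \<longleftrightarrow>
     (\<forall>\<eta>\<in>D. \<exists>\<epsilon>>0. \<forall>\<zeta>\<in>H_space T. H_dist T \<zeta> \<eta> < \<epsilon> \<longrightarrow> \<zeta> \<in> D) \<and>
     (\<forall>\<eta>\<in>D. \<forall>\<zeta>\<in>D. \<forall>u\<in>{0..1}. H_mix u \<eta> \<zeta> \<in> D \<and>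
        W (H_mix u \<eta> \<zeta>) \<ge> ereal (1 - u) * W \<eta> + ereal u * W \<zeta>) \<and>
     (\<forall>x y g. (x, g) \<in> D \<and> (y, g) \<in> D \<and> x < y \<longrightarrow> W (x, g) < W (y, g)) \<and>
     (\<forall>\<eta>\<in>D. (\<lambda>x. real_of_ereal (W (x, snd \<eta>))) field_differentiable (at (fst \<eta>)) \<and>
        present_deriv W \<eta> > 0) \<and>
     (\<forall>\<eta>\<in>D. \<forall>\<epsilon>>0. \<exists>\<delta>>0. \<forall>\<zeta>\<in>D. H_dist T \<zeta> \<eta> < \<delta> \<longrightarrow>
        \<bar>present_deriv W \<zeta> - present_deriv W \<eta>\<bar> < \<epsilon>)"

end

theory Submission
  imports Defs
begin

text \<open>
  The dynamic programming inequality is proved directly, without the Hamilton-Jacobi-Bellman equation.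
  Start an almost optimal control \<open>c\<close> at the state of the closed-loop trajectory \<open>x\<close> at time \<open>t\<close> and
  follow it for a short time \<open>h\<close>, with trajectory \<open>y\<close>. The pasts of \<open>y\<close> and \<open>x\<close> at time \<open>t + h\<close> differ
  only on an interval of length \<open>h\<close>, by \<open>O(\<integral>\<bar>c - c\<^sup>*\<bar>)\<close>, and through the delay term this is compensated by
  raising the present value by \<open>O(h \<integral>\<bar>c - c\<^sup>*\<bar>)\<close>. Hence the rest of the payoff of \<open>c\<close> is at most the value of
  a state with the past of \<open>x\<close> and present value \<open>x(t + h) - \<integral>(c - c\<^sup>*) + O(h \<integral>\<bar>c - c\<^sup>*\<bar>)\<close>. Concavity in
  the present value and the maximality of \<open>c\<^sup>*\<close> in the definition of the feedback give
  \<open>V(x\<^sub>t) \<le> \<integral>\<^sub>0\<^sup>h e\<^sup>-\<^sup>\<rho>\<^sup>s [U\<^sub>1(c\<^sup>*) + U\<^sub>2(x)] ds + e\<^sup>-\<^sup>\<rho>\<^sup>h V(x\<^sub>t\<^sub>+\<^sub>h) + o(h)\<close>, uniformly for \<open>t\<close> in a compact interval.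
  Summing over a partition and letting the horizon tend to infinity bounds \<open>V(\<eta>)\<close> by the payoff of \<open>c\<^sup>*\<close>.
\<close>

section \<open>Continuity of translations in \<open>L\<^sup>2\<close>\<close>

text \<open>The known facts provide a derivative of \<open>V\<close> in the direction (1,0) alone,
  so a discrepancy between pasts cannot be estimated by differentiating \<open>V\<close>; it has to
  be exchanged for present value before concavity applies. The competitor \<open>c\<close> changes
  with the step and is unbounded, hence the integral of its distance to the feedback control over a
  step need not be small. The errors it causes are therefore kept linear in this integral, with a
  coefficient of order \<open>h\<close>, and charged to the maximality of the feedback under a
  slightly perturbed price: for large consumption the linear cost outweighs the bounded utility. The
  tangent is taken at the end of the step, so its slope is the derivative of \<open>V\<close> at
  time \<open>t + h\<close>, whereas the feedback at time \<open>s\<close> is optimal for the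
  derivative at time \<open>s\<close>. The two are close because the derivative is continuous along
  the trajectory, uniformly on compact intervals. As pasts are merely square integrable, this
  continuity rests on the continuity of translations in L2.\<close>

lemma integrable_lebesgue_translate:
  fixes F :: "real \<Rightarrow> real"
  shows "integrable lebesgue (\<lambda>s. F (t + s)) \<longleftrightarrow> integrable lebesgue F"
  using has_bochner_integral_lebesgue_real_affine_iff[of 1 F _ t]
  by (auto simp: integrable.simps)

lemma integral_lebesgue_translate:
  fixes F :: "real \<Rightarrow> real"
  shows "(LINT s|lebesgue. F (t + s)) = (LINT s|lebesgue. F s)"
  using lebesgue_integral_real_affine[of 1 F t] by simp

lemma measurable_lebesgue_translate:
  fixes F :: "real \<Rightarrow> real"
  assumes "F \<in> borel_measurable lebesgue"
  shows "(\<lambda>s. F (t + s)) \<in> borel_measurable lebesgue"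
proof -
  have "(\<lambda>s::real. t + s) \<in> lebesgue \<rightarrow>\<^sub>M lebesgue"
    using lebesgue_affine_measurable[where c= "\<lambda>x::real. 1" and t = t] by simp
  from measurable_compose[OF this assms] show ?thesis .
qed

lemma continuous_borel_measurable_lebesgue:
  fixes g :: "real \<Rightarrow> real"
  assumes "continuous_on UNIV g"
  shows "g \<in> borel_measurable lebesgue"
  using continuous_imp_measurable_on_sets_lebesgue[OF assms] by (simp add: lebesgue_on_UNIV_eq)

lemma square_sum3_le: "(a + b + c)\<^sup>2 \<le> 3 * (a\<^sup>2 + b\<^sup>2 + c\<^sup>2)" for a b c :: real
proof -
  have "0 \<le> (a - b)\<^sup>2 + (b - c)\<^sup>2 + (a - c)\<^sup>2" by simp
  then show ?thesis by (simp add: power2_eq_square algebra_simps)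
qed

lemma square_sum2_le: "(a + b)\<^sup>2 \<le> 2 * (a\<^sup>2 + b\<^sup>2)" for a b :: real
proof -
  have "0 \<le> (a - b)\<^sup>2" by simp
  then show ?thesis by (simp add: power2_eq_square algebra_simps)
qed

lemma square_integrable_add:
  fixes F G :: "'a \<Rightarrow> real"
  assumes "F \<in> borel_measurable M" "G \<in> borel_measurable M"
    and "integrable M (\<lambda>s. (F s)\<^sup>2)" "integrable M (\<lambda>s. (G s)\<^sup>2)"
  shows "integrable M (\<lambda>s. (F s + G s)\<^sup>2)" "integrable M (\<lambda>s. (F s - G s)\<^sup>2)"
proof -
  have *: "integrable M (\<lambda>s. 2 * ((F s)\<^sup>2 + (G s)\<^sup>2))" using assms by simp
  show "integrable M (\<lambda>s. (F s + G s)\<^sup>2)"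
    by (rule Bochner_Integration.integrable_bound[OF *])
       (use assms square_sum2_le in \<open>auto simp: abs_of_nonneg\<close>)
  show "integrable M (\<lambda>s. (F s - G s)\<^sup>2)"
    by (rule Bochner_Integration.integrable_bound[OF *])
       (use assms square_sum2_le[of _ "- _"] in \<open>auto simp: abs_of_nonneg\<close>)
qed

text \<open>Stated with sequences, the form in which dominated convergence applies. The integral of
  a non-integrable function is 0, so the notion is used together with square integrability.\<close>

definition L2_translation_continuous :: "(real \<Rightarrow> real) \<Rightarrow> bool" where
  "L2_translation_continuous F \<longleftrightarrow>
     (\<forall>t. t \<longlonglongrightarrow> 0 \<longrightarrow> (\<lambda>n. LINT s|lebesgue. (F (t n + s) - F s)\<^sup>2) \<longlonglongrightarrow> 0)"

text \<open>Translation is an isometry of L2, so in the splitting of \<open>F (t + s) - F s\<close>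
  through \<open>G\<close> both outer terms have the norm of \<open>F - G\<close>, whatever
  \<open>t\<close> is. Of the factor 9 in \<open>e / 9\<close>, one 3 comes from squaring a sum of
  three terms and the other from their number.\<close>

lemma L2_translation_continuous_closure:
  fixes F :: "real \<Rightarrow> real"
  assumes F: "F \<in> borel_measurable lebesgue" "integrable lebesgue (\<lambda>s. (F s)\<^sup>2)"
    and approx: "\<And>e. 0 < e \<Longrightarrow> \<exists>G. G \<in> borel_measurable lebesgue \<and> integrable lebesgue (\<lambda>s. (G s)\<^sup>2) \<and>
       L2_translation_continuous G \<and> (LINT s|lebesgue. (F s - G s)\<^sup>2) < e"
  shows "L2_translation_continuous F"
  unfolding L2_translation_continuous_def
proof (intro allI impI)
  fix t :: "nat \<Rightarrow> real" assume t: "t \<longlonglongrightarrow> 0"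
  show "(\<lambda>n. LINT s|lebesgue. (F (t n + s) - F s)\<^sup>2) \<longlonglongrightarrow> 0"
  proof (rule LIMSEQ_I)
    fix e :: real assume "0 < e"
    then obtain G where G: "G \<in> borel_measurable lebesgue" "integrable lebesgue (\<lambda>s. (G s)\<^sup>2)"
       "L2_translation_continuous G" "(LINT s|lebesgue. (F s - G s)\<^sup>2) < e / 9"
      using approx[of "e/9"] by auto
    from G(3) t have "(\<lambda>n. LINT s|lebesgue. (G (t n + s) - G s)\<^sup>2) \<longlonglongrightarrow> 0"
      unfolding L2_translation_continuous_def by blast
    from LIMSEQ_D[OF this, of "e/9"] \<open>0 < e\<close> obtain N where
      N: "\<And>n. n \<ge> N \<Longrightarrow> \<bar>LINT s|lebesgue. (G (t n + s) - G s)\<^sup>2\<bar> < e / 9" by auto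
    show "\<exists>N. \<forall>n\<ge>N. norm ((LINT s|lebesgue. (F (t n + s) - F s)\<^sup>2) - 0) < e"
    proof (intro exI allI impI)
      fix n assume n: "n \<ge> N"
      let ?D = "\<lambda>s. (F s - G s)\<^sup>2" and ?E = "\<lambda>s. (G (t n + s) - G s)\<^sup>2"
      have FG: "integrable lebesgue ?D" using square_integrable_add(2) F G by blast
      have FGt: "integrable lebesgue (\<lambda>s. ?D (t n + s))"
        using FG by (subst integrable_lebesgue_translate)
      have Gt: "integrable lebesgue (\<lambda>s. (G (t n + s))\<^sup>2)"
        using G(2) by (subst integrable_lebesgue_translate)
      have Ft: "integrable lebesgue (\<lambda>s. (F (t n + s))\<^sup>2)"
        using F(2) by (subst integrable_lebesgue_translate)
      have E: "integrable lebesgue ?E"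
        by (intro square_integrable_add measurable_lebesgue_translate G Gt)
      have FF: "integrable lebesgue (\<lambda>s. (F (t n + s) - F s)\<^sup>2)"
        by (intro square_integrable_add measurable_lebesgue_translate F Ft)
      have "(LINT s|lebesgue. (F (t n + s) - F s)\<^sup>2) \<le> (LINT s|lebesgue. 3 * (?D (t n + s) + ?E s + ?D s))"
      proof (rule integral_mono[OF FF])
        show "integrable lebesgue (\<lambda>s. 3 * (?D (t n + s) + ?E s + ?D s))"
          using FG FGt E by simp
        fix s
        show "(F (t n + s) - F s)\<^sup>2 \<le> 3 * (?D (t n + s) + ?E s + ?D s)"
          using square_sum3_le[of "F (t n + s) - G (t n + s)" "G (t n + s) - G s" "G s - F s"]
          by (simp add: power2_commute)
      qed
      also have "\<dots> = 3 * ((LINT s|lebesgue. ?D (t n + s)) + (LINT s|lebesgue. ?E s) + (LINT s|lebesgue. ?D s))"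
        using FG FGt E by simp
      also have "(LINT s|lebesgue. ?D (t n + s)) = (LINT s|lebesgue. ?D s)"
        by (rule integral_lebesgue_translate)
      finally have "(LINT s|lebesgue. (F (t n + s) - F s)\<^sup>2) < e"
        using N[OF n] G(4) \<open>0 < e\<close> by argo
      moreover have "0 \<le> (LINT s|lebesgue. (F (t n + s) - F s)\<^sup>2)" by simp
      ultimately show "norm ((LINT s|lebesgue. (F (t n + s) - F s)\<^sup>2) - 0) < e" by simp
    qed
  qed
qed

section \<open>Approximation by bounded functions of bounded support\<close>

text \<open>Values and arguments are cut at the same level, so one parameter controls both, and
  multiples of indicators serve as integrable majorants.\<close>

definition truncate_at :: "real \<Rightarrow> (real \<Rightarrow> real) \<Rightarrow> real \<Rightarrow> real" where
  "truncate_at k F s = indicator {-k..k} s * max (-k) (min k (F s))"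

lemma truncate_at_measurable:
  fixes F :: "real \<Rightarrow> real"
  assumes "F \<in> borel_measurable lebesgue"
  shows "truncate_at k F \<in> borel_measurable lebesgue"
proof -
  have "(indicator {-k..k} :: real \<Rightarrow> real) \<in> borel_measurable lebesgue"
    by (intro borel_measurable_indicator) simp
  with assms show ?thesis unfolding truncate_at_def by measurable
qed

lemma abs_truncate_at_le: "0 \<le> k \<Longrightarrow> \<bar>truncate_at k F s\<bar> \<le> k"
  by (auto simp: truncate_at_def indicator_def)

lemma integrable_indicator_Icc: "integrable lebesgue (\<lambda>s. K * indicator {a..b::real} s :: real)"
proof -
  have "integrable lebesgue (indicator {a..b} :: real \<Rightarrow> real)"
    by (rule integrable_real_indicator) (auto simp: emeasure_lborel_Icc_eq)
  then show ?thesis by simp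
qed

lemma truncate_at_square_integrable:
  fixes F :: "real \<Rightarrow> real"
  assumes "F \<in> borel_measurable lebesgue" "0 \<le> k"
  shows "integrable lebesgue (\<lambda>s. (truncate_at k F s)\<^sup>2)"
proof (rule Bochner_Integration.integrable_bound[OF integrable_indicator_Icc[of "k\<^sup>2" "-k" k]])
  show "(\<lambda>s. (truncate_at k F s)\<^sup>2) \<in> borel_measurable lebesgue"
    using truncate_at_measurable[OF assms(1)] by simp
  show "AE s in lebesgue. norm ((truncate_at k F s)\<^sup>2) \<le> norm (k\<^sup>2 * indicator {-k..k} s)"
  proof (rule AE_I2)
    fix s
    have "(truncate_at k F s)\<^sup>2 \<le> k\<^sup>2"
      using abs_truncate_at_le[OF assms(2)] assms(2) by (metis abs_le_square_iff abs_of_nonneg)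
    then show "norm ((truncate_at k F s)\<^sup>2) \<le> norm (k\<^sup>2 * indicator {-k..k} s)"
      by (auto simp: truncate_at_def indicator_def)
  qed
qed

lemma truncate_at_L2_tendsto:
  fixes F :: "real \<Rightarrow> real"
  assumes F: "F \<in> borel_measurable lebesgue" "integrable lebesgue (\<lambda>s. (F s)\<^sup>2)"
  shows "(\<lambda>n. LINT s|lebesgue. (F s - truncate_at (real n) F s)\<^sup>2) \<longlonglongrightarrow> 0"
proof -
  have "(\<lambda>n. LINT s|lebesgue. (F s - truncate_at (real n) F s)\<^sup>2) \<longlonglongrightarrow> (LINT s|(lebesgue :: real measure). 0)"
  proof (rule integral_dominated_convergence[where w = "\<lambda>s. (F s)\<^sup>2"])
    show "(\<lambda>s. (F s - truncate_at (real n) F s)\<^sup>2) \<in> borel_measurable lebesgue" for n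
      using F truncate_at_measurable[OF F(1)] by simp
    show "AE s in lebesgue. (\<lambda>n. (F s - truncate_at (real n) F s)\<^sup>2) \<longlonglongrightarrow> 0"
    proof (rule AE_I2, rule tendsto_eventually)
      fix s
      obtain N :: nat where N: "\<bar>s\<bar> + \<bar>F s\<bar> \<le> real N" using real_arch_simple by blast
      show "\<forall>\<^sub>F n in sequentially. (F s - truncate_at (real n) F s)\<^sup>2 = 0"
        using eventually_ge_at_top[of N]
        by eventually_elim (use N in \<open>auto simp: truncate_at_def indicator_def\<close>)
    qed
    show "AE s in lebesgue. norm ((F s - truncate_at (real n) F s)\<^sup>2) \<le> (F s)\<^sup>2" for n
    proof (rule AE_I2)
      fix s
      have "\<bar>F s - truncate_at (real n) F s\<bar> \<le> \<bar>F s\<bar>"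
        by (auto simp: truncate_at_def indicator_def)
      then show "norm ((F s - truncate_at (real n) F s)\<^sup>2) \<le> (F s)\<^sup>2"
        by (simp add: abs_le_square_iff)
    qed
  qed (use F in auto)
  then show ?thesis by simp
qed

text \<open>The cut of the domain can create jumps at \<open>k\<close> and \<open>-k\<close> only;
  away from these points the translates converge pointwise, and dominated convergence does the
  rest.\<close>

lemma L2_translation_continuous_truncate_continuous:
  fixes g :: "real \<Rightarrow> real"
  assumes g: "continuous_on UNIV g" and k: "0 \<le> k"
  shows "L2_translation_continuous (truncate_at k g)"
  unfolding L2_translation_continuous_def
proof (intro allI impI)
  fix t :: "nat \<Rightarrow> real" assume t: "t \<longlonglongrightarrow> 0"
  let ?G = "truncate_at k g"
  have gm: "?G \<in> borel_measurable lebesgue"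
    using g by (intro truncate_at_measurable continuous_borel_measurable_lebesgue)
  \<comment> \<open>From \<open>N\<close> on the shifts are smaller than 1, so all the differences
    vanish outside \<open>{-k-1..k+1}\<close> and share an integrable majorant; the sequence is
    restarted there.\<close>
  obtain N where N: "\<And>n. n \<ge> N \<Longrightarrow> \<bar>t n\<bar> < 1"
    using LIMSEQ_D[OF t, of 1] by auto
  have "(\<lambda>n. LINT s|lebesgue. (?G (t (n + N) + s) - ?G s)\<^sup>2) \<longlonglongrightarrow> (LINT s|(lebesgue::real measure). 0)"
  proof (rule integral_dominated_convergence[where w = "\<lambda>s. (2 * k)\<^sup>2 * indicator {-k-1..k+1} s"])
    show "(\<lambda>s. (?G (t (n + N) + s) - ?G s)\<^sup>2) \<in> borel_measurable lebesgue" for n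
      using gm measurable_lebesgue_translate[OF gm] by simp
    show "AE s in lebesgue. (\<lambda>n. (?G (t (n + N) + s) - ?G s)\<^sup>2) \<longlonglongrightarrow> 0"
    proof -
      have "AE s in lebesgue. s \<notin> {-k, k}"
        by (rule AE_not_in) (auto simp: null_sets_completionI)
      then show ?thesis
      proof eventually_elim
        case (elim s)
        have "continuous_on (- {-k, k}) ?G"
        proof -
          have [continuous_intros]: "continuous_on (- {-k, k}) g"
            using g continuous_on_subset by blast
          have eq: "- {-k, k} = {..< -k} \<union> {-k<..<k} \<union> {k<..}" using k by auto
          have 1: "continuous_on {..< -k} ?G"
            by (rule continuous_on_eq[of _ "\<lambda>_. 0"]) (auto simp: truncate_at_def)
          have 2: "continuous_on {k<..} ?G"
            by (rule continuous_on_eq[of _ "\<lambda>_. 0"]) (auto simp: truncate_at_def)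
          have 3: "continuous_on {-k<..<k} ?G"
            by (rule continuous_on_eq[of _ "\<lambda>s. max (-k) (min k (g s))"])
              (auto simp: truncate_at_def intro!: continuous_intros continuous_on_subset[OF g])
          show ?thesis unfolding eq
            by (intro continuous_on_open_Un 1 2 3) auto
        qed
        then have "isCont ?G s" using elim
          by (subst (asm) continuous_on_eq_continuous_at) (auto intro: open_Compl finite_imp_closed)
        moreover have "(\<lambda>n. t (n + N) + s) \<longlonglongrightarrow> 0 + s"
          by (intro tendsto_intros LIMSEQ_ignore_initial_segment t)
        ultimately have "(\<lambda>n. ?G (t (n + N) + s)) \<longlonglongrightarrow> ?G s"
          by (auto intro: isCont_tendsto_compose)
        then have "(\<lambda>n. (?G (t (n + N) + s) - ?G s)\<^sup>2) \<longlonglongrightarrow> (?G s - ?G s)\<^sup>2"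
          by (intro tendsto_intros)
        then show ?case by simp
      qed
    qed
    show "AE s in lebesgue. norm ((?G (t (n + N) + s) - ?G s)\<^sup>2) \<le> (2 * k)\<^sup>2 * indicator {-k-1..k+1} s" for n
    proof (rule AE_I2)
      fix s
      have "\<bar>?G (t (n + N) + s) - ?G s\<bar> \<le> 2 * k"
        using abs_truncate_at_le[OF k, of g s] abs_truncate_at_le[OF k, of g "t (n + N) + s"] by linarith
      then have "(?G (t (n + N) + s) - ?G s)\<^sup>2 \<le> (2 * k)\<^sup>2"
        using k by (metis abs_le_square_iff abs_of_nonneg zero_le_mult_iff zero_le_numeral)
      moreover have "?G (t (n + N) + s) = 0 \<and> ?G s = 0" if "s \<notin> {-k-1..k+1}"
        using that N[of "n + N"] by (auto simp: truncate_at_def indicator_def)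
      ultimately show "norm ((?G (t (n + N) + s) - ?G s)\<^sup>2) \<le> (2 * k)\<^sup>2 * indicator {-k-1..k+1} s"
        by (auto simp: indicator_def)
    qed
  qed (use integrable_indicator_Icc in auto)
  then show "(\<lambda>n. LINT s|lebesgue. (?G (t n + s) - ?G s)\<^sup>2) \<longlonglongrightarrow> 0"
    by (simp add: LIMSEQ_offset)
qed

text \<open>A Lebesgue measurable function is an almost everywhere limit of continuous ones.
  Truncation is continuous in the value and leaves a common majorant, so the truncated limit also
  holds in L2; this is the approximation that the closure lemma asks for.\<close>

lemma L2_translation_continuous_truncate:
  fixes F :: "real \<Rightarrow> real"
  assumes F: "F \<in> borel_measurable lebesgue" and k: "0 \<le> k"
  shows "L2_translation_continuous (truncate_at k F)"
proof (rule L2_translation_continuous_closure)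
  show "truncate_at k F \<in> borel_measurable lebesgue" "integrable lebesgue (\<lambda>s. (truncate_at k F s)\<^sup>2)"
    using F k by (auto intro: truncate_at_measurable truncate_at_square_integrable)
  from F have "F measurable_on UNIV"
    by (simp add: lebesgue_measurable_imp_measurable_on)
  then obtain N g where N: "negligible N" and g: "\<And>n. continuous_on UNIV (g n)"
    and lim: "\<And>x. x \<notin> N \<Longrightarrow> (\<lambda>n. g n x) \<longlonglongrightarrow> F x"
    unfolding measurable_on_def by auto
  have gm: "g n \<in> borel_measurable lebesgue" for n
    using g[of n] by (rule continuous_borel_measurable_lebesgue)
  have "(\<lambda>n. LINT s|lebesgue. (truncate_at k F s - truncate_at k (g n) s)\<^sup>2) \<longlonglongrightarrow> (LINT s|(lebesgue::real measure). 0)"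
  proof (rule integral_dominated_convergence[where w = "\<lambda>s. (2 * k)\<^sup>2 * indicator {-k..k} s"])
    show "(\<lambda>s. (truncate_at k F s - truncate_at k (g n) s)\<^sup>2) \<in> borel_measurable lebesgue" for n
      using truncate_at_measurable[OF F] truncate_at_measurable[OF gm] by simp
    have "AE s in lebesgue. s \<notin> N"
      using N by (intro AE_not_in) (simp add: negligible_iff_null_sets)
    then show "AE s in lebesgue. (\<lambda>n. (truncate_at k F s - truncate_at k (g n) s)\<^sup>2) \<longlonglongrightarrow> 0"
    proof eventually_elim
      case (elim s)
      then have "(\<lambda>n. (truncate_at k F s - truncate_at k (g n) s)\<^sup>2) \<longlonglongrightarrow> (truncate_at k F s - truncate_at k F s)\<^sup>2"
        unfolding truncate_at_def by (intro tendsto_intros lim)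
      then show ?case by simp
    qed
    show "AE s in lebesgue. norm ((truncate_at k F s - truncate_at k (g n) s)\<^sup>2) \<le> (2 * k)\<^sup>2 * indicator {-k..k} s" for n
    proof (rule AE_I2)
      fix s
      have "\<bar>truncate_at k F s - truncate_at k (g n) s\<bar> \<le> 2 * k"
        using abs_truncate_at_le[OF k, of F s] abs_truncate_at_le[OF k, of "g n" s] by linarith
      then have "(truncate_at k F s - truncate_at k (g n) s)\<^sup>2 \<le> (2 * k)\<^sup>2"
        using k by (metis abs_le_square_iff abs_of_nonneg zero_le_mult_iff zero_le_numeral)
      then show "norm ((truncate_at k F s - truncate_at k (g n) s)\<^sup>2) \<le> (2 * k)\<^sup>2 * indicator {-k..k} s"
        by (auto simp: indicator_def truncate_at_def)
    qed
  qed (use integrable_indicator_Icc in auto)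
  then have lim0: "(\<lambda>n. LINT s|lebesgue. (truncate_at k F s - truncate_at k (g n) s)\<^sup>2) \<longlonglongrightarrow> 0" by simp
  fix e :: real assume "0 < e"
  from eventually_happens[OF order_tendstoD(2)[OF lim0 this]] obtain n where
    "(LINT s|lebesgue. (truncate_at k F s - truncate_at k (g n) s)\<^sup>2) < e" by auto
  then show "\<exists>G. G \<in> borel_measurable lebesgue \<and> integrable lebesgue (\<lambda>s. (G s)\<^sup>2) \<and>
       L2_translation_continuous G \<and> (LINT s|lebesgue. (truncate_at k F s - G s)\<^sup>2) < e"
    using k g by (intro exI[of _ "truncate_at k (g n)"])
      (auto intro!: truncate_at_measurable truncate_at_square_integrable gm
        L2_translation_continuous_truncate_continuous)
qed

lemma L2_translation_continuousI:
  fixes F :: "real \<Rightarrow> real"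
  assumes F: "F \<in> borel_measurable lebesgue" "integrable lebesgue (\<lambda>s. (F s)\<^sup>2)"
  shows "L2_translation_continuous F"
proof (rule L2_translation_continuous_closure[OF F])
  fix e :: real assume "0 < e"
  then have "\<forall>\<^sub>F n in sequentially. (LINT s|lebesgue. (F s - truncate_at (real n) F s)\<^sup>2) < e"
    by (rule order_tendstoD(2)[OF truncate_at_L2_tendsto[OF F]])
  from eventually_happens[OF this] obtain n where
    "(LINT s|lebesgue. (F s - truncate_at (real n) F s)\<^sup>2) < e" by auto
  then show "\<exists>G. G \<in> borel_measurable lebesgue \<and> integrable lebesgue (\<lambda>s. (G s)\<^sup>2) \<and>
       L2_translation_continuous G \<and> (LINT s|lebesgue. (F s - G s)\<^sup>2) < e"
    using F by (intro exI[of _ "truncate_at (real n) F"])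
      (auto intro!: truncate_at_measurable truncate_at_square_integrable L2_translation_continuous_truncate)
qed

lemma tendsto_L2_translation:
  fixes F :: "real \<Rightarrow> real"
  assumes F: "F \<in> borel_measurable lebesgue" "integrable lebesgue (\<lambda>s. (F s)\<^sup>2)"
    and t: "t \<longlonglongrightarrow> t0"
  shows "(\<lambda>n. LINT s|lebesgue. (F (t n + s) - F (t0 + s))\<^sup>2) \<longlonglongrightarrow> 0"
proof -
  have "(\<lambda>n. t n - t0) \<longlonglongrightarrow> 0" using t by (simp add: LIM_zero)
  then have "(\<lambda>n. LINT s|lebesgue. (F (t n - t0 + s) - F s)\<^sup>2) \<longlonglongrightarrow> 0"
    using L2_translation_continuousI[OF F] unfolding L2_translation_continuous_def by blast
  moreover have "(LINT s|lebesgue. (F (t n - t0 + s) - F s)\<^sup>2) = (LINT s|lebesgue. (F (t n + s) - F (t0 + s))\<^sup>2)" for n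
    using integral_lebesgue_translate[of "\<lambda>s. (F (t n - t0 + s) - F s)\<^sup>2" t0]
    by (simp add: algebra_simps)
  ultimately show ?thesis by simp
qed

section \<open>Integrals over the half line\<close>

text \<open>For a concave function the difference quotient over a fraction \<open>u\<close> of the
  segment towards \<open>z + d\<close> is at least the full increment; let \<open>u\<close> tend to
  0 from the right. Concavity is asked for on this segment only, as the value function is concave on
  its domain.\<close>

lemma concave_tangent_le:
  fixes \<phi> :: "real \<Rightarrow> real"
  assumes deriv: "(\<phi> has_real_derivative P) (at z)"
    and conc: "\<And>u. 0 < u \<Longrightarrow> u < 1 \<Longrightarrow> (1 - u) * \<phi> z + u * \<phi> (z + d) \<le> \<phi> (z + u * d)"
  shows "\<phi> (z + d) \<le> \<phi> z + P * d"
proof -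
  have "((\<lambda>u. z + u * d) has_real_derivative d) (at 0)"
    by (auto intro!: derivative_eq_intros)
  from DERIV_chain'[OF this, of \<phi> P] deriv
  have "((\<lambda>u. \<phi> (z + u * d)) has_real_derivative P * d) (at 0)"
    by (simp add: mult.commute)
  then have "((\<lambda>u. (\<phi> (z + u * d) - \<phi> z) / u) \<longlongrightarrow> P * d) (at_right 0)"
    unfolding has_field_derivative_iff by (auto intro: filterlim_at_split[THEN iffD1, THEN conjunct2])
  moreover have "\<forall>\<^sub>F u in at_right 0. \<phi> (z + d) - \<phi> z \<le> (\<phi> (z + u * d) - \<phi> z) / u"
    unfolding eventually_at_right_field
  proof (intro exI[of _ 1] conjI allI impI)
    fix u :: real assume "0 < u" "u < 1"
    with conc[of u] show "\<phi> (z + d) - \<phi> z \<le> (\<phi> (z + u * d) - \<phi> z) / u"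
      by (simp add: field_simps)
  qed simp
  ultimately have "\<phi> (z + d) - \<phi> z \<le> P * d"
    by (intro tendsto_lowerbound) auto
  then show ?thesis by simp
qed

section \<open>Extended integrals and their real counterparts\<close>

lemma absolutely_integrable_iff_lebesgue_on:
  "S \<in> sets lebesgue \<Longrightarrow> f absolutely_integrable_on S \<longleftrightarrow> integrable (lebesgue_on S) f"
  by (simp add: set_integrable_eq)

lemma ext_integral_halfline_mono:
  assumes "\<And>t. 0 \<le> t \<Longrightarrow> g t \<le> h t"
  shows "ext_integral_halfline g \<le> ext_integral_halfline h"
  unfolding ext_integral_halfline_def
  using assms by (intro ereal_minus_mono)
    (auto simp: less_eq_ennreal.rep_eq[symmetric] intro!: nn_integral_mono ennreal_leI)

lemma ext_integral_halfline_cong: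
  assumes "\<And>t. 0 \<le> t \<Longrightarrow> g t = h t"
  shows "ext_integral_halfline g = ext_integral_halfline h"
  using assms by (intro antisym ext_integral_halfline_mono) auto

lemma ext_integral_halfline_eq_integral:
  assumes "g absolutely_integrable_on {0..}"
  shows "ext_integral_halfline g = ereal (integral {0..} g)"
proof -
  have g: "integrable (lebesgue_on {0..}) g"
    using assms by (simp add: absolutely_integrable_iff_lebesgue_on)
  then have fin: "(\<integral>\<^sup>+t. ennreal (g t) \<partial>lebesgue_on {0..}) \<noteq> \<infinity>"
    "(\<integral>\<^sup>+t. ennreal (- g t) \<partial>lebesgue_on {0..}) \<noteq> \<infinity>"
    by (auto simp: real_integrable_def)
  have *: "enn2ereal v = ereal (enn2real v)" if "v \<noteq> \<infinity>" for v
    using that by (cases v) (auto simp: enn2ereal_ennreal)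
  have "ereal (integral {0..} g) = ereal (LINT t|lebesgue_on {0..}. g t)"
    using g by (simp add: lebesgue_integral_eq_integral)
  also have "\<dots> = ext_integral_halfline g"
    unfolding ext_integral_halfline_def *[OF fin(1)] *[OF fin(2)] real_lebesgue_integral_def[OF g] by simp
  finally show ?thesis ..
qed

lemma exp_decay_absolutely_integrable:
  fixes \<rho> :: real
  assumes "0 < \<rho>"
  shows "(\<lambda>t. K * exp (- \<rho> * t)) absolutely_integrable_on {0..}"
    and "integral {0..} (\<lambda>t. K * exp (- \<rho> * t)) = K / \<rho>"
proof -
  have *: "((\<lambda>t. exp (- \<rho> * t)) has_integral 1 / \<rho>) {0..}"
    using has_integral_exp_minus_to_infinity[OF assms, of 0] by simp
  then have "(\<lambda>t. exp (- \<rho> * t)) absolutely_integrable_on {0..}"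
    by (intro nonnegative_absolutely_integrable_1) auto
  then show "(\<lambda>t. K * exp (- \<rho> * t)) absolutely_integrable_on {0..}"
    by (rule set_integrable_mult_right[rotated]) 
  show "integral {0..} (\<lambda>t. K * exp (- \<rho> * t)) = K / \<rho>"
    using integral_unique[OF has_integral_mult_right[OF *, of K]] by simp
qed

lemma ext_integral_halfline_le:
  fixes \<rho> :: real
  assumes "0 < \<rho>" and "\<And>t. 0 \<le> t \<Longrightarrow> g t \<le> K * exp (- \<rho> * t)"
  shows "ext_integral_halfline g \<le> ereal (K / \<rho>)"
  using ext_integral_halfline_mono[of g "\<lambda>t. K * exp (- \<rho> * t)"] assms
    ext_integral_halfline_eq_integral[OF exp_decay_absolutely_integrable(1)[OF assms(1)], of K]
    exp_decay_absolutely_integrable(2)[OF assms(1), of K] by simp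

text \<open>The exponential majorant makes the positive part integrable, so a value other than
  \<open>-\<infinity>\<close> forces the negative part to be integrable too. This turns finiteness
  of an objective into ordinary integrability.\<close>

lemma ext_integral_halfline_finite_imp_integrable:
  fixes \<rho> :: real
  assumes "0 < \<rho>" and le: "\<And>t. 0 \<le> t \<Longrightarrow> g t \<le> K * exp (- \<rho> * t)"
    and g: "g \<in> borel_measurable (lebesgue_on {0..})" and fin: "ext_integral_halfline g \<noteq> -\<infinity>"
  shows "g absolutely_integrable_on {0..}"
proof -
  have "integrable (lebesgue_on {0..}) (\<lambda>t. K * exp (- \<rho> * t))"
    using exp_decay_absolutely_integrable(1)[OF assms(1), of K]
    by (subst absolutely_integrable_iff_lebesgue_on[symmetric]) simp_all
  then have "(\<integral>\<^sup>+t. ennreal (K * exp (- \<rho> * t)) \<partial>lebesgue_on {0..}) \<noteq> \<infinity>"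
    unfolding real_integrable_def by blast
  moreover have "(\<integral>\<^sup>+t. ennreal (g t) \<partial>lebesgue_on {0..}) \<le> (\<integral>\<^sup>+t. ennreal (K * exp (- \<rho> * t)) \<partial>lebesgue_on {0..})"
  proof (rule nn_integral_mono)
    fix t :: real assume "t \<in> space (lebesgue_on {0..})"
    then have "0 \<le> t" by simp
    then show "ennreal (g t) \<le> ennreal (K * exp (- \<rho> * t))" by (intro ennreal_leI le)
  qed
  ultimately have pos: "(\<integral>\<^sup>+t. ennreal (g t) \<partial>lebesgue_on {0..}) \<noteq> \<infinity>"
    by (metis infinity_ennreal_def neq_top_trans)
  have neg: "(\<integral>\<^sup>+t. ennreal (- g t) \<partial>lebesgue_on {0..}) \<noteq> \<infinity>"
  proof
    assume "(\<integral>\<^sup>+t. ennreal (- g t) \<partial>lebesgue_on {0..}) = \<infinity>"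
    with fin pos show False unfolding ext_integral_halfline_def
      by (cases "\<integral>\<^sup>+t. ennreal (g t) \<partial>lebesgue_on {0..}") (auto simp: enn2ereal_ennreal)
  qed
  have "integrable (lebesgue_on {0..}) g"
    using g pos neg by (simp add: real_integrable_def)
  then show ?thesis by (simp add: absolutely_integrable_iff_lebesgue_on)
qed

text \<open>The negative part of \<open>g\<close> is not known to be integrable beforehand. The
  defect \<open>w\<close> from the majorant is nonnegative, and the assumed lower bounds on
  \<open>integral {0..t} g\<close> bound its integrals from above, so monotone convergence yields
  integrability and the estimate at once.\<close>

lemma ext_integral_halfline_geI:
  fixes \<rho> :: real
  assumes \<rho>: "0 < \<rho>" and le: "\<And>t. 0 \<le> t \<Longrightarrow> g t \<le> K * exp (- \<rho> * t)"
    and g: "\<And>t. 0 \<le> t \<Longrightarrow> g absolutely_integrable_on {0..t}"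
    and v: "\<And>t. 0 \<le> t \<Longrightarrow> v \<le> integral {0..t} g + exp (- \<rho> * t) * B"
  shows "ereal v \<le> ext_integral_halfline g"
proof -
  let ?e = "\<lambda>t. K * exp (- \<rho> * t)"
  define w where "w t = ?e t - g t" for t
  have e: "?e absolutely_integrable_on {0..}" by (rule exp_decay_absolutely_integrable(1)[OF \<rho>])
  have e': "?e absolutely_integrable_on {0..t}" for t
    by (rule set_integrable_subset[OF e]) auto
  have w: "w absolutely_integrable_on {0..t}" if "0 \<le> t" for t
    unfolding w_def using e' g[OF that] by (rule set_integral_diff(1))
  have w0: "0 \<le> w t" if "0 \<le> t" for t using le[OF that] by (simp add: w_def)
  define f where "f k t = (if t \<in> {0..real k} then w t else 0)" for k t
  have f_int: "integral {0..} (f k) = integral {0..real k} w" for k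
    unfolding f_def by (simp add: integral_restrict_Int Int_absorb1 Icc_subset_Ici_iff del: atLeastAtMost_iff)
  have w_int: "integral {0..real k} w \<le> integral {0..real k} ?e - v + exp (- \<rho> * real k) * B" for k
    using v[of "real k"] e' g[of "real k"] unfolding w_def
    by (subst Henstock_Kurzweil_Integration.integral_diff) (auto simp: absolutely_integrable_on_def)
  have lim_e: "(\<lambda>k. integral {0..real k} ?e) \<longlonglongrightarrow> K / \<rho>"
  proof -
    have "(\<lambda>k. LINT t:{0..real k}|lebesgue. ?e t) \<longlonglongrightarrow> (LINT t:{0..}|lebesgue. ?e t)"
      using filterlim_compose[OF tendsto_set_lebesgue_integral_at_top[OF _ e] filterlim_real_sequentially] by simp
    then show ?thesis
      unfolding set_lebesgue_integral_eq_integral(2)[OF e'] set_lebesgue_integral_eq_integral(2)[OF e]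
        exp_decay_absolutely_integrable(2)[OF \<rho>] .
  qed
  have lim: "(\<lambda>k. integral {0..real k} ?e - v + exp (- \<rho> * real k) * B) \<longlonglongrightarrow> K / \<rho> - v + 0 * B"
  proof (intro tendsto_intros lim_e)
    have "filterlim (\<lambda>k. \<rho> * real k) at_top sequentially"
      by (rule filterlim_tendsto_pos_mult_at_top[OF tendsto_const \<rho> filterlim_real_sequentially])
    then have "filterlim (\<lambda>k. - \<rho> * real k) at_bot sequentially"
      by (simp add: filterlim_uminus_at_top)
    then show "(\<lambda>k. exp (- \<rho> * real k)) \<longlonglongrightarrow> 0"
      by (rule filterlim_compose[OF exp_at_bot])
  qed
  have mc: "w integrable_on {0..} \<and> (\<lambda>k. integral {0..} (f k)) \<longlonglongrightarrow> integral {0..} w"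
  proof (rule monotone_convergence_increasing)
    show "f k integrable_on {0..}" for k
      using w[of "real k"] unfolding f_def
      by (simp add: integrable_restrict_Int Int_absorb1 Icc_subset_Ici_iff del: atLeastAtMost_iff add: absolutely_integrable_on_def)
    show "f k t \<le> f (Suc k) t" if "t \<in> {0..}" for k t
      using w0 that by (auto simp: f_def)
    show "(\<lambda>k. f k t) \<longlonglongrightarrow> w t" if "t \<in> {0..}" for t
    proof (rule tendsto_eventually)
      obtain N :: nat where N: "t \<le> real N" using real_arch_simple by blast
      show "\<forall>\<^sub>F k in sequentially. f k t = w t"
        using eventually_ge_at_top[of N] by eventually_elim (use that N in \<open>auto simp: f_def\<close>)
    qed
    obtain M where M: "\<And>k. \<bar>integral {0..real k} ?e - v + exp (- \<rho> * real k) * B\<bar> \<le> M"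
      using convergent_imp_Bseq[OF convergentI[OF lim]] unfolding Bseq_def real_norm_def by blast
    have "0 \<le> integral {0..real k} w" for k
      using w[of "real k"] w0 by (intro integral_nonneg) (auto simp: absolutely_integrable_on_def)
    moreover have "integral {0..real k} w \<le> M" for k
      using w_int[of k] M[of k] by linarith
    ultimately show "bounded (range (\<lambda>k. integral {0..} (f k)))"
      unfolding f_int bounded_iff by (intro exI[of _ M]) auto
  qed
  have "w absolutely_integrable_on {0..}"
    using mc w0 by (intro nonnegative_absolutely_integrable_1) auto
  then have g_int: "(\<lambda>t. ?e t - w t) absolutely_integrable_on {0..}"
    using e by (intro set_integral_diff(1))
  have "integral {0..} w \<le> K / \<rho> - v + 0 * B"
    by (rule LIMSEQ_le[OF _ lim]) (use mc f_int w_int in auto)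
  moreover have "integral {0..} (\<lambda>t. ?e t - w t) = K / \<rho> - integral {0..} w"
    using mc e exp_decay_absolutely_integrable(2)[OF \<rho>]
    by (subst Henstock_Kurzweil_Integration.integral_diff) (auto simp: absolutely_integrable_on_def)
  ultimately have "v \<le> integral {0..} (\<lambda>t. ?e t - w t)" by simp
  then show ?thesis
    using ext_integral_halfline_eq_integral[OF g_int] by (simp add: w_def)
qed

section \<open>Translated integrals and locally integrable functions\<close>

lemma absolutely_integrable_translate_iff:
  fixes f :: "real \<Rightarrow> real"
  shows "(\<lambda>s. f (h + s)) absolutely_integrable_on {a..b} \<longleftrightarrow> f absolutely_integrable_on {h + a..h + b}"
proof -
  have "(\<lambda>s. indicator {a..b} s *\<^sub>R f (h + s)) = (\<lambda>s. (\<lambda>u. indicator {h + a..h + b} u *\<^sub>R f u) (h + s))"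
    by (auto simp: indicator_def)
  then show ?thesis
    unfolding set_integrable_def by (metis (no_types) integrable_lebesgue_translate[of "\<lambda>u. indicator {h + a..h + b} u *\<^sub>R f u" h])
qed

lemma integral_translate:
  fixes f :: "real \<Rightarrow> real"
  assumes "f absolutely_integrable_on {h + a..h + b}"
  shows "integral {a..b} (\<lambda>s. f (h + s)) = integral {h + a..h + b} f"
proof -
  have "(\<lambda>s. indicator {a..b} s *\<^sub>R f (h + s)) = (\<lambda>s. (\<lambda>u. indicator {h + a..h + b} u *\<^sub>R f u) (h + s))"
    by (auto simp: indicator_def)
  then have "(LINT s:{a..b}|lebesgue. f (h + s)) = (LINT s:{h + a..h + b}|lebesgue. f s)"
    unfolding set_lebesgue_integral_def by (metis (no_types) integral_lebesgue_translate[of "\<lambda>u. indicator {h + a..h + b} u *\<^sub>R f u" h])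
  then show ?thesis
    using assms by (simp add: set_lebesgue_integral_eq_integral(2) absolutely_integrable_translate_iff)
qed

lemma absolutely_integrable_translate_halfline:
  fixes f :: "real \<Rightarrow> real"
  assumes f: "f absolutely_integrable_on {0..}" and h: "0 \<le> h"
  shows "(\<lambda>s. f (h + s)) absolutely_integrable_on {0..}"
    and "integral {0..} f = integral {0..h} f + integral {0..} (\<lambda>s. f (h + s))"
proof -
  have fh: "f absolutely_integrable_on {h..}" and f0: "f absolutely_integrable_on {0..h}"
    using h by (auto intro: set_integrable_subset[OF f])
  have eq: "(\<lambda>s. indicator {0..} s *\<^sub>R f (h + s)) = (\<lambda>s. (\<lambda>u. indicator {h..} u *\<^sub>R f u) (h + s))"
    by (auto simp: indicator_def)
  show i: "(\<lambda>s. f (h + s)) absolutely_integrable_on {0..}"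
    using fh unfolding set_integrable_def eq
    by (rule iffD2[OF integrable_lebesgue_translate[of "\<lambda>u. indicator {h..} u *\<^sub>R f u" h]])
  have "(LINT s:{0..}|lebesgue. f (h + s)) = (LINT s:{h..}|lebesgue. f s)"
    unfolding set_lebesgue_integral_def eq
    by (rule integral_lebesgue_translate[of "\<lambda>u. indicator {h..} u *\<^sub>R f u" h])
  then have 1: "integral {0..} (\<lambda>s. f (h + s)) = integral {h..} f"
    unfolding set_lebesgue_integral_eq_integral(2)[OF i] set_lebesgue_integral_eq_integral(2)[OF fh] .
  have "(f has_integral integral {0..h} f + integral {h..} f) ({0..h} \<union> {h..})"
  proof (rule has_integral_Un)
    have "{0..h} \<inter> {h..} = {h}" using h by auto
    then show "negligible ({0..h} \<inter> {h..})" by simp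
  qed (use f0 fh in \<open>auto simp: absolutely_integrable_on_def\<close>)
  moreover have "{0..h} \<union> {h..} = {0..}" using h by auto
  ultimately show "integral {0..} f = integral {0..h} f + integral {0..} (\<lambda>s. f (h + s))"
    unfolding 1 by (simp add: integral_unique)
qed

lemma borel_measurable_halfline:
  fixes g :: "real \<Rightarrow> real"
  assumes "\<And>t. 0 \<le> t \<Longrightarrow> g absolutely_integrable_on {0..t}"
  shows "g \<in> borel_measurable (lebesgue_on {0..})"
proof -
  have m: "(\<lambda>t. if t \<in> {0..real n} then g t else 0) \<in> borel_measurable lebesgue" for n
    using absolutely_integrable_imp_borel_measurable[OF assms, of "real n"] by (subst borel_measurable_if) auto
  have "(\<lambda>t. if t \<in> {0..} then g t else 0) \<in> borel_measurable lebesgue"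
  proof (rule borel_measurable_LIMSEQ_real[OF _ m])
    fix t :: real
    obtain N :: nat where N: "t \<le> real N" using real_arch_simple by blast
    show "(\<lambda>n. if t \<in> {0..real n} then g t else 0) \<longlonglongrightarrow> (if t \<in> {0..} then g t else 0)"
      by (rule tendsto_eventually, use eventually_ge_at_top[of N] in eventually_elim) (use N in auto)
  qed
  then show ?thesis by (subst (asm) borel_measurable_if) auto
qed

lemma continuous_on_indefinite_integral_halfline:
  fixes g :: "real \<Rightarrow> real"
  assumes "\<And>t. 0 \<le> t \<Longrightarrow> g integrable_on {0..t}"
  shows "continuous_on {0..} (\<lambda>t. integral {0..t} g)"
  unfolding continuous_on_eq_continuous_within
proof
  fix t :: real assume t: "t \<in> {0..}"
  have "continuous_on {0..t+1} (\<lambda>t. integral {0..t} g)"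
    using t by (intro indefinite_integral_continuous_1 assms) auto
  then have "continuous (at t within {0..t+1}) (\<lambda>t. integral {0..t} g)"
    using t by (simp add: continuous_on_eq_continuous_within)
  moreover have "at t within {0..t+1} = at t within {0..}"
    by (rule at_within_nhd[of _ "{..<t+1}"]) (use t in auto)
  ultimately show "continuous (at t within {0..}) (\<lambda>t. integral {0..t} g)" by (simp add: continuous_within)
qed

section \<open>Square integrable histories\<close>

text \<open>The restrictions are encoded by indicator factors, which makes them functions on the
  whole line to which continuity of translations applies; \<open>N\<close> is finite because
  trajectories may grow.\<close>

definition locally_L2 :: "real \<Rightarrow> (real \<Rightarrow> real) \<Rightarrow> bool" where
  "locally_L2 T x \<longleftrightarrow>
     (\<forall>N. (\<lambda>s. indicator {-T..N} s * x s) \<in> borel_measurable lebesgue \<and>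
          integrable lebesgue (\<lambda>s. (indicator {-T..N} s * x s)\<^sup>2))"

lemma locally_L2I:
  assumes g: "g \<in> L2_past T" and eq: "\<And>s. -T \<le> s \<Longrightarrow> s < 0 \<Longrightarrow> x s = g s"
    and cont: "continuous_on {0..} x"
  shows "locally_L2 T x"
  unfolding locally_L2_def
proof (intro allI)
  fix N :: real
  let ?g = "\<lambda>s. if s \<in> {-T..0} then g s else 0" and ?x = "\<lambda>s. if s \<in> {0..N} then x s else 0"
  have gm: "?g \<in> borel_measurable lebesgue"
    using g by (subst borel_measurable_if) (auto simp: L2_past_def)
  have xm: "?x \<in> borel_measurable lebesgue"
    using continuous_imp_measurable_on_sets_lebesgue[OF continuous_on_subset[OF cont], of "{0..N}"]
    by (subst borel_measurable_if) auto
  have ind: "(indicator A :: real \<Rightarrow> real) \<in> borel_measurable lebesgue" if "A \<in> sets borel" for A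
    using that by (intro borel_measurable_indicator) auto
  have eq': "indicator {-T..N} s * x s = indicator {-T..N} s * (indicator {..<0} s * ?g s * indicator {..N} s + ?x s)" for s
    using eq[of s] by (auto simp: indicator_def)
  show "(\<lambda>s. indicator {-T..N} s * x s) \<in> borel_measurable lebesgue \<and>
          integrable lebesgue (\<lambda>s. (indicator {-T..N} s * x s)\<^sup>2)"
  proof (intro conjI)
    show m: "(\<lambda>s. indicator {-T..N} s * x s) \<in> borel_measurable lebesgue"
      unfolding eq' by (intro borel_measurable_times borel_measurable_add ind gm xm) auto
    have "(\<lambda>s. (g s)\<^sup>2) absolutely_integrable_on {-T..0}"
      using g by (subst absolutely_integrable_iff_lebesgue_on) (auto simp: L2_past_def)
    moreover have "(\<lambda>s. (x s)\<^sup>2) absolutely_integrable_on {0..N}"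
      by (intro absolutely_integrable_continuous_real continuous_intros continuous_on_subset[OF cont]) auto
    ultimately have "integrable lebesgue (\<lambda>s. indicator {-T..0} s *\<^sub>R (g s)\<^sup>2 + indicator {0..N} s *\<^sub>R (x s)\<^sup>2)"
      unfolding set_integrable_def by (rule Bochner_Integration.integrable_add)
    then show "integrable lebesgue (\<lambda>s. (indicator {-T..N} s * x s)\<^sup>2)"
    proof (rule Bochner_Integration.integrable_bound)
      show "AE s in lebesgue. norm ((indicator {-T..N} s * x s)\<^sup>2) \<le>
         norm (indicator {-T..0} s *\<^sub>R (g s)\<^sup>2 + indicator {0..N} s *\<^sub>R (x s)\<^sup>2)"
      proof (rule AE_I2)
        fix s
        show "norm ((indicator {-T..N} s * x s)\<^sup>2) \<le>
         norm (indicator {-T..0} s *\<^sub>R (g s)\<^sup>2 + indicator {0..N} s *\<^sub>R (x s)\<^sup>2)"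
          using eq[of s] by (auto simp: indicator_def)
      qed
    qed (use m in simp)
  qed
qed

lemma integrable_lebesgue_on:
  fixes f :: "real \<Rightarrow> real"
  assumes "integrable lebesgue f" "S \<in> sets lebesgue"
  shows "integrable (lebesgue_on S) f"
proof -
  have "integrable lebesgue (\<lambda>s. indicator S s *\<^sub>R f s)"
    by (rule integrable_mult_indicator[OF assms(2,1)])
  then show ?thesis using assms(2) by (subst integrable_restrict_space) simp_all
qed

lemma integral_lebesgue_on_le:
  fixes f :: "real \<Rightarrow> real"
  assumes "integrable lebesgue f" "S \<in> sets lebesgue" "\<And>s. 0 \<le> f s"
  shows "integral\<^sup>L (lebesgue_on S) f \<le> integral\<^sup>L lebesgue f"
proof -
  have i: "integrable lebesgue (\<lambda>s. indicator S s *\<^sub>R f s)"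
    by (rule integrable_mult_indicator[OF assms(2,1)])
  have "integral\<^sup>L (lebesgue_on S) f = (LINT s|lebesgue. indicator S s *\<^sub>R f s)"
    using assms(2) by (subst integral_restrict_space) simp_all
  also have "\<dots> \<le> integral\<^sup>L lebesgue f"
    by (rule integral_mono[OF i assms(1)]) (use assms(3) in \<open>auto simp: indicator_def\<close>)
  finally show ?thesis .
qed

lemma locally_L2_segment:
  assumes "locally_L2 T x" "0 \<le> t"
  shows "(\<lambda>s. x (t + s)) \<in> L2_past T"
proof -
  let ?F = "\<lambda>s. indicator {-T..t} s * x s"
  have F: "?F \<in> borel_measurable lebesgue" "integrable lebesgue (\<lambda>s. (?F s)\<^sup>2)"
    using assms unfolding locally_L2_def by auto
  have eq: "?F (t + s) = x (t + s)" if "s \<in> {-T..0}" for s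
    using that assms(2) by (auto simp: indicator_def)
  have "(\<lambda>s. ?F (t + s)) \<in> borel_measurable (lebesgue_on {-T..0})"
    by (rule measurable_restrict_space1[OF measurable_lebesgue_translate[OF F(1)]])
  moreover have "integrable (lebesgue_on {-T..0}) (\<lambda>s. (?F (t + s))\<^sup>2)"
  proof -
    have "integrable lebesgue (\<lambda>s. (?F (t + s))\<^sup>2)"
      using F(2) by (subst integrable_lebesgue_translate)
    then show ?thesis by (rule integrable_lebesgue_on) simp
  qed
  moreover have "(\<lambda>s. ?F (t + s)) \<in> borel_measurable (lebesgue_on {-T..0})
      \<longleftrightarrow> (\<lambda>s. x (t + s)) \<in> borel_measurable (lebesgue_on {-T..0})"
    by (rule measurable_cong, rule eq) simp
  moreover have "integrable (lebesgue_on {-T..0}) (\<lambda>s. (?F (t + s))\<^sup>2)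
      \<longleftrightarrow> integrable (lebesgue_on {-T..0}) (\<lambda>s. (x (t + s))\<^sup>2)"
    by (intro Bochner_Integration.integrable_cong refl, subst eq) simp_all
  ultimately show ?thesis
    unfolding L2_past_def by blast
qed

lemma L2_past_integrable:
  assumes "g \<in> L2_past T"
  shows "integrable (lebesgue_on {-T..0}) g" "integrable (lebesgue_on {-T..0}) (\<lambda>s. \<bar>g s\<bar>)"
proof -
  interpret finite_measure "lebesgue_on {-T..0}"
    by (rule finite_measure_lebesgue_on) simp
  have "integrable (lebesgue_on {-T..0}) (\<lambda>s. 1 + (g s)\<^sup>2)"
    using assms by (auto simp: L2_past_def)
  then show *: "integrable (lebesgue_on {-T..0}) g"
  proof (rule Bochner_Integration.integrable_bound)
    show "AE s in lebesgue_on {-T..0}. norm (g s) \<le> norm (1 + (g s)\<^sup>2)"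
    proof (rule AE_I2)
      fix s
      have "\<bar>g s\<bar> \<le> 1 + (g s)\<^sup>2" using sum_squares_bound[of 1 "\<bar>g s\<bar>"] by simp
      then show "norm (g s) \<le> norm (1 + (g s)\<^sup>2)" by simp
    qed
  qed (use assms in \<open>simp add: L2_past_def\<close>)
  then show "integrable (lebesgue_on {-T..0}) (\<lambda>s. \<bar>g s\<bar>)" by simp
qed

lemma L2_past_diff:
  assumes "f \<in> L2_past T" "g \<in> L2_past T"
  shows "(\<lambda>s. f s - g s) \<in> L2_past T"
  using assms square_integrable_add(2) unfolding L2_past_def by auto

text \<open>All the windows ending at \<open>u n\<close> or \<open>t\<close> lie in
  \<open>{-T..N}\<close>, where the cut-off function agrees with \<open>x\<close>. The statement for
  translations on the whole line thus bounds the distance on the window.\<close>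

lemma segment_L2_tendsto:
  assumes x: "locally_L2 T x" and u: "\<And>n. 0 \<le> u n" "0 \<le> t" "u \<longlonglongrightarrow> t"
  shows "(\<lambda>n. LINT s|lebesgue_on {-T..0}. (x (u n + s) - x (t + s))\<^sup>2) \<longlonglongrightarrow> 0"
proof -
  obtain N where N: "\<And>n. \<bar>u n\<bar> \<le> N" 
    using convergent_imp_Bseq[OF convergentI[OF u(3)]] unfolding Bseq_def real_norm_def by blast
  have Nt: "t \<le> N" using LIMSEQ_le_const2[OF u(3), of N] N by (meson abs_le_D1)
  let ?F = "\<lambda>s. indicator {-T..N} s * x s"
  have F: "?F \<in> borel_measurable lebesgue" "integrable lebesgue (\<lambda>s. (?F s)\<^sup>2)"
    using x unfolding locally_L2_def by auto
  have lim: "(\<lambda>n. LINT s|lebesgue. (?F (u n + s) - ?F (t + s))\<^sup>2) \<longlonglongrightarrow> 0"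
    by (rule tendsto_L2_translation[OF F u(3)])
  show ?thesis
  proof (rule tendsto_sandwich[OF _ _ tendsto_const lim])
    show "\<forall>\<^sub>F n in sequentially. (LINT s|lebesgue_on {-T..0}. (x (u n + s) - x (t + s))\<^sup>2)
        \<le> (LINT s|lebesgue. (?F (u n + s) - ?F (t + s))\<^sup>2)"
    proof (rule always_eventually, rule allI)
      fix n
      have eq: "x (u n + s) = ?F (u n + s)" "x (t + s) = ?F (t + s)" if "s \<in> {-T..0}" for s
        using that u(1)[of n] u(2) N[of n] Nt by (auto simp: indicator_def)
      have int: "integrable lebesgue (\<lambda>s. (?F (u n + s) - ?F (t + s))\<^sup>2)"
      proof (rule square_integrable_add)
        show "integrable lebesgue (\<lambda>s. (?F (u n + s))\<^sup>2)"
          by (rule iffD2[OF integrable_lebesgue_translate[of "\<lambda>s. (?F s)\<^sup>2" "u n"] F(2)])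
        show "integrable lebesgue (\<lambda>s. (?F (t + s))\<^sup>2)"
          by (rule iffD2[OF integrable_lebesgue_translate[of "\<lambda>s. (?F s)\<^sup>2" t] F(2)])
        show "(\<lambda>s. ?F (u n + s)) \<in> borel_measurable lebesgue"
          by (rule measurable_lebesgue_translate[OF F(1), of "u n"])
        show "(\<lambda>s. ?F (t + s)) \<in> borel_measurable lebesgue"
          by (rule measurable_lebesgue_translate[OF F(1), of t])
      qed
      have "(LINT s|lebesgue_on {-T..0}. (x (u n + s) - x (t + s))\<^sup>2)
          = (LINT s|lebesgue_on {-T..0}. (?F (u n + s) - ?F (t + s))\<^sup>2)"
      proof (rule Bochner_Integration.integral_cong[OF refl])
        fix s assume "s \<in> space (lebesgue_on {-T..0})"
        then have "s \<in> {-T..0}" by simp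
        show "(x (u n + s) - x (t + s))\<^sup>2 = (?F (u n + s) - ?F (t + s))\<^sup>2"
          by (simp only: eq[OF \<open>s \<in> {-T..0}\<close>, symmetric])
      qed
      also have "\<dots> \<le> (LINT s|lebesgue. (?F (u n + s) - ?F (t + s))\<^sup>2)"
        using int by (rule integral_lebesgue_on_le) auto
      finally show "(LINT s|lebesgue_on {-T..0}. (x (u n + s) - x (t + s))\<^sup>2)
        \<le> (LINT s|lebesgue. (?F (u n + s) - ?F (t + s))\<^sup>2)" .
    qed
  qed auto
qed

lemma segment_H_dist_tendsto:
  assumes x: "locally_L2 T x" and u: "\<And>n. 0 \<le> u n" "0 \<le> t" "u \<longlonglongrightarrow> t" and cont: "continuous_on {0..} x"
  shows "(\<lambda>n. H_dist T (segment x (u n)) (segment x t)) \<longlonglongrightarrow> 0"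
proof -
  have "(\<lambda>n. x (u n)) \<longlonglongrightarrow> x t"
    using cont u unfolding continuous_on_sequentially by (auto simp: o_def)
  then have "(\<lambda>n. sqrt ((x (u n) - x t)\<^sup>2 +
      (LINT s|lebesgue_on {-T..0}. (x (u n + s) - x (t + s))\<^sup>2))) \<longlonglongrightarrow> sqrt ((x t - x t)\<^sup>2 + 0)"
    by (intro tendsto_intros segment_L2_tendsto[OF x u])
  then show ?thesis by (simp add: H_dist_def segment_def)
qed

text \<open>This is the source of the additional factor \<open>h\<close>: two solutions with a
  common past differ at time \<open>h\<close> only on the last part of the window, of length
  \<open>h\<close>, and there they are uniformly close.\<close>

lemma past_integral_le:
  fixes z :: "real \<Rightarrow> real"
  assumes z: "integrable (lebesgue_on {-T..0}) z" and S: "0 \<le> S" "0 \<le> w"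
    and le: "\<And>u. u \<in> {-T..0} \<Longrightarrow> -w \<le> u \<Longrightarrow> \<bar>z u\<bar> \<le> S"
    and zero: "\<And>u. u \<in> {-T..0} \<Longrightarrow> u < -w \<Longrightarrow> z u = 0"
  shows "(LINT u|lebesgue_on {-T..0}. \<bar>z u\<bar>) \<le> S * w"
proof -
  have i: "integrable lebesgue (\<lambda>u. S * indicator {-w..0} u)" by (rule integrable_indicator_Icc)
  have "(LINT u|lebesgue_on {-T..0}. \<bar>z u\<bar>) \<le> (LINT u|lebesgue_on {-T..0}. S * indicator {-w..0} u)"
  proof (rule integral_mono)
    show "integrable (lebesgue_on {-T..0}) (\<lambda>u. \<bar>z u\<bar>)" using z by simp
    show "integrable (lebesgue_on {-T..0}) (\<lambda>u. S * indicator {-w..0} u)"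
      by (rule integrable_lebesgue_on[OF i]) simp
    fix u assume "u \<in> space (lebesgue_on {-T..0})"
    then show "\<bar>z u\<bar> \<le> S * indicator {-w..0} u"
      using le[of u] zero[of u] by (cases "u < -w") (auto simp: indicator_def)
  qed
  also have "\<dots> \<le> (LINT u|lebesgue. S * indicator {-w..0} u)"
    by (rule integral_lebesgue_on_le[OF i]) (use S in \<open>auto simp: indicator_def\<close>)
  also have "\<dots> = S * w" using S by simp
  finally show ?thesis .
qed

section \<open>The delay equation\<close>

locale delay_dynamics =
  fixes T r :: real and a :: "real \<Rightarrow> real" and f\<^sub>0 :: "real \<Rightarrow> real \<Rightarrow> real" and C :: real
  assumes T_pos: "0 < T" and r_pos: "0 < r" and dyn: "dynamics_assms T a f\<^sub>0 C"
begin

lemma C_nonneg: "0 \<le> C"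
  using dyn unfolding dynamics_assms_def by (auto dest: lipschitz_on_nonneg)

text \<open>The extension to negative arguments keeps the constant, since \<open>max 0\<close> is
  nonexpansive; the sum of the two differences dominates the Euclidean distance of the
  product.\<close>

lemma f0_lipschitz: "\<bar>f\<^sub>0 (max 0 u) v - f\<^sub>0 (max 0 u') v'\<bar> \<le> C * (\<bar>u - u'\<bar> + \<bar>v - v'\<bar>)"
proof -
  have "C-lipschitz_on ({0..} \<times> UNIV) (\<lambda>(x, y). f\<^sub>0 x y)"
    using dyn by (auto simp: dynamics_assms_def)
  from lipschitz_onD[OF this, of "(max 0 u, v)" "(max 0 u', v')"]
  have "\<bar>f\<^sub>0 (max 0 u) v - f\<^sub>0 (max 0 u') v'\<bar> \<le> C * dist (max 0 u, v) (max 0 u', v')"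
    by (simp add: dist_real_def)
  also have "dist (max 0 u, v) (max 0 u', v') \<le> \<bar>max 0 u - max 0 u'\<bar> + \<bar>v - v'\<bar>"
    unfolding dist_Pair_Pair dist_real_def by (rule sqrt_sum_squares_le_sum) auto
  also have "\<dots> \<le> \<bar>u - u'\<bar> + \<bar>v - v'\<bar>" by auto
  finally show ?thesis using C_nonneg by (simp add: mult_left_mono)
qed

lemma f0_mono: "v \<le> v' \<Longrightarrow> f\<^sub>0 (max 0 u) v \<le> f\<^sub>0 (max 0 u) v'"
proof -
  assume "v \<le> v'"
  moreover have "mono (f\<^sub>0 (max 0 u))" using dyn unfolding dynamics_assms_def by simp
  ultimately show ?thesis by (simp add: monoD)
qed

lemma f0_continuous:
  assumes "continuous_on S u" "continuous_on S v"
  shows "continuous_on S (\<lambda>s. f\<^sub>0 (max 0 (u s)) (v s))"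
proof -
  have "continuous_on ({0..} \<times> UNIV) (\<lambda>(x, y). f\<^sub>0 x y)"
    using dyn by (auto simp: dynamics_assms_def intro: lipschitz_on_continuous_on)
  moreover have "continuous_on S (\<lambda>s. (max 0 (u s), v s))"
    by (intro continuous_intros assms)
  moreover have "(\<lambda>s. (max 0 (u s), v s)) ` S \<subseteq> {0..} \<times> UNIV"
    by (intro image_subsetI SigmaI) auto
  ultimately show ?thesis
    using continuous_on_compose2[of "{0..} \<times> UNIV" "\<lambda>(x, y). f\<^sub>0 x y" S "\<lambda>s. (max 0 (u s), v s)"] by simp
qed

text \<open>A bound on the kernel makes the delay term Lipschitz for the L1 distance of pasts. A
  discrepancy on a window of length \<open>h\<close> then costs a factor \<open>h\<close>, where the
  Cauchy-Schwarz inequality with the L2 norm of the kernel would give its square root.\<close>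

definition A where "A = (SUP s\<in>{-T..0}. a s)"

lemma a_continuous: "continuous_on {-T..0} a" and a_nonneg: "s \<in> {-T..0} \<Longrightarrow> 0 \<le> a s"
  using dyn by (auto simp: dynamics_assms_def W12_past_def)

lemma a_le_A:
  assumes "s \<in> {-T..0}" shows "a s \<le> A"
proof -
  have "compact (a ` {-T..0})" by (intro compact_continuous_image a_continuous) simp
  then have "bdd_above (a ` {-T..0})" by (intro bounded_imp_bdd_above compact_imp_bounded)
  then show ?thesis unfolding A_def using assms by (rule cSUP_upper[rotated])
qed

lemma A_nonneg: "0 \<le> A"
  using a_nonneg[of 0] a_le_A[of 0] T_pos by auto

lemma a_measurable: "a \<in> borel_measurable (lebesgue_on {-T..0})"
  by (intro continuous_imp_measurable_on_sets_lebesgue a_continuous) auto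

lemma a_times_integrable:
  assumes "g \<in> L2_past T"
  shows "integrable (lebesgue_on {-T..0}) (\<lambda>s. a s * g s)"
proof (rule Bochner_Integration.integrable_bound[where f = "\<lambda>s. A * \<bar>g s\<bar>"])
  show "integrable (lebesgue_on {-T..0}) (\<lambda>s. A * \<bar>g s\<bar>)"
    using L2_past_integrable[OF assms] by simp
  show "(\<lambda>s. a s * g s) \<in> borel_measurable (lebesgue_on {-T..0})"
    using a_measurable assms by (auto simp: L2_past_def)
  show "AE s in lebesgue_on {-T..0}. norm (a s * g s) \<le> norm (A * \<bar>g s\<bar>)"
  proof (rule AE_I2)
    fix s assume "s \<in> space (lebesgue_on {-T..0})"
    then show "norm (a s * g s) \<le> norm (A * \<bar>g s\<bar>)"
      using a_nonneg[of s] a_le_A[of s] A_nonneg by (auto simp: abs_mult intro!: mult_right_mono)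
  qed
qed

lemma delay_term_diff:
  assumes "locally_L2 T x" "locally_L2 T y" "0 \<le> t" "0 \<le> u"
  shows "delay_term T a x t - delay_term T a y u =
    (LINT s|lebesgue_on {-T..0}. a s * (x (t + s) - y (u + s)))"
  unfolding delay_term_def right_diff_distrib
  by (rule Bochner_Integration.integral_diff[symmetric])
    (intro a_times_integrable locally_L2_segment assms)+

lemma delay_term_diff_le:
  assumes "locally_L2 T x" "locally_L2 T y" "0 \<le> t" "0 \<le> u"
  shows "\<bar>delay_term T a x t - delay_term T a y u\<bar> \<le>
    A * (LINT s|lebesgue_on {-T..0}. \<bar>x (t + s) - y (u + s)\<bar>)"
proof -
  have d: "(\<lambda>s. x (t + s) - y (u + s)) \<in> L2_past T"
    by (intro L2_past_diff locally_L2_segment assms)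
  have "\<bar>delay_term T a x t - delay_term T a y u\<bar> \<le> (LINT s|lebesgue_on {-T..0}. A * \<bar>x (t + s) - y (u + s)\<bar>)"
    unfolding delay_term_diff[OF assms] real_norm_def[symmetric]
  proof (rule Bochner_Integration.integral_norm_bound_integral)
    show "integrable (lebesgue_on {-T..0}) (\<lambda>s. a s * (x (t + s) - y (u + s)))"
      using a_times_integrable[OF d] .
    show "integrable (lebesgue_on {-T..0}) (\<lambda>s. A * norm (x (t + s) - y (u + s)))"
      using L2_past_integrable(2)[OF d] by simp
    show "norm (a s * (x (t + s) - y (u + s))) \<le> A * norm (x (t + s) - y (u + s))"
      if "s \<in> space (lebesgue_on {-T..0})" for s
      using that a_nonneg[of s] a_le_A[of s] by (auto simp: abs_mult intro!: mult_right_mono)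
  qed
  then show ?thesis by simp
qed

lemma delay_term_continuous:
  assumes x: "locally_L2 T x"
  shows "continuous_on {0..} (delay_term T a x)"
  unfolding continuous_on_sequentially
proof (intro allI ballI impI)
  fix u t assume "t \<in> {0::real..}" and "(\<forall>n::nat. u n \<in> {0..}) \<and> u \<longlonglongrightarrow> t"
  then have u: "\<And>n. 0 \<le> u n" "0 \<le> t" "u \<longlonglongrightarrow> t" by auto
  let ?q = "\<lambda>n. LINT s|lebesgue_on {-T..0}. (x (u n + s) - x (t + s))\<^sup>2"
  have q0: "?q \<longlonglongrightarrow> 0" by (rule segment_L2_tendsto[OF x u])
  show "(delay_term T a x \<circ> u) \<longlonglongrightarrow> delay_term T a x t"
  proof (rule LIMSEQ_I)
    fix e :: real assume e: "0 < e"
    \<comment> \<open>Chosen so that \<open>A * (d * T + d)\<close> is at most \<open>e / 2\<close>;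
      \<open>A + 1\<close> covers the case of a vanishing kernel.\<close>
    define d where "d = e / (2 * (A + 1) * (T + 1))"
    have d: "0 < d" using e A_nonneg T_pos by (simp add: d_def)
    have "\<forall>\<^sub>F n in sequentially. ?q n < d\<^sup>2"
      using order_tendstoD(2)[OF q0] d by simp
    then obtain N where N: "\<And>n. n \<ge> N \<Longrightarrow> ?q n < d\<^sup>2" by (auto simp: eventually_sequentially)
    show "\<exists>N. \<forall>n\<ge>N. norm ((delay_term T a x \<circ> u) n - delay_term T a x t) < e"
    proof (intro exI allI impI)
      fix n assume n: "N \<le> n"
      have diff: "(\<lambda>s. x (u n + s) - x (t + s)) \<in> L2_past T"
        by (intro L2_past_diff locally_L2_segment x u)
      interpret finite_measure "lebesgue_on {-T..0}"
        by (rule finite_measure_lebesgue_on) simp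
      have sq: "integrable (lebesgue_on {-T..0}) (\<lambda>s. (x (u n + s) - x (t + s))\<^sup>2)"
        using diff by (simp add: L2_past_def)
      \<comment> \<open>From L2 to L1 by \<open>z \<le> d + z\<^sup>2 / d\<close>, integrated over
        an interval of length \<open>T\<close>.\<close>
      have "(LINT s|lebesgue_on {-T..0}. \<bar>x (u n + s) - x (t + s)\<bar>)
          \<le> (LINT s|lebesgue_on {-T..0}. d + (x (u n + s) - x (t + s))\<^sup>2 / d)"
      proof (rule integral_mono)
        show "\<bar>x (u n + s) - x (t + s)\<bar> \<le> d + (x (u n + s) - x (t + s))\<^sup>2 / d" for s
        proof -
          define z where "z = \<bar>x (u n + s) - x (t + s)\<bar>"
          have "2 * d * z \<le> d\<^sup>2 + z\<^sup>2" by (rule sum_squares_bound)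
          moreover have "0 \<le> d * z" using d by (simp add: z_def)
          ultimately have "d * z \<le> d\<^sup>2 + z\<^sup>2" by linarith
          then have "z \<le> d + z\<^sup>2 / d" using d by (simp add: field_simps power2_eq_square)
          then show ?thesis by (simp add: z_def)
        qed
      qed (use L2_past_integrable(2)[OF diff] sq in auto)
      also have "\<dots> = d * T + ?q n / d"
        using sq T_pos by (simp add: measure_restrict_space)
      also have "\<dots> \<le> d * T + d"
        using N[OF n] d by (simp add: field_simps power2_eq_square)
      finally have "\<bar>delay_term T a x (u n) - delay_term T a x t\<bar> \<le> A * (d * T + d)"
        using delay_term_diff_le[OF x x, of "u n" t] u A_nonneg by (meson mult_left_mono order_trans)
      also have "\<dots> = A * (d * (T + 1))" by (simp add: algebra_simps)
      also have "\<dots> \<le> (A + 1) * (d * (T + 1))" using d T_pos by (intro mult_right_mono) auto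
      also have "\<dots> = e / 2"
      proof -
        have "2 * (A + 1) * (T + 1) \<noteq> 0" using A_nonneg T_pos by simp
        then have "d * (2 * (A + 1) * (T + 1)) = e" unfolding d_def by simp
        then show ?thesis by (simp add: algebra_simps)
      qed
      finally show "norm ((delay_term T a x \<circ> u) n - delay_term T a x t) < e" using e by simp
    qed
  qed
qed

section \<open>Integral form of the equation and its time shifts\<close>

text \<open>Without the control, the right-hand side is continuous along a continuous trajectory
  with square integrable past, so that integrability concerns the control alone.\<close>

definition drift :: "(real \<Rightarrow> real) \<Rightarrow> real \<Rightarrow> real" where
  "drift x s = r * x s + f\<^sub>0 (max 0 (x s)) (delay_term T a x s)"

lemma delay_rhs_eq: "delay_rhs T r a f\<^sub>0 c x s = drift x s - c s"
  by (simp add: delay_rhs_def drift_def)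

lemma drift_continuous:
  assumes "locally_L2 T x" "continuous_on {0..} x"
  shows "continuous_on {0..} (drift x)"
  unfolding drift_def by (intro continuous_intros f0_continuous delay_term_continuous assms)

lemma drift_integrable:
  assumes "locally_L2 T x" "continuous_on {0..} x" "0 \<le> s"
  shows "drift x absolutely_integrable_on {s..t}"
  using assms(3) by (intro absolutely_integrable_continuous_real
      continuous_on_subset[OF drift_continuous[OF assms(1,2)]]) auto

lemma solution_continuous:
  assumes "delay_solution T r a f\<^sub>0 \<eta> c x"
  shows "continuous_on {0..} x"
proof -
  have i: "delay_rhs T r a f\<^sub>0 c x integrable_on {0..t}"
    and eq: "fst \<eta> + integral {0..t} (delay_rhs T r a f\<^sub>0 c x) = x t" if "0 \<le> t" for t
    using assms that unfolding delay_solution_def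
    by (auto simp: set_lebesgue_integral_eq_integral(2) absolutely_integrable_on_def)
  have "continuous_on {0..} (\<lambda>t. fst \<eta> + integral {0..t} (delay_rhs T r a f\<^sub>0 c x))"
    by (intro continuous_intros continuous_on_indefinite_integral_halfline i)
  then show ?thesis by (rule continuous_on_eq) (use eq in auto)
qed

lemma solution_locally_L2:
  assumes "delay_solution T r a f\<^sub>0 \<eta> c x" "snd \<eta> \<in> L2_past T"
  shows "locally_L2 T x"
  by (rule locally_L2I[OF assms(2) _ solution_continuous[OF assms(1)]])
    (use assms(1) in \<open>auto simp: delay_solution_def\<close>)

text \<open>The control is the difference of the continuous drift and the integrable right-hand
  side. For the feedback control, local integrability, and with it admissibility, is obtained in
  this way.\<close>

lemma solution_control_integrable:
  assumes "delay_solution T r a f\<^sub>0 \<eta> c x" "snd \<eta> \<in> L2_past T" "0 \<le> s"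
  shows "c absolutely_integrable_on {s..t}"
proof -
  have "delay_rhs T r a f\<^sub>0 c x absolutely_integrable_on {0..max 0 t}"
    using assms(1) by (auto simp: delay_solution_def)
  then have "delay_rhs T r a f\<^sub>0 c x absolutely_integrable_on {s..t}"
    by (rule set_integrable_subset) (use assms(3) in auto)
  moreover have "drift x absolutely_integrable_on {s..t}"
    using assms by (intro drift_integrable solution_locally_L2 solution_continuous)
  ultimately have "(\<lambda>u. drift x u - delay_rhs T r a f\<^sub>0 c x u) absolutely_integrable_on {s..t}"
    by (intro set_integral_diff(1))
  then show ?thesis by (simp add: delay_rhs_eq)
qed

lemma solution_eq:
  assumes "delay_solution T r a f\<^sub>0 \<eta> c x" "snd \<eta> \<in> L2_past T" "0 \<le> t"
  shows "x t = fst \<eta> + integral {0..t} (drift x) - integral {0..t} c"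
proof -
  have "x t = fst \<eta> + integral {0..t} (delay_rhs T r a f\<^sub>0 c x)"
    using assms unfolding delay_solution_def by (simp add: set_lebesgue_integral_eq_integral(2))
  also have "integral {0..t} (delay_rhs T r a f\<^sub>0 c x) = integral {0..t} (drift x) - integral {0..t} c"
    using drift_integrable[OF solution_locally_L2[OF assms(1,2)] solution_continuous[OF assms(1)], of 0 t]
      solution_control_integrable[OF assms(1,2), of 0 t]
    unfolding delay_rhs_eq by (intro Henstock_Kurzweil_Integration.integral_diff) (auto simp: absolutely_integrable_on_def)
  finally show ?thesis by simp
qed

lemma solutionI:
  assumes "snd \<eta> \<in> L2_past T" "\<And>s. -T \<le> s \<Longrightarrow> s < 0 \<Longrightarrow> x s = snd \<eta> s"
    and cont: "continuous_on {0..} x" and c: "\<And>t. 0 \<le> t \<Longrightarrow> c absolutely_integrable_on {0..t}"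
    and eq: "\<And>t. 0 \<le> t \<Longrightarrow> x t = fst \<eta> + integral {0..t} (drift x) - integral {0..t} c"
  shows "delay_solution T r a f\<^sub>0 \<eta> c x"
  unfolding delay_solution_def
proof (intro conjI ballI allI impI)
  show "x s = snd \<eta> s" if "s \<in> {-T..<0}" for s using assms(2) that by auto
next
  fix t :: real assume t: "0 \<le> t"
  have d: "drift x absolutely_integrable_on {0..t}"
    by (intro drift_integrable cont locally_L2I[OF assms(1,2)]) auto
  have e: "delay_rhs T r a f\<^sub>0 c x = (\<lambda>s. drift x s - c s)" by (rule ext) (rule delay_rhs_eq)
  show i: "delay_rhs T r a f\<^sub>0 c x absolutely_integrable_on {0..t}"
    unfolding e using d c[OF t] by (rule set_integral_diff(1))
  have "integral {0..t} (delay_rhs T r a f\<^sub>0 c x) = integral {0..t} (drift x) - integral {0..t} c"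
    using d c[OF t] unfolding e
    by (intro Henstock_Kurzweil_Integration.integral_diff) (auto simp: absolutely_integrable_on_def)
  then show "x t = fst \<eta> + (LINT s:{0..t}|lebesgue. delay_rhs T r a f\<^sub>0 c x s)"
    using eq[OF t] i by (simp add: set_lebesgue_integral_eq_integral(2))
qed

lemma solution_initial:
  assumes "delay_solution T r a f\<^sub>0 \<eta> c x" "snd \<eta> \<in> L2_past T"
  shows "x 0 = fst \<eta>"
  using solution_eq[OF assms, of 0] by simp

lemma drift_shift:
  fixes x :: "real \<Rightarrow> real"
  shows "drift (\<lambda>u. x (h + u)) s = drift x (h + s)"
  by (simp add: drift_def delay_term_def add.assoc)

text \<open>The equation is autonomous and a segment contains all that the future depends on.
  Dynamic programming rests on this flow property.\<close>

lemma solution_shift: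
  assumes sol: "delay_solution T r a f\<^sub>0 \<eta> c x" and \<eta>: "snd \<eta> \<in> L2_past T" and h: "0 \<le> h"
  shows "delay_solution T r a f\<^sub>0 (segment x h) (\<lambda>s. c (h + s)) (\<lambda>s. x (h + s))"
    and "snd (segment x h) \<in> L2_past T"
proof -
  show seg: "snd (segment x h) \<in> L2_past T"
    using locally_L2_segment[OF solution_locally_L2[OF sol \<eta>] h] by (simp add: segment_def)
  have cx: "continuous_on {0..} x" by (rule solution_continuous[OF sol])
  have cint: "c absolutely_integrable_on {s..t}" if "0 \<le> s" for s t
    by (rule solution_control_integrable[OF sol \<eta> that])
  have dint: "drift x absolutely_integrable_on {s..t}" if "0 \<le> s" for s t
    by (rule drift_integrable[OF solution_locally_L2[OF sol \<eta>] cx that])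
  show "delay_solution T r a f\<^sub>0 (segment x h) (\<lambda>s. c (h + s)) (\<lambda>s. x (h + s))"
  proof (rule solutionI[OF seg])
    show "continuous_on {0..} (\<lambda>s. x (h + s))"
      by (rule continuous_on_compose2[OF cx]) (use h in \<open>auto intro!: continuous_intros\<close>)
    fix t :: real assume t: "0 \<le> t"
    show "(\<lambda>s. c (h + s)) absolutely_integrable_on {0..t}"
      using cint h by (simp add: absolutely_integrable_translate_iff)
    have "integral {0..h + t} (drift x) = integral {0..h} (drift x) + integral {h..h + t} (drift x)"
      using dint[of 0 "h + t"] h t by (intro Henstock_Kurzweil_Integration.integral_combine[symmetric])
        (auto simp: absolutely_integrable_on_def)
    moreover have "integral {0..h + t} c = integral {0..h} c + integral {h..h + t} c"
      using cint[of 0 "h + t"] h t by (intro Henstock_Kurzweil_Integration.integral_combine[symmetric])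
        (auto simp: absolutely_integrable_on_def)
    moreover have "integral {0..t} (\<lambda>s. drift x (h + s)) = integral {h..h + t} (drift x)"
      using integral_translate[where f = "drift x" and h = h and a = 0 and b = t] dint h by simp
    moreover have "integral {0..t} (\<lambda>s. c (h + s)) = integral {h..h + t} c"
      using integral_translate[where f = c and h = h and a = 0 and b = t] cint h by simp
    moreover have "drift (\<lambda>s. x (h + s)) = (\<lambda>s. drift x (h + s))" by (rule ext) (rule drift_shift)
    ultimately show "x (h + t) = fst (segment x h) + integral {0..t} (drift (\<lambda>s. x (h + s))) - integral {0..t} (\<lambda>s. c (h + s))"
      using solution_eq[OF sol \<eta>, of h] solution_eq[OF sol \<eta>, of "h + t"] h t by (simp add: segment_def)
  qed (simp add: segment_def)
qed

section \<open>Stability and uniqueness of solutions\<close>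

text \<open>Lipschitz constant of the drift in the sup norm over the elapsed time, for solutions
  with a common past: \<open>r\<close> and \<open>C\<close> stem from the present value,
  \<open>C * A * T\<close> from the window.\<close>

definition K where "K = r + C + C * A * T"

lemma K_pos: "0 < K"
  using r_pos C_nonneg A_nonneg T_pos by (simp add: K_def add_pos_nonneg)

lemma drift_diff_le:
  assumes x: "locally_L2 T x" and y: "locally_L2 T y" and s: "0 \<le> s"
    and past: "\<And>u. -T \<le> u \<Longrightarrow> u < 0 \<Longrightarrow> x u = y u"
    and S: "\<And>u. 0 \<le> u \<Longrightarrow> u \<le> s \<Longrightarrow> \<bar>x u - y u\<bar> \<le> S"
  shows "\<bar>drift x s - drift y s\<bar> \<le> K * S"
proof -
  have S0: "0 \<le> S" using S[of s] s by (meson abs_ge_zero order_refl order_trans)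
  have "(\<lambda>u. x (s + u) - y (s + u)) \<in> L2_past T"
    by (intro L2_past_diff locally_L2_segment x y s)
  then have "(LINT u|lebesgue_on {-T..0}. \<bar>x (s + u) - y (s + u)\<bar>) \<le> S * min s T"
    using S0 s S past T_pos by (intro past_integral_le L2_past_integrable) auto
  also have "\<dots> \<le> S * T" using S0 by (intro mult_left_mono) auto
  finally have "\<bar>delay_term T a x s - delay_term T a y s\<bar> \<le> A * (S * T)"
    using delay_term_diff_le[OF x y s s] A_nonneg by (meson mult_left_mono order_trans)
  then have "C * (\<bar>x s - y s\<bar> + \<bar>delay_term T a x s - delay_term T a y s\<bar>) \<le> C * (S + A * (S * T))"
    using C_nonneg S[of s] s by (intro mult_left_mono) auto
  then have "\<bar>f\<^sub>0 (max 0 (x s)) (delay_term T a x s) - f\<^sub>0 (max 0 (y s)) (delay_term T a y s)\<bar> \<le> C * (S + A * (S * T))"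
    using f0_lipschitz order_trans by blast
  moreover have "\<bar>r * x s - r * y s\<bar> \<le> r * S"
    using S[of s] s r_pos by (simp add: abs_mult flip: right_diff_distrib)
  ultimately show ?thesis unfolding drift_def K_def by (simp add: algebra_simps abs_le_iff)
qed

text \<open>With \<open>2 * K * h \<le> 1\<close> the supremum \<open>S\<close> of the difference
  satisfies \<open>S \<le> K * h * S + G\<close>, hence \<open>S \<le> 2 * G\<close>, by absorption
  rather than by Gronwall. Inserted into the drift integral, this gives the second claim: up to an
  error of order \<open>h * G\<close>, the trajectories differ by the integral of the control
  difference.\<close>

lemma solution_gap:
  assumes x: "delay_solution T r a f\<^sub>0 \<eta> c x" and y: "delay_solution T r a f\<^sub>0 \<zeta> d y"
    and \<eta>: "snd \<eta> \<in> L2_past T" "snd \<zeta> \<in> L2_past T"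
    and init: "fst \<eta> = fst \<zeta>" "\<And>s. -T \<le> s \<Longrightarrow> s < 0 \<Longrightarrow> snd \<eta> s = snd \<zeta> s"
    and h: "0 \<le> h" "2 * K * h \<le> 1" and s: "0 \<le> s" "s \<le> h"
  defines "G \<equiv> integral {0..h} (\<lambda>u. \<bar>c u - d u\<bar>)"
  shows "\<bar>x s - y s\<bar> \<le> 2 * G"
    and "\<bar>x s - y s + integral {0..s} (\<lambda>u. c u - d u)\<bar> \<le> 2 * K * h * G"
proof -
  have xL: "locally_L2 T x" and yL: "locally_L2 T y"
    using x y \<eta> by (auto intro: solution_locally_L2)
  have xc: "continuous_on {0..} x" and yc: "continuous_on {0..} y"
    using x y by (auto intro: solution_continuous)
  have past: "x s = y s" if "-T \<le> s" "s < 0" for s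
    using x y init that by (auto simp: delay_solution_def)
  have "continuous_on {0..h} (\<lambda>s. \<bar>x s - y s\<bar>)"
    by (intro continuous_intros continuous_on_subset[OF xc] continuous_on_subset[OF yc]) auto
  from continuous_attains_sup[OF compact_Icc _ this] h(1) obtain s0 where
    s0: "0 \<le> s0" "s0 \<le> h" and max: "\<And>s. 0 \<le> s \<Longrightarrow> s \<le> h \<Longrightarrow> \<bar>x s - y s\<bar> \<le> \<bar>x s0 - y s0\<bar>"
    by (metis atLeastAtMost_iff atLeastatMost_empty_iff2 order_trans)
  define S where "S = \<bar>x s0 - y s0\<bar>"
  have S0: "0 \<le> S" by (simp add: S_def)
  have cd: "(\<lambda>u. c u - d u) absolutely_integrable_on {s..t}" if "0 \<le> s" for s t
    using that x y \<eta> by (intro set_integral_diff(1) solution_control_integrable)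
  have dr: "drift x absolutely_integrable_on {0..t}" "drift y absolutely_integrable_on {0..t}" for t
    using xL yL xc yc by (auto intro: drift_integrable)
  have G_le: "\<bar>integral {0..t} (\<lambda>u. c u - d u)\<bar> \<le> G" if "0 \<le> t" "t \<le> h" for t
  proof -
    have "norm (integral {0..t} (\<lambda>u. c u - d u)) \<le> integral {0..t} (\<lambda>u. \<bar>c u - d u\<bar>)"
      using cd[of 0 t]
      by (intro Henstock_Kurzweil_Integration.integral_norm_bound_integral) (auto simp: absolutely_integrable_on_def)
    then have "\<bar>integral {0..t} (\<lambda>u. c u - d u)\<bar> \<le> integral {0..t} (\<lambda>u. \<bar>c u - d u\<bar>)" by simp
    also have "\<dots> \<le> G" unfolding G_def
      using cd[of 0 t] cd[of 0 h] that unfolding absolutely_integrable_on_def real_norm_def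
      by (intro integral_subset_le) auto
    finally show ?thesis .
  qed
  have main: "\<bar>x t - y t + integral {0..t} (\<lambda>u. c u - d u)\<bar> \<le> K * h * S" if t: "0 \<le> t" "t \<le> h" for t
  proof -
    have "x t - y t + integral {0..t} (\<lambda>u. c u - d u) = integral {0..t} (\<lambda>u. drift x u - drift y u)"
    proof -
      have "integral {0..t} (\<lambda>u. c u - d u) = integral {0..t} c - integral {0..t} d"
        using solution_control_integrable[OF x \<eta>(1), of 0 t] solution_control_integrable[OF y \<eta>(2), of 0 t]
        by (intro Henstock_Kurzweil_Integration.integral_diff) (auto simp: absolutely_integrable_on_def)
      moreover have "integral {0..t} (\<lambda>u. drift x u - drift y u) = integral {0..t} (drift x) - integral {0..t} (drift y)"
        using dr by (intro Henstock_Kurzweil_Integration.integral_diff) (auto simp: absolutely_integrable_on_def)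
      ultimately show ?thesis
        using solution_eq[OF x \<eta>(1) t(1)] solution_eq[OF y \<eta>(2) t(1)] init by simp
    qed
    also have "\<bar>\<dots>\<bar> \<le> K * S * (t - 0)"
    proof -
      have "norm (integral {0..t} (\<lambda>u. drift x u - drift y u)) \<le> integral {0..t} (\<lambda>u. K * S)"
      proof (rule Henstock_Kurzweil_Integration.integral_norm_bound_integral)
        show "(\<lambda>u. drift x u - drift y u) integrable_on {0..t}"
          using set_integral_diff(1)[OF dr] by (simp add: absolutely_integrable_on_def)
        show "norm (drift x u - drift y u) \<le> K * S" if "u \<in> {0..t}" for u
          using that t max h past unfolding real_norm_def S_def
          by (intro drift_diff_le[OF xL yL]) auto
      qed (rule integrable_const_ivl)
      then show ?thesis using t by (simp add: mult_ac)
    qed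
    also have "\<dots> \<le> K * h * S"
      using mult_left_mono[OF t(2), of "K * S"] K_pos S0 by (simp add: mult_ac)
    finally show ?thesis .
  qed
  have "S \<le> K * h * S + G"
    using main[OF s0] G_le[OF s0] unfolding S_def by linarith
  moreover have "K * h * S \<le> S / 2"
    using mult_right_mono[OF h(2) S0] by simp
  ultimately have S: "S \<le> 2 * G" by simp
  show "\<bar>x s - y s\<bar> \<le> 2 * G" using max[OF s] S by (simp add: S_def)
  have "K * h * S \<le> K * h * (2 * G)"
    using S K_pos h by (intro mult_left_mono) auto
  then show "\<bar>x s - y s + integral {0..s} (\<lambda>u. c u - d u)\<bar> \<le> 2 * K * h * G"
    using main[OF s] by simp
qed

lemma solution_unique:
  assumes x: "delay_solution T r a f\<^sub>0 \<eta> c x" and y: "delay_solution T r a f\<^sub>0 \<eta> c y"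
    and \<eta>: "snd \<eta> \<in> L2_past T" and t: "0 \<le> t"
  shows "x t = y t"
proof -
  define h where "h = 1 / (2 * K)"
  have h: "0 < h" "2 * K * h \<le> 1"
    using K_pos by (auto simp: h_def)
  \<comment> \<open>The induction runs over steps of length \<open>h\<close> and for all data at
    once, because each step restarts from the segments at \<open>h\<close>. The initial pasts are
    compared only before time 0 and within the window, since the two segments may be different
    functions elsewhere.\<close>
  have "\<forall>\<eta> \<zeta> c x y t. delay_solution T r a f\<^sub>0 \<eta> c x \<and> delay_solution T r a f\<^sub>0 \<zeta> c y \<and>
     snd \<eta> \<in> L2_past T \<and> snd \<zeta> \<in> L2_past T \<and> fst \<eta> = fst \<zeta> \<and> (\<forall>s. -T \<le> s \<and> s < 0 \<longrightarrow> snd \<eta> s = snd \<zeta> s) \<and>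
     0 \<le> t \<and> t \<le> real n * h \<longrightarrow> x t = y t" for n
  proof (induction n)
    case 0
    then show ?case using solution_initial by (metis antisym mult_zero_left of_nat_0)
  next
    case (Suc n)
    show ?case
    proof (intro allI impI, elim conjE)
      fix \<eta> \<zeta> c x y t
      assume x: "delay_solution T r a f\<^sub>0 \<eta> c x" and y: "delay_solution T r a f\<^sub>0 \<zeta> c y"
        and \<eta>: "snd \<eta> \<in> L2_past T" and \<zeta>: "snd \<zeta> \<in> L2_past T" and e0: "fst \<eta> = fst \<zeta>"
        and e: "\<forall>s. -T \<le> s \<and> s < 0 \<longrightarrow> snd \<eta> s = snd \<zeta> s"
        and t: "0 \<le> t" "t \<le> real (Suc n) * h"
      have first: "x s = y s" if "0 \<le> s" "s \<le> h" for s
        using solution_gap(1)[OF x y \<eta> \<zeta> e0 _ _ h(2) that] e h(1) by simp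
      have before: "x s = y s" if "-T \<le> s" "s < 0" for s
        using x y e that by (auto simp: delay_solution_def)
      show "x t = y t"
      proof (cases "t \<le> h")
        case True
        then show ?thesis using first t by simp
      next
        case False
        have all: "x (h + s) = y (h + s)" if "-T \<le> s" "s \<le> 0" for s
          using first[of "h + s"] before[of "h + s"] that h by (cases "h + s < 0") auto
        have "delay_solution T r a f\<^sub>0 (segment x h) (\<lambda>s. c (h + s)) (\<lambda>s. x (h + s))"
          "snd (segment x h) \<in> L2_past T"
          using solution_shift[OF x \<eta>, of h] h(1) by simp_all
        moreover have "delay_solution T r a f\<^sub>0 (segment y h) (\<lambda>s. c (h + s)) (\<lambda>s. y (h + s))"
          "snd (segment y h) \<in> L2_past T"
          using solution_shift[OF y \<zeta>, of h] h(1) by simp_all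
        moreover have "fst (segment x h) = fst (segment y h)"
          "\<forall>s. -T \<le> s \<and> s < 0 \<longrightarrow> snd (segment x h) s = snd (segment y h) s"
          using all[of 0] all T_pos by (simp_all add: segment_def)
        moreover have "0 \<le> t - h" "t - h \<le> real n * h"
          using False t by (simp_all add: algebra_simps)
        ultimately have "x (h + (t - h)) = y (h + (t - h))"
          using Suc.IH by blast
        then show ?thesis by simp
      qed
    qed
  qed
  moreover obtain n :: nat where "t \<le> real n * h"
    using h(1) ex_less_of_nat_mult[of h t] by (auto intro: less_imp_le)
  ultimately show ?thesis using x y \<eta> t by blast
qed

lemma trajectory_eq:
  assumes x: "delay_solution T r a f\<^sub>0 \<eta> c x" and \<eta>: "snd \<eta> \<in> L2_past T" and t: "0 \<le> t"
  shows "trajectory T r a f\<^sub>0 \<eta> c t = x t"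
  unfolding trajectory_def
proof (rule the_equality)
  show "\<exists>y. delay_solution T r a f\<^sub>0 \<eta> c y \<and> y t = x t" using x by blast
  fix v assume "\<exists>y. delay_solution T r a f\<^sub>0 \<eta> c y \<and> y t = v"
  then show "v = x t" using solution_unique[OF _ x \<eta> t] by blast
qed

text \<open>
  \<open>Y\<close> is raised by \<open>z s = m * exp (- (C + 1) * s)\<close>. The decay rate exceeds the Lipschitz constant of
  \<open>f\<^sub>0\<close> by one, which leaves a surplus \<open>z s\<close> in the control; \<open>m\<close> is chosen so that this surplus covers
  the loss \<open>C * e\<close> caused by the different past on \<open>[0,T]\<close>, after which the past is forgotten.
\<close>
lemma dominating_solution:
  assumes Y: "delay_solution T r a f\<^sub>0 \<zeta> c Y" and \<zeta>: "snd \<zeta> \<in> L2_past T" "snd \<zeta>' \<in> L2_past T"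
    and gap: "fst \<zeta>' = fst \<zeta> + C * e * exp ((C + 1) * T)"
      "e = A * (LINT u|lebesgue_on {-T..0}. \<bar>snd \<zeta>' u - snd \<zeta> u\<bar>)"
  obtains c' y where "delay_solution T r a f\<^sub>0 \<zeta>' c' y"
    "\<And>t. 0 \<le> t \<Longrightarrow> c t \<le> c' t" "\<And>t. 0 \<le> t \<Longrightarrow> Y t \<le> y t"
proof -
  define m where "m = C * e * exp ((C + 1) * T)"
  define z where "z s = m * exp (- (C + 1) * s)" for s
  define y where "y s = (if s < 0 then snd \<zeta>' s else Y s + z s)" for s
  \<comment> \<open>The consumption that the equation leaves once the trajectory
    \<open>Y + z\<close> is prescribed, as \<open>z\<close> has the derivative
    \<open>- (C + 1) * z\<close>.\<close>
  define c' where "c' s = c s + (drift y s - drift Y s) + (C + 1) * z s" for s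
  have e0: "0 \<le> e" unfolding gap(2) using A_nonneg by simp
  then have m0: "0 \<le> m" using C_nonneg by (simp add: m_def)
  then have z0: "0 \<le> z s" for s by (simp add: z_def)
  have Yc: "continuous_on {0..} Y" by (rule solution_continuous[OF Y])
  have YL: "locally_L2 T Y" by (rule solution_locally_L2[OF Y \<zeta>(1)])
  have zc: "continuous_on S z" for S unfolding z_def by (intro continuous_intros)
  have yc: "continuous_on {0..} y"
    by (rule continuous_on_eq[of _ "\<lambda>s. Y s + z s"]) (auto simp: y_def intro!: continuous_intros Yc zc)
  have yL: "locally_L2 T y"
    by (rule locally_L2I[OF \<zeta>(2) _ yc]) (simp add: y_def)
  have z_int: "integral {0..t} (\<lambda>s. (C + 1) * z s) = m - z t" if "0 \<le> t" for t
  proof -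
    have "((\<lambda>s. (C + 1) * z s) has_integral (- z t) - (- z 0)) {0..t}"
    proof (rule fundamental_theorem_of_calculus[OF that])
      fix s
      have "((\<lambda>s. - z s) has_real_derivative (C + 1) * z s) (at s within {0..t})"
        unfolding z_def by (auto intro!: derivative_eq_intros simp: algebra_simps)
      then show "((\<lambda>s. - z s) has_vector_derivative (C + 1) * z s) (at s within {0..t})"
        by (simp add: has_real_derivative_iff_has_vector_derivative)
    qed
    from integral_unique[OF this] show ?thesis by (simp only: z_def) simp
  qed
  have cint: "c absolutely_integrable_on {0..t}" for t
    by (rule solution_control_integrable[OF Y \<zeta>(1)]) simp
  have yd: "drift y absolutely_integrable_on {0..t}" and Yd: "drift Y absolutely_integrable_on {0..t}" for t
    by (auto intro: drift_integrable yL yc YL Yc)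
  have zi: "(\<lambda>s. (C + 1) * z s) absolutely_integrable_on {0..t}" for t
    by (intro absolutely_integrable_continuous_real continuous_intros zc)
  have sol: "delay_solution T r a f\<^sub>0 \<zeta>' c' y"
  proof (rule solutionI[OF \<zeta>(2) _ yc])
    fix t :: real assume t: "0 \<le> t"
    show "c' absolutely_integrable_on {0..t}"
      unfolding c'_def by (intro set_integral_add(1) set_integral_diff(1) cint yd Yd zi)
    have "integral {0..t} c' = integral {0..t} c + (integral {0..t} (drift y) - integral {0..t} (drift Y)) + (m - z t)"
    proof -
      have i: "c integrable_on {0..t}" "drift y integrable_on {0..t}" "drift Y integrable_on {0..t}"
        "(\<lambda>s. (C + 1) * z s) integrable_on {0..t}"
        using cint yd Yd zi by (auto simp: absolutely_integrable_on_def)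
      show ?thesis unfolding c'_def z_int[OF t, symmetric]
        using i by (simp add: Henstock_Kurzweil_Integration.integral_add Henstock_Kurzweil_Integration.integral_diff
            integrable_add integrable_diff del: Henstock_Kurzweil_Integration.integral_mult_right)
    qed
    then show "y t = fst \<zeta>' + integral {0..t} (drift y) - integral {0..t} c'"
      using solution_eq[OF Y \<zeta>(1) t] t gap(1) by (simp add: y_def m_def)
  qed (simp add: y_def)
  \<comment> \<open>Only the part of the window before time 0 can lower the delay term, by at most
    \<open>e\<close>, and beyond \<open>T\<close> there is no such part. After time 0 the raise
    helps, because the kernel is nonnegative.\<close>
  have delay_ge: "delay_term T a Y s - (if s \<le> T then e else 0) \<le> delay_term T a y s" if s: "0 \<le> s" for s
  proof -
    \<comment> \<open>Extended by zero, so that the part of the past still visible at time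
      \<open>s\<close> has at most the full integral.\<close>
    define G where "G v = indicator {-T..0} v * \<bar>snd \<zeta>' v - snd \<zeta> v\<bar>" for v
    have dL: "(\<lambda>u. snd \<zeta>' u - snd \<zeta> u) \<in> L2_past T" by (intro L2_past_diff \<zeta>)
    have Gint: "integrable lebesgue G"
      using L2_past_integrable(2)[OF dL] by (subst (asm) integrable_restrict_space) (simp_all add: G_def[abs_def])
    have Gs: "integrable lebesgue (\<lambda>u. G (s + u))"
      using Gint by (simp add: integrable_lebesgue_translate)
    have Gnn: "0 \<le> G v" for v by (simp add: G_def)
    have e_eq: "e = A * (LINT v|lebesgue. G v)"
      unfolding gap(2) by (subst integral_restrict_space) (simp_all add: G_def[abs_def])
    have Gle: "(LINT u|lebesgue_on {-T..0}. G (s + u)) \<le> (LINT v|lebesgue. G v)"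
      using integral_lebesgue_on_le[OF Gs, of "{-T..0}"] Gnn by (simp add: integral_lebesgue_translate)
    have diffL: "(\<lambda>u. y (s + u) - Y (s + u)) \<in> L2_past T"
      by (intro L2_past_diff locally_L2_segment yL YL s)
    have D: "delay_term T a y s - delay_term T a Y s = (LINT u|lebesgue_on {-T..0}. a u * (y (s + u) - Y (s + u)))"
      by (rule delay_term_diff[OF yL YL s s])
    have pos: "0 \<le> a u * (y (s + u) - Y (s + u))" if "u \<in> {-T..0}" "0 \<le> s + u" for u
      using that a_nonneg z0 by (simp add: y_def)
    show ?thesis
    proof (cases "s \<le> T")
      case True
      have "- e \<le> - (A * (LINT u|lebesgue_on {-T..0}. G (s + u)))"
        unfolding e_eq using Gle A_nonneg by (simp add: mult_left_mono)
      also have "\<dots> = (LINT u|lebesgue_on {-T..0}. - A * G (s + u))" by simp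
      also have "\<dots> \<le> (LINT u|lebesgue_on {-T..0}. a u * (y (s + u) - Y (s + u)))"
      proof (rule integral_mono)
        show "integrable (lebesgue_on {-T..0}) (\<lambda>u. - A * G (s + u))"
          by (intro integrable_mult_right integrable_lebesgue_on Gs) simp
        show "integrable (lebesgue_on {-T..0}) (\<lambda>u. a u * (y (s + u) - Y (s + u)))"
          by (rule a_times_integrable[OF diffL])
        fix u assume "u \<in> space (lebesgue_on {-T..0})"
        then have u: "u \<in> {-T..0}" by simp
        show "- A * G (s + u) \<le> a u * (y (s + u) - Y (s + u))"
        proof (cases "0 \<le> s + u")
          case True
          have "- A * G (s + u) \<le> 0" using A_nonneg Gnn by simp
          with pos[OF u True] show ?thesis by linarith
        next
          case False
          then have su: "s + u \<in> {-T..<0}" using u s by auto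
          then have Ysu: "Y (s + u) = snd \<zeta> (s + u)" using Y by (simp add: delay_solution_def)
          have "a u * \<bar>y (s + u) - Y (s + u)\<bar> \<le> A * G (s + u)"
            using a_le_A[OF u] su Ysu by (auto simp: G_def y_def intro!: mult_right_mono)
          moreover have "- (a u * (y (s + u) - Y (s + u))) \<le> a u * \<bar>y (s + u) - Y (s + u)\<bar>"
            using a_nonneg[OF u] by (simp flip: mult_minus_right add: mult_left_mono)
          ultimately show ?thesis by linarith
        qed
      qed
      finally show ?thesis using True D by simp
    next
      case False
      have "0 \<le> (LINT u|lebesgue_on {-T..0}. a u * (y (s + u) - Y (s + u)))"
        using pos False by (intro Bochner_Integration.integral_nonneg) auto
      then show ?thesis using False D by simp
    qed
  qed
  have "c s \<le> c' s" if s: "0 \<le> s" for s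
  proof -
    define es where "es = (if s \<le> T then e else 0)"
    have es0: "0 \<le> es" using e0 by (simp add: es_def)
    have ys: "y s = Y s + z s" using s by (simp add: y_def)
    \<comment> \<open>Monotonicity brings the delay term down to the lower bound just found. From
      there the Lipschitz estimate towards \<open>Y\<close> costs \<open>C * (z s + es)\<close>: the
      term \<open>(C + 1) * z s\<close> in \<open>c'\<close> pays for \<open>C * z s\<close>, and
      the \<open>z s\<close> that remains pays for \<open>C * es\<close>.\<close>
    have "f\<^sub>0 (max 0 (y s)) (delay_term T a Y s - es) \<le> f\<^sub>0 (max 0 (y s)) (delay_term T a y s)"
      using delay_ge[OF s] unfolding es_def by (rule f0_mono)
    moreover have "\<bar>f\<^sub>0 (max 0 (y s)) (delay_term T a Y s - es) - f\<^sub>0 (max 0 (Y s)) (delay_term T a Y s)\<bar> \<le> C * (z s + es)"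
      using f0_lipschitz[of "y s" "delay_term T a Y s - es" "Y s" "delay_term T a Y s"] ys z0[of s] es0 by simp
    moreover have "C * es \<le> z s"
    proof (cases "s \<le> T")
      case True
      have "exp ((C + 1) * T) * exp (- (C + 1) * s) = exp ((C + 1) * (T - s))"
        by (simp add: mult_exp_exp algebra_simps)
      moreover have "1 \<le> exp ((C + 1) * (T - s))" using True C_nonneg by simp
      ultimately have "C * e * 1 \<le> C * e * (exp ((C + 1) * T) * exp (- (C + 1) * s))"
        using e0 C_nonneg by (intro mult_left_mono) auto
      then show ?thesis using True by (simp add: es_def z_def m_def mult.assoc)
    qed (simp add: es_def z0)
    moreover have "0 \<le> r * z s" using r_pos z0 by simp
    moreover have "c' s - c s = r * z s + (f\<^sub>0 (max 0 (y s)) (delay_term T a y s) - f\<^sub>0 (max 0 (Y s)) (delay_term T a Y s)) + (C + 1) * z s"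
      unfolding c'_def drift_def ys by (simp add: algebra_simps)
    ultimately show ?thesis by (simp add: algebra_simps)
  qed
  with sol z0 that show ?thesis by (simp add: y_def)
qed

text \<open>
  \<open>trajectory\<close> is an arbitrary value if there is no solution, so an admissible control has the
  intended meaning only because solutions exist. The fixed point is taken in the bounded continuous
  functions \<open>f\<close>, with \<open>x = w * f\<close> for a weight \<open>w\<close> that grows fast enough to absorb \<open>c\<close>.
\<close>
lemma solution_exists:
  assumes \<eta>: "snd \<eta> \<in> L2_past T" and c: "\<And>t. 0 \<le> t \<Longrightarrow> c absolutely_integrable_on {0..t}"
  shows "\<exists>x. delay_solution T r a f\<^sub>0 \<eta> c x"
proof -
  define \<Gamma> where "\<Gamma> t = integral {0..t} (\<lambda>s. \<bar>c s\<bar>)" for t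
  \<comment> \<open>The exponential makes the integral operator a contraction with factor 1/2, by
    \<open>w_int\<close>; the factor \<open>1 + \<Gamma> t\<close> keeps the integral of the control
    bounded relative to \<open>w\<close>.\<close>
  define w where "w t = exp (2 * K * t) * (1 + \<Gamma> t)" for t
  define X where "X f s = (if s < 0 then snd \<eta> s else w s * f s)" for f s
  define Q where "Q f t = fst \<eta> + integral {0..t} (drift (X f)) - integral {0..t} c" for f t
  have ci: "(\<lambda>s. \<bar>c s\<bar>) integrable_on {0..t}" "c integrable_on {0..t}" if "0 \<le> t" for t
    using c[OF that] by (auto simp: absolutely_integrable_on_def)
  have \<Gamma>0: "0 \<le> \<Gamma> t" for t unfolding \<Gamma>_def
    by (cases "(\<lambda>s. \<bar>c s\<bar>) integrable_on {0..t}") (auto intro: integral_nonneg simp: not_integrable_integral)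
  have \<Gamma>mono: "\<Gamma> s \<le> \<Gamma> t" if "0 \<le> s" "s \<le> t" for s t
    unfolding \<Gamma>_def using ci that by (intro integral_subset_le) auto
  have \<Gamma>c: "continuous_on {0..} \<Gamma>"
    unfolding \<Gamma>_def by (rule continuous_on_indefinite_integral_halfline) (rule ci)
  have wc: "continuous_on {0..} w" unfolding w_def by (intro continuous_intros \<Gamma>c)
  have w1: "1 \<le> w t" "\<Gamma> t \<le> w t" "exp (2 * K * t) \<le> w t" if "0 \<le> t" for t
  proof -
    have "1 \<le> exp (2 * K * t)" using K_pos that by simp
    then have "1 * (1 + \<Gamma> t) \<le> w t" unfolding w_def using \<Gamma>0 by (intro mult_right_mono) auto
    then show "1 \<le> w t" "\<Gamma> t \<le> w t" using \<Gamma>0[of t] by simp_all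
    show "exp (2 * K * t) \<le> w t" unfolding w_def using \<Gamma>0[of t] by (simp add: algebra_simps)
  qed
  have wmono: "w s \<le> w t" if "0 \<le> s" "s \<le> t" for s t
    unfolding w_def using \<Gamma>mono[OF that] \<Gamma>0[of s] K_pos that by (intro mult_mono) auto
  have wi: "(\<lambda>s. w s) integrable_on {0..t}" for t
    by (rule integrable_continuous_real[OF continuous_on_subset[OF wc]]) auto
  have w_int: "K * integral {0..t} w \<le> w t / 2" if t: "0 \<le> t" for t
  proof -
    have "((\<lambda>s. exp (2 * K * s)) has_integral exp (2 * K * t) / (2 * K) - exp (2 * K * 0) / (2 * K)) {0..t}"
    proof (rule fundamental_theorem_of_calculus[OF t])
      fix s
      have "((\<lambda>s. exp (2 * K * s) / (2 * K)) has_real_derivative exp (2 * K * s)) (at s within {0..t})"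
        using K_pos by (auto intro!: derivative_eq_intros)
      then show "((\<lambda>s. exp (2 * K * s) / (2 * K)) has_vector_derivative exp (2 * K * s)) (at s within {0..t})"
        by (simp add: has_real_derivative_iff_has_vector_derivative)
    qed
    from has_integral_mult_left[OF this, of "1 + \<Gamma> t"]
    have E: "((\<lambda>s. exp (2 * K * s) * (1 + \<Gamma> t)) has_integral
        (exp (2 * K * t) / (2 * K) - exp (2 * K * 0) / (2 * K)) * (1 + \<Gamma> t)) {0..t}" .
    have "integral {0..t} w \<le> (exp (2 * K * t) / (2 * K) - exp (2 * K * 0) / (2 * K)) * (1 + \<Gamma> t)"
      using \<Gamma>mono by (intro has_integral_le[OF integrable_integral[OF wi] E]) (auto simp: w_def)
    also have "\<dots> \<le> exp (2 * K * t) / (2 * K) * (1 + \<Gamma> t)"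
      using K_pos \<Gamma>0[of t] by (intro mult_right_mono) auto
    also have "\<dots> = w t / (2 * K)" by (simp add: w_def)
    finally show ?thesis using K_pos by (simp add: field_simps)
  qed
  have Xc: "continuous_on {0..} (X f)" if "continuous_on UNIV f" for f
    by (rule continuous_on_eq[of _ "\<lambda>s. w s * f s"])
      (auto simp: X_def intro!: continuous_intros wc continuous_on_subset[OF that])
  have XL: "locally_L2 T (X f)" if "continuous_on UNIV f" for f
    by (rule locally_L2I[OF \<eta> _ Xc[OF that]]) (simp add: X_def)
  have Xd: "drift (X f) integrable_on {0..t}" if "continuous_on UNIV f" for f t
    using drift_integrable[OF XL[OF that] Xc[OF that], of 0 t] by (simp add: absolutely_integrable_on_def)
  have Qc: "continuous_on {0..} (Q f)" if "continuous_on UNIV f" for f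
    unfolding Q_def
    by (intro continuous_intros continuous_on_indefinite_integral_halfline Xd[OF that] ci)
  have contr: "\<bar>Q f t - Q g t\<bar> \<le> d * w t / 2"
    if f: "continuous_on UNIV f" and g: "continuous_on UNIV g"
      and d: "\<And>s. \<bar>f s - g s\<bar> \<le> d" and t: "0 \<le> t" for f g d t
  proof -
    have d0: "0 \<le> d" using d[of 0] by linarith
    have Qd: "Q f t - Q g t = integral {0..t} (\<lambda>s. drift (X f) s - drift (X g) s)"
      unfolding Q_def by (simp add: Henstock_Kurzweil_Integration.integral_diff[OF Xd[OF f] Xd[OF g]])
    have "norm (integral {0..t} (\<lambda>s. drift (X f) s - drift (X g) s)) \<le> integral {0..t} (\<lambda>s. K * d * w s)"
    proof (rule Henstock_Kurzweil_Integration.integral_norm_bound_integral)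
      show "(\<lambda>s. drift (X f) s - drift (X g) s) integrable_on {0..t}"
        by (rule integrable_diff[OF Xd[OF f] Xd[OF g]])
      show "(\<lambda>s. K * d * w s) integrable_on {0..t}" by (intro integrable_on_mult_right wi)
      fix s assume s: "s \<in> {0..t}"
      have "\<bar>drift (X f) s - drift (X g) s\<bar> \<le> K * (d * w s)"
      proof (rule drift_diff_le[OF XL[OF f] XL[OF g]])
        fix u assume u: "0 \<le> u" "u \<le> s"
        have "\<bar>X f u - X g u\<bar> = w u * \<bar>f u - g u\<bar>"
          using u w1[of u] by (simp add: X_def abs_mult flip: right_diff_distrib)
        also have "\<dots> \<le> w s * d"
          using u wmono[of u s] w1[of u] w1[of s] d[of u] by (intro mult_mono) auto
        finally show "\<bar>X f u - X g u\<bar> \<le> d * w s" by (simp add: mult.commute)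
      qed (use s in \<open>auto simp: X_def\<close>)
      then show "norm (drift (X f) s - drift (X g) s) \<le> K * d * w s" by simp
    qed
    also have "\<dots> = d * (K * integral {0..t} w)" by (subst Henstock_Kurzweil_Integration.integral_mult_right) (simp only: mult_ac)
    also have "\<dots> \<le> d * (w t / 2)" using w_int[OF t] d0 by (rule mult_left_mono)
    finally show ?thesis unfolding Qd real_norm_def by simp
  qed
  obtain B where B: "\<And>t. 0 \<le> t \<Longrightarrow> \<bar>Q (\<lambda>_. 0) t\<bar> \<le> B * w t"
  proof -
    let ?X = "X (\<lambda>_. 0)"
    \<comment> \<open>With zero future, the window contains no initial past from time
      \<open>T\<close> on, and the drift is the constant \<open>f\<^sub>0 0 0\<close>. It is
      therefore bounded on the half line, so \<open>Q\<close> of the zero function is bounded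
      relative to \<open>w\<close>; the contraction estimate carries this over to every bounded
      \<open>f\<close>.\<close>
    have zero: "drift ?X s = f\<^sub>0 0 0" if "T \<le> s" for s
    proof -
      have "delay_term T a ?X s = (LINT u|lebesgue_on {-T..0}. 0)"
        unfolding delay_term_def by (rule Bochner_Integration.integral_cong) (use that in \<open>auto simp: X_def\<close>)
      then show ?thesis using that T_pos by (simp add: drift_def X_def)
    qed
    have "compact (drift ?X ` {0..T})"
      by (intro compact_continuous_image continuous_on_subset[OF drift_continuous[OF XL Xc]]) auto
    then obtain M where M: "\<And>s. s \<in> {0..T} \<Longrightarrow> \<bar>drift ?X s\<bar> \<le> M"
      using compact_imp_bounded bounded_iff by (metis imageI real_norm_def)
    have M': "\<bar>drift ?X s\<bar> \<le> M" if "0 \<le> s" for s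
      using M[of s] M[of T] zero[of s] zero[of T] that T_pos by (cases "s \<le> T") auto
    have M0: "0 \<le> M" using M'[of 0] by linarith
    show ?thesis
    proof (rule that)
      fix t :: real assume t: "0 \<le> t"
      have "norm (integral {0..t} (drift ?X)) \<le> integral {0..t} (\<lambda>_. M)"
        using M' by (intro Henstock_Kurzweil_Integration.integral_norm_bound_integral Xd) auto
      then have 1: "\<bar>integral {0..t} (drift ?X)\<bar> \<le> M * t" using t by (simp add: mult.commute)
      have "2 * K * t \<le> exp (2 * K * t)" using exp_ge_add_one_self[of "2 * K * t"] by linarith
      then have "t \<le> w t / (2 * K)" using w1(3)[OF t] K_pos by (simp add: field_simps)
      then have 2: "M * t \<le> M / (2 * K) * w t" using mult_left_mono[OF _ M0] by fastforce
      have "norm (integral {0..t} c) \<le> \<Gamma> t" unfolding \<Gamma>_def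
        by (intro Henstock_Kurzweil_Integration.integral_norm_bound_integral ci[OF t]) auto
      then have 3: "\<bar>integral {0..t} c\<bar> \<le> w t" using w1(2)[OF t] by simp
      have 4: "\<bar>fst \<eta>\<bar> \<le> \<bar>fst \<eta>\<bar> * w t" using w1(1)[OF t] by (simp add: mult_le_cancel_left1)
      show "\<bar>Q (\<lambda>_. 0) t\<bar> \<le> (\<bar>fst \<eta>\<bar> + M / (2 * K) + 1) * w t"
        using 1 2 3 4 unfolding Q_def distrib_right by linarith
    qed
  qed
  \<comment> \<open>Functions of the type used for the fixed point have the whole line as domain;
    \<open>max 0\<close> extends the quotient by its value at 0.\<close>
  define P where "P f t = Q f (max 0 t) / w (max 0 t)" for f t
  have P: "P (apply_bcontfun f) \<in> bcontfun" for f :: "real \<Rightarrow>\<^sub>C real"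
  proof -
    have wne: "w (max 0 t) \<noteq> 0" for t using w1(1)[of "max 0 t"] by auto
    have "continuous_on UNIV (P f)" unfolding P_def
      by (intro continuous_on_divide continuous_on_compose2[OF Qc] continuous_on_compose2[OF wc])
        (auto intro!: continuous_intros simp: wne)
    moreover have "\<bar>P f t\<bar> \<le> B + dist f 0 / 2" for t
    proof -
      have "\<bar>Q f (max 0 t) - Q (\<lambda>_. 0) (max 0 t)\<bar> \<le> dist f 0 * w (max 0 t) / 2"
        using dist_bounded[of f _ 0] by (intro contr) (auto simp: dist_real_def)
      moreover have "\<bar>Q (\<lambda>_. 0) (max 0 t)\<bar> \<le> B * w (max 0 t)" by (rule B) simp
      ultimately have "\<bar>Q f (max 0 t)\<bar> \<le> B * w (max 0 t) + dist f 0 * w (max 0 t) / 2" by linarith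
      also have "\<dots> = (B + dist f 0 / 2) * w (max 0 t)" by (simp add: algebra_simps)
      finally have "\<bar>Q f (max 0 t)\<bar> \<le> (B + dist f 0 / 2) * w (max 0 t)" .
      then show ?thesis using w1(1)[of "max 0 t"] by (simp add: P_def divide_simps)
    qed
    ultimately show ?thesis unfolding bcontfun_def bounded_iff by auto
  qed
  define \<Phi> where "\<Phi> f = Bcontfun (P (apply_bcontfun f))" for f
  have \<Phi>: "apply_bcontfun (\<Phi> f) t = P f t" for f t
    unfolding \<Phi>_def by (simp add: Bcontfun_inverse[OF P])
  have "\<exists>!f. \<Phi> f = f"
  proof (rule banach_fix_type[of "1/2"])
    show "\<forall>f g. dist (\<Phi> f) (\<Phi> g) \<le> 1 / 2 * dist f g"
    proof (intro allI dist_bound)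
      fix f g :: "real \<Rightarrow>\<^sub>C real" and t
      have "\<bar>Q f (max 0 t) - Q g (max 0 t)\<bar> \<le> dist f g * w (max 0 t) / 2"
        using dist_bounded[of f _ g] by (intro contr) (auto simp: dist_real_def)
      then show "dist (\<Phi> f t) (\<Phi> g t) \<le> 1 / 2 * dist f g"
        using w1(1)[of "max 0 t"] unfolding \<Phi> P_def dist_real_def
        by (simp add: abs_divide pos_divide_le_eq mult.commute flip: diff_divide_distrib)
    qed
  qed auto
  then obtain f where f: "\<Phi> f = f" by blast
  have "delay_solution T r a f\<^sub>0 \<eta> c (X f)"
  proof (rule solutionI[OF \<eta> _ Xc c])
    fix t :: real assume t: "0 \<le> t"
    have "f t = Q f t / w t" using \<Phi>[of f t] f t by (simp add: P_def)
    then show "X f t = fst \<eta> + integral {0..t} (drift (X f)) - integral {0..t} c"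
      using t w1(1)[OF t] by (simp add: X_def Q_def)
  qed (auto simp: X_def)
  then show ?thesis by blast
qed

end

section \<open>The value function\<close>

locale control_problem = delay_dynamics T r a f\<^sub>0 C
  for T r :: real and a f\<^sub>0 C +
  fixes \<rho> :: real and U\<^sub>1 U\<^sub>2 :: "real \<Rightarrow> real"
  assumes \<rho>_pos: "0 < \<rho>" and U1: "consumption_utility U\<^sub>1" and U2: "state_utility \<rho> C U\<^sub>2"
    and regular: "feedback_regularity T (value_fun T \<rho> r a f\<^sub>0 U\<^sub>1 U\<^sub>2) (value_dom T \<rho> r a f\<^sub>0 U\<^sub>1 U\<^sub>2)"
begin

abbreviation "V \<equiv> value_fun T \<rho> r a f\<^sub>0 U\<^sub>1 U\<^sub>2"
abbreviation "D \<equiv> value_dom T \<rho> r a f\<^sub>0 U\<^sub>1 U\<^sub>2"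
abbreviation "p \<equiv> present_deriv V"
abbreviation "v \<eta> \<equiv> real_of_ereal (V \<eta>)"

section \<open>Bounds on the utilities\<close>

definition M where "M = (SUP c\<in>{0..}. \<bar>U\<^sub>1 c\<bar>)"
definition B where "B = max 0 (SUP x\<in>{0<..}. U\<^sub>2 x)"

lemma abs_U1_le: "0 \<le> c \<Longrightarrow> \<bar>U\<^sub>1 c\<bar> \<le> M"
proof -
  assume "0 \<le> c"
  have "bounded (U\<^sub>1 ` {0..})" using U1 by (simp add: consumption_utility_def)
  then have "bdd_above ((\<lambda>c. \<bar>U\<^sub>1 c\<bar>) ` {0..})"
    unfolding bounded_iff bdd_above_def by auto
  then show ?thesis unfolding M_def using \<open>0 \<le> c\<close> by (intro cSUP_upper) auto
qed

lemma M_nonneg: "0 \<le> M"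
  using abs_U1_le[of 0] by simp

lemma U2_le: "0 < x \<Longrightarrow> U\<^sub>2 x \<le> B"
proof -
  assume "0 < x"
  have "bdd_above (U\<^sub>2 ` {0<..})" using U2 by (simp add: state_utility_def)
  then have "U\<^sub>2 x \<le> (SUP x\<in>{0<..}. U\<^sub>2 x)" using \<open>0 < x\<close> by (intro cSUP_upper) auto
  then show ?thesis by (simp add: B_def)
qed

lemma U1_mono:
  assumes "0 \<le> c" "c \<le> c'"
  shows "U\<^sub>1 c \<le> U\<^sub>1 c'"
proof (rule DERIV_nonneg_imp_increasing_open[OF assms(2)])
  show "continuous_on {c..c'} U\<^sub>1"
    using U1 assms(1) by (auto simp: consumption_utility_def elim: continuous_on_subset)
  fix z assume "c < z"
  then have "U\<^sub>1 field_differentiable at z" "0 < deriv U\<^sub>1 z"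
    using U1 assms(1) by (auto simp: consumption_utility_def)
  then show "\<exists>d. (U\<^sub>1 has_real_derivative d) (at z) \<and> 0 \<le> d"
    using DERIV_deriv_iff_field_differentiable less_imp_le by blast
qed

lemma U2_mono: "0 < x \<Longrightarrow> x \<le> y \<Longrightarrow> U\<^sub>2 x \<le> U\<^sub>2 y"
  using U2 mono_onD[of "{0<..}" U\<^sub>2 x y] by (simp add: state_utility_def)

text \<open>By concavity the slope to the right of \<open>x\<close> is at most that between
  \<open>\<xi> / 2\<close> and \<open>x\<close>, and the upper bound \<open>B\<close> makes the
  latter independent of \<open>x\<close>. The bound is one-sided, which suffices: a smaller
  \<open>y\<close> has no larger utility.\<close>

lemma U2_slope:
  assumes \<xi>: "0 < \<xi>" "\<xi> \<le> x" and d: "0 \<le> d" and y: "0 < y" "y \<le> x + d"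
  shows "U\<^sub>2 y \<le> U\<^sub>2 x + 2 * (B - U\<^sub>2 (\<xi> / 2)) / \<xi> * d"
proof -
  define b where "b = \<xi> / 2"
  have b: "0 < b" "b \<le> x - b" using \<xi> by (auto simp: b_def)
  \<comment> \<open>Length of the interval from \<open>b\<close> to \<open>x + d\<close>; in it,
    \<open>x\<close> is the mean of the endpoints with weights \<open>d / n\<close> and
    \<open>(x - b) / n\<close>.\<close>
  define n where "n = x + d - b"
  have n: "0 < n" using b d by (simp add: n_def)
  have conc: "concave_on {0<..} U\<^sub>2" using U2 by (simp add: state_utility_def)
  have uv: "d / n + (x - b) / n = 1" using n by (simp add: n_def add_divide_distrib[symmetric])
  have "d / n * U\<^sub>2 b + (x - b) / n * U\<^sub>2 (x + d) \<le> U\<^sub>2 ((d / n) *\<^sub>R b + ((x - b) / n) *\<^sub>R (x + d))"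
    using conc[unfolded concave_on_iff, THEN conjunct2, rule_format, of b "x + d" "d / n" "(x - b) / n"] b d n uv
    by simp
  also have "(d / n) *\<^sub>R b + ((x - b) / n) *\<^sub>R (x + d) = x"
  proof -
    have "d * b + (x - b) * (x + d) = n * x" by (simp add: n_def algebra_simps)
    then show ?thesis using n by (simp add: add_divide_distrib[symmetric])
  qed
  finally have "d * U\<^sub>2 b + (x - b) * U\<^sub>2 (x + d) \<le> n * U\<^sub>2 x"
    using n by (simp add: field_simps)
  then have "(x - b) * (U\<^sub>2 (x + d) - U\<^sub>2 x) \<le> d * (U\<^sub>2 x - U\<^sub>2 b)"
    by (simp add: n_def algebra_simps)
  also have "\<dots> \<le> d * (B - U\<^sub>2 b)"
    using d \<xi> U2_le[of x] by (intro mult_left_mono) auto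
  finally have 1: "(x - b) * (U\<^sub>2 (x + d) - U\<^sub>2 x) \<le> d * (B - U\<^sub>2 b)" .
  have "0 \<le> U\<^sub>2 (x + d) - U\<^sub>2 x" using U2_mono[of x "x + d"] \<xi> d by simp
  then have "b * (U\<^sub>2 (x + d) - U\<^sub>2 x) \<le> (x - b) * (U\<^sub>2 (x + d) - U\<^sub>2 x)"
    using b by (intro mult_right_mono) auto
  with 1 have "U\<^sub>2 (x + d) - U\<^sub>2 x \<le> d * (B - U\<^sub>2 b) / b"
    using b by (simp add: pos_le_divide_eq mult.commute)
  also have "\<dots> = 2 * (B - U\<^sub>2 (\<xi> / 2)) / \<xi> * d" by (simp add: b_def)
  finally show ?thesis using U2_mono[OF y] by simp
qed

section \<open>Payoffs along solutions\<close>

text \<open>The trajectory is an argument, so that payoffs can be shifted and compared without going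
  through the description operator in \<open>trajectory\<close>.\<close>

definition payoff :: "(real \<Rightarrow> real) \<Rightarrow> (real \<Rightarrow> real) \<Rightarrow> real \<Rightarrow> real" where
  "payoff c x t = exp (- \<rho> * t) * (U\<^sub>1 (c t) + U\<^sub>2 (x t))"

lemma payoff_le: "0 \<le> c t \<Longrightarrow> 0 < x t \<Longrightarrow> payoff c x t \<le> (M + B) * exp (- \<rho> * t)"
  using abs_U1_le[of "c t"] U2_le[of "x t"] unfolding payoff_def by (simp add: mult.commute)

lemma payoff_shift: "payoff (\<lambda>s. c (h + s)) (\<lambda>s. x (h + s)) s = exp (\<rho> * h) * payoff c x (h + s)"
proof -
  have "exp (- \<rho> * s) = exp (\<rho> * h) * exp (- \<rho> * (h + s))" by (simp add: mult_exp_exp algebra_simps)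
  then show ?thesis by (simp add: payoff_def)
qed

lemma U1_control_integrable:
  fixes c :: "real \<Rightarrow> real"
  assumes c: "c absolutely_integrable_on {s..t}" and c0: "\<And>u. s \<le> u \<Longrightarrow> 0 \<le> c u"
  shows "(\<lambda>u. U\<^sub>1 (c u)) absolutely_integrable_on {s..t}"
proof (rule measurable_bounded_by_integrable_imp_absolutely_integrable)
  \<comment> \<open>Continuity of \<open>U\<^sub>1\<close> is given on the nonnegative half line;
    precomposition with \<open>max 0\<close> yields a Borel function on the whole line.\<close>
  have "continuous_on UNIV (\<lambda>z. U\<^sub>1 (max 0 z))"
  proof -
    have 1: "continuous_on {0..} U\<^sub>1" using U1 by (simp add: consumption_utility_def)
    have 2: "continuous_on UNIV (\<lambda>z::real. max 0 z)" by (intro continuous_intros)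
    show ?thesis by (rule continuous_on_compose2[OF 1 2]) auto
  qed
  then have "(\<lambda>z. U\<^sub>1 (max 0 z)) \<in> borel_measurable borel" by (rule borel_measurable_continuous_onI)
  from measurable_compose[OF absolutely_integrable_imp_borel_measurable[OF c] this]
  have "(\<lambda>u. U\<^sub>1 (max 0 (c u))) \<in> borel_measurable (lebesgue_on {s..t})" by simp
  moreover have "(\<lambda>u. U\<^sub>1 (max 0 (c u))) \<in> borel_measurable (lebesgue_on {s..t})
      \<longleftrightarrow> (\<lambda>u. U\<^sub>1 (c u)) \<in> borel_measurable (lebesgue_on {s..t})"
    by (rule measurable_cong) (use c0 in auto)
  ultimately show "(\<lambda>u. U\<^sub>1 (c u)) \<in> borel_measurable (lebesgue_on {s..t})" by blast
  show "(\<lambda>_. M) integrable_on {s..t}" by (rule integrable_const_ivl)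
  show "norm (U\<^sub>1 (c u)) \<le> M" if "u \<in> {s..t}" for u using abs_U1_le c0 that by simp
qed simp

lemma payoff_integrable:
  assumes x: "delay_solution T r a f\<^sub>0 \<eta> c x" "snd \<eta> \<in> L2_past T"
    and pos: "\<And>t. 0 \<le> t \<Longrightarrow> 0 \<le> c t" "\<And>t. 0 \<le> t \<Longrightarrow> 0 < x t" and s: "0 \<le> s"
  shows "payoff c x absolutely_integrable_on {s..t}"
proof -
  have e: "continuous_on {s..t} (\<lambda>u. exp (- \<rho> * u))" by (intro continuous_intros)
  have U1i: "(\<lambda>u. U\<^sub>1 (c u)) absolutely_integrable_on {s..t}"
    using pos s by (intro U1_control_integrable solution_control_integrable[OF x]) auto
  have em: "(\<lambda>u. exp (- \<rho> * u)) \<in> borel_measurable (lebesgue_on {s..t})"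
    by (rule continuous_imp_measurable_on_sets_lebesgue[OF e]) simp
  have eb: "bounded ((\<lambda>u. exp (- \<rho> * u)) ` {s..t})"
    by (rule compact_imp_bounded[OF compact_continuous_image[OF e compact_Icc]])
  have "(\<lambda>u. exp (- \<rho> * u) * U\<^sub>1 (c u)) absolutely_integrable_on {s..t}"
    by (rule absolutely_integrable_bounded_measurable_product_real[OF em _ eb U1i]) simp
  moreover have "(\<lambda>u. exp (- \<rho> * u) * U\<^sub>2 (x u)) absolutely_integrable_on {s..t}"
  proof (rule absolutely_integrable_continuous_real)
    have "continuous_on {s..t} (\<lambda>u. U\<^sub>2 (x u))"
    proof -
      have 1: "continuous_on {0<..} U\<^sub>2" using U2 by (simp add: state_utility_def)
      have 2: "continuous_on {s..t} x"
        by (rule continuous_on_subset[OF solution_continuous[OF x(1)]]) (use s in auto)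
      show ?thesis by (rule continuous_on_compose2[OF 1 2]) (use pos(2) s in auto)
    qed
    with e show "continuous_on {s..t} (\<lambda>u. exp (- \<rho> * u) * U\<^sub>2 (x u))" by (rule continuous_on_mult)
  qed
  ultimately have "(\<lambda>u. exp (- \<rho> * u) * U\<^sub>1 (c u) + exp (- \<rho> * u) * U\<^sub>2 (x u)) absolutely_integrable_on {s..t}"
    by (rule set_integral_add(1))
  then show ?thesis by (simp add: payoff_def[abs_def] distrib_left)
qed

lemma admissible_solution:
  assumes "c \<in> admissible T r a f\<^sub>0 \<eta>" "snd \<eta> \<in> L2_past T"
  obtains x where "delay_solution T r a f\<^sub>0 \<eta> c x" "\<And>t. 0 \<le> t \<Longrightarrow> 0 < x t" "\<And>t. 0 \<le> t \<Longrightarrow> 0 \<le> c t"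
proof -
  obtain x where x: "delay_solution T r a f\<^sub>0 \<eta> c x"
    using solution_exists[OF assms(2), of c] assms(1) unfolding admissible_def by blast
  show ?thesis
    by (rule that[OF x]) (use assms(1) trajectory_eq[OF x assms(2)] in \<open>auto simp: admissible_def\<close>)
qed

lemma admissibleI:
  assumes x: "delay_solution T r a f\<^sub>0 \<eta> c x" "snd \<eta> \<in> L2_past T"
    and pos: "\<And>t. 0 \<le> t \<Longrightarrow> 0 \<le> c t" "\<And>t. 0 \<le> t \<Longrightarrow> 0 < x t"
  shows "c \<in> admissible T r a f\<^sub>0 \<eta>"
  using pos solution_control_integrable[OF x, of 0] by (simp add: admissible_def trajectory_eq[OF x])

lemma objective_eq:
  assumes x: "delay_solution T r a f\<^sub>0 \<eta> c x" "snd \<eta> \<in> L2_past T"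
  shows "objective T \<rho> r a f\<^sub>0 U\<^sub>1 U\<^sub>2 \<eta> c = ext_integral_halfline (payoff c x)"
  unfolding objective_def by (rule ext_integral_halfline_cong) (simp add: payoff_def trajectory_eq[OF x])

lemma payoff_le_value:
  assumes x: "delay_solution T r a f\<^sub>0 \<eta> c x" "snd \<eta> \<in> L2_past T"
    and pos: "\<And>t. 0 \<le> t \<Longrightarrow> 0 \<le> c t" "\<And>t. 0 \<le> t \<Longrightarrow> 0 < x t"
  shows "ext_integral_halfline (payoff c x) \<le> V \<eta>"
  unfolding value_fun_def objective_eq[OF x, symmetric]
  by (intro SUP_upper admissibleI[OF x]) (use pos in auto)

section \<open>Bounds and tangents of the value function\<close>

lemma value_le: "V \<eta> \<le> ereal ((M + B) / \<rho>)"
  unfolding value_fun_def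
proof (rule SUP_least)
  fix c assume c: "c \<in> admissible T r a f\<^sub>0 \<eta>"
  then show "objective T \<rho> r a f\<^sub>0 U\<^sub>1 U\<^sub>2 \<eta> c \<le> ereal ((M + B) / \<rho>)"
    unfolding objective_def
    by (intro ext_integral_halfline_le[OF \<rho>_pos] payoff_le[unfolded payoff_def]) (auto simp: admissible_def)
qed

lemma value_eq: "\<eta> \<in> D \<Longrightarrow> V \<eta> = ereal (v \<eta>)"
  using value_le[of \<eta>] by (cases "V \<eta>") (auto simp: value_dom_def)

text \<open>A solution ignores the profile at 0, where the present value counts. The segment at time
  0 carries \<open>x 0\<close> in its profile there, while the initial state may carry anything;
  their values are identified in this way.\<close>

lemma value_cong:
  assumes "fst \<eta> = fst \<zeta>" "\<And>s. -T \<le> s \<Longrightarrow> s < 0 \<Longrightarrow> snd \<eta> s = snd \<zeta> s"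
  shows "V \<eta> = V \<zeta>"
proof -
  have "delay_solution T r a f\<^sub>0 \<eta> = delay_solution T r a f\<^sub>0 \<zeta>"
    using assms by (intro ext) (auto simp: delay_solution_def)
  then have "trajectory T r a f\<^sub>0 \<eta> = trajectory T r a f\<^sub>0 \<zeta>"
    by (intro ext) (simp add: trajectory_def)
  then show ?thesis by (simp add: value_fun_def objective_def admissible_def)
qed

text \<open>The mixture of two states with the same past has that past again, so concavity on the
  domain becomes concavity in the present value.\<close>

lemma value_tangent:
  assumes \<eta>: "\<eta> \<in> D" and z: "(z, snd \<eta>) \<in> D"
  shows "v (z, snd \<eta>) \<le> v \<eta> + p \<eta> * (z - fst \<eta>)"
proof -
  let ?\<phi> = "\<lambda>x. v (x, snd \<eta>)"
  have "(\<lambda>x. v (x, snd \<eta>)) field_differentiable (at (fst \<eta>))"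
    using regular \<eta> by (simp add: feedback_regularity_def)
  then have d: "(?\<phi> has_real_derivative p \<eta>) (at (fst \<eta>))"
    by (simp add: present_deriv_def DERIV_deriv_iff_field_differentiable)
  have "?\<phi> (fst \<eta> + (z - fst \<eta>)) \<le> ?\<phi> (fst \<eta>) + p \<eta> * (z - fst \<eta>)"
  proof (rule concave_tangent_le[OF d])
    fix u :: real assume u: "0 < u" "u < 1"
    have mix: "H_mix u \<eta> (z, snd \<eta>) = (fst \<eta> + u * (z - fst \<eta>), snd \<eta>)"
      by (simp add: H_mix_def algebra_simps)
    have "H_mix u \<eta> (z, snd \<eta>) \<in> D \<and>
        V (H_mix u \<eta> (z, snd \<eta>)) \<ge> ereal (1 - u) * V \<eta> + ereal u * V (z, snd \<eta>)"
      using regular \<eta> z u unfolding feedback_regularity_def by (auto simp: less_imp_le)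
    then have m: "(fst \<eta> + u * (z - fst \<eta>), snd \<eta>) \<in> D"
      and ge: "ereal (1 - u) * V \<eta> + ereal u * V (z, snd \<eta>) \<le> V (fst \<eta> + u * (z - fst \<eta>), snd \<eta>)"
      unfolding mix by auto
    show "(1 - u) * ?\<phi> (fst \<eta>) + u * ?\<phi> (fst \<eta> + (z - fst \<eta>)) \<le> ?\<phi> (fst \<eta> + u * (z - fst \<eta>))"
    proof -
      obtain a1 a2 a3 where "V \<eta> = ereal a1" "V (z, snd \<eta>) = ereal a2" "V (fst \<eta> + u * (z - fst \<eta>), snd \<eta>) = ereal a3"
        using value_eq[OF m] value_eq[OF z] value_eq[OF \<eta>] by blast
      with ge show ?thesis by simp
    qed
  qed
  moreover have "fst \<eta> + (z - fst \<eta>) = z" by simp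
  ultimately show ?thesis by (simp only: prod.collapse)
qed

lemma present_deriv_pos: "\<eta> \<in> D \<Longrightarrow> 0 < p \<eta>"
  using regular by (simp add: feedback_regularity_def)

lemma value_domD: "\<eta> \<in> D \<Longrightarrow> snd \<eta> \<in> L2_past T"
  by (auto simp: value_dom_def H_plus_def)

text \<open>Composes the continuity of the derivative for the distance of \<open>H\<close> with that
  of \<open>segment x\<close> in time, which comes from the continuity of translations.\<close>

lemma present_deriv_continuous:
  assumes x: "delay_solution T r a f\<^sub>0 \<eta> c x" "snd \<eta> \<in> L2_past T"
    and D: "\<And>t. 0 \<le> t \<Longrightarrow> segment x t \<in> D"
  shows "continuous_on {0..} (\<lambda>t. p (segment x t))"
  unfolding continuous_on_sequentially
proof (intro allI ballI impI)
  fix u t assume "t \<in> {0::real..}" and "(\<forall>n::nat. u n \<in> {0..}) \<and> u \<longlonglongrightarrow> t"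
  then have u: "\<And>n. 0 \<le> u n" "0 \<le> t" "u \<longlonglongrightarrow> t" by auto
  have lim: "(\<lambda>n. H_dist T (segment x (u n)) (segment x t)) \<longlonglongrightarrow> 0"
    by (rule segment_H_dist_tendsto[OF solution_locally_L2[OF x] u solution_continuous[OF x(1)]])
  show "((\<lambda>t. p (segment x t)) \<circ> u) \<longlonglongrightarrow> p (segment x t)"
  proof (rule tendstoI)
    fix e :: real assume "0 < e"
    have "\<forall>\<eta>\<in>D. \<forall>\<epsilon>>0. \<exists>\<delta>>0. \<forall>\<zeta>\<in>D. H_dist T \<zeta> \<eta> < \<delta> \<longrightarrow> \<bar>p \<zeta> - p \<eta>\<bar> < \<epsilon>"
      using regular unfolding feedback_regularity_def by (elim conjE)
    from this[rule_format, OF D[OF u(2)] \<open>0 < e\<close>] obtain d where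
      d: "0 < d" "\<forall>\<zeta>\<in>D. H_dist T \<zeta> (segment x t) < d \<longrightarrow> \<bar>p \<zeta> - p (segment x t)\<bar> < e" by (elim exE conjE)
    have "\<bar>p (segment x (u n)) - p (segment x t)\<bar> < e" if "H_dist T (segment x (u n)) (segment x t) < d" for n
      using d(2)[rule_format, OF D[OF u(1)] that] .
    then show "\<forall>\<^sub>F n in sequentially. dist (((\<lambda>t. p (segment x t)) \<circ> u) n) (p (segment x t)) < e"
      unfolding dist_real_def o_def by (rule eventually_mono[OF order_tendstoD(2)[OF lim d(1)]])
  qed
qed

text \<open>\<open>arg_max_on\<close> is a choice operator, so a maximizer has to be exhibited
  before anything is known of its value. Beyond \<open>2 * M / p \<eta>\<close> the cost exceeds any
  possible gain of utility over zero consumption, so the maximum over a compact interval is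
  global.\<close>

lemma feedback_optimal:
  assumes "\<eta> \<in> D"
  defines "k \<equiv> feedback T \<rho> r a f\<^sub>0 U\<^sub>1 U\<^sub>2 \<eta>"
  shows "0 \<le> k" and "0 \<le> c \<Longrightarrow> U\<^sub>1 c - c * p \<eta> \<le> U\<^sub>1 k - k * p \<eta>"
proof -
  have p: "0 < p \<eta>" by (rule present_deriv_pos[OF assms(1)])
  let ?h = "\<lambda>c. U\<^sub>1 c - c * p \<eta>"
  let ?R = "2 * M / p \<eta>"
  have R: "0 \<le> ?R" using M_nonneg p by simp
  have "continuous_on {0..?R} ?h"
    using U1 by (intro continuous_intros) (auto simp: consumption_utility_def elim: continuous_on_subset)
  from continuous_attains_sup[OF compact_Icc _ this] R obtain b where
    b: "b \<in> {0..?R}" "\<And>c. c \<in> {0..?R} \<Longrightarrow> ?h c \<le> ?h b" by auto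
  have "?h c \<le> ?h b" if "0 \<le> c" for c
  proof (cases "c \<le> ?R")
    case False
    then have "2 * M < c * p \<eta>" using p by (simp add: field_simps)
    then have "?h c \<le> U\<^sub>1 0" using abs_U1_le[OF that] abs_U1_le[of 0] by simp
    also have "\<dots> \<le> ?h b" using b(2)[of 0] R by simp
    finally show ?thesis .
  qed (use b that in auto)
  then have "is_arg_max ?h (\<lambda>c. c \<in> {0..}) b"
    using b(1) by (auto simp: is_arg_max_linorder)
  then have "is_arg_max ?h (\<lambda>c. c \<in> {0..}) k"
    unfolding k_def feedback_def arg_max_on_def arg_max_def by (rule someI)
  then show "0 \<le> k" "0 \<le> c \<Longrightarrow> ?h c \<le> ?h k"
    by (auto simp: is_arg_max_linorder)
qed

section \<open>Optimality of the feedback\<close>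

text \<open>
  The perturbation is linear in \<open>c\<close> and \<open>c\<close> is unbounded, but beyond \<open>10 * M / q0\<close> the cost \<open>q * c\<close>
  outweighs the bounded utility, so only a bounded range of \<open>c\<close> matters.
\<close>
lemma perturbed_optimality:
  assumes c: "0 \<le> c" and k: "0 \<le> k" and opt: "\<And>c. 0 \<le> c \<Longrightarrow> U\<^sub>1 c - c * q \<le> U\<^sub>1 k - k * q"
    and q: "0 < q0" "q0 \<le> q" and \<delta>: "0 \<le> \<delta>" "\<bar>q - P\<bar> + b \<le> \<delta>" "2 * \<delta> \<le> q0"
  shows "U\<^sub>1 c - U\<^sub>1 k - P * c + P * k + b * (c + k) \<le> \<delta> * (12 * M / q0)"
proof -
  \<comment> \<open>Comparison with zero consumption: the cost of the optimum is at most the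
    variation of the bounded utility.\<close>
  have qk: "q * k \<le> 2 * M"
    using opt[of 0] abs_U1_le[of 0] abs_U1_le[OF k] by (simp add: mult.commute)
  have "q0 * k \<le> q * k" using q k by (intro mult_right_mono) auto
  then have k_le: "k \<le> 2 * M / q0" using qk q by (simp add: field_simps)
  have "(q - P) * (c - k) \<le> \<bar>q - P\<bar> * (c + k)"
  proof -
    have "\<bar>(q - P) * (c - k)\<bar> \<le> \<bar>q - P\<bar> * (c + k)"
      unfolding abs_mult using c k by (intro mult_left_mono) auto
    then show ?thesis by linarith
  qed
  then have "(q - P) * (c - k) + b * (c + k) \<le> (\<bar>q - P\<bar> + b) * (c + k)" by (simp add: algebra_simps)
  also have "\<dots> \<le> \<delta> * (c + k)" using \<delta> c k by (intro mult_right_mono) auto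
  finally have err: "(q - P) * (c - k) + b * (c + k) \<le> \<delta> * (c + k)" .
  have split: "U\<^sub>1 c - U\<^sub>1 k - P * c + P * k + b * (c + k)
      = (U\<^sub>1 c - U\<^sub>1 k - q * c + q * k) + ((q - P) * (c - k) + b * (c + k))"
    by (simp add: algebra_simps)
  show ?thesis
  proof (cases "c \<le> 10 * M / q0")
    case True
    have "U\<^sub>1 c - U\<^sub>1 k - q * c + q * k \<le> 0" using opt[OF c] by (simp add: mult.commute)
    moreover have "c + k \<le> 12 * M / q0" using True k_le by (simp add: add_divide_distrib[symmetric])
    then have "\<delta> * (c + k) \<le> \<delta> * (12 * M / q0)" using \<delta> by (intro mult_left_mono) auto
    ultimately show ?thesis unfolding split using err by linarith
  next
    \<comment> \<open>Here \<open>q * c \<ge> 10 * M\<close>, \<open>q * k \<le> 2 * M\<close>, and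
      the error is at most half of \<open>q * (c + k)\<close>. The whole is at most
      \<open>2 * M - q * c / 2 + 3 * q * k / 2\<close>, and 10 is the threshold from which this is
      nonpositive. The 12 of the claim is 10 plus the 2 in the bound on \<open>k\<close>.\<close>
    case False
    then have "10 * M \<le> q0 * c" using q by (simp add: field_simps)
    moreover have "q0 * c \<le> q * c" using q c by (intro mult_right_mono) auto
    moreover have "2 * (\<delta> * (c + k)) \<le> q * (c + k)"
      using mult_right_mono[of "2 * \<delta>" q "c + k"] \<delta> q c k by simp
    moreover have "q * (c + k) = q * c + q * k" by (simp add: distrib_left)
    moreover have "U\<^sub>1 c - U\<^sub>1 k \<le> 2 * M" using abs_U1_le[OF c] abs_U1_le[OF k] by linarith
    ultimately have "U\<^sub>1 c - U\<^sub>1 k - P * c + P * k + b * (c + k) \<le> 0"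
      unfolding split using err qk by linarith
    also have "0 \<le> \<delta> * (12 * M / q0)" using \<delta> M_nonneg q by simp
    finally show ?thesis .
  qed
qed

section \<open>One step of dynamic programming\<close>

text \<open>After time \<open>h\<close> the competitor continues from \<open>segment y h\<close>.
  The lifted state \<open>\<zeta>'\<close> with the prescribed past \<open>g\<close> admits a
  control with at least this consumption and at least this trajectory, and both utilities are
  nondecreasing. Since the tail is finite, \<open>\<zeta>'\<close> is found to lie in the
  domain.\<close>

lemma tail_le_value:
  assumes y: "delay_solution T r a f\<^sub>0 \<zeta> c y" "snd \<zeta> \<in> L2_past T"
    and pos: "\<And>t. 0 \<le> t \<Longrightarrow> 0 \<le> c t" "\<And>t. 0 \<le> t \<Longrightarrow> 0 < y t"
    and fin: "ext_integral_halfline (payoff c y) \<noteq> -\<infinity>" and h: "0 \<le> h"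
    and g: "g \<in> L2_past T"
    and e: "A * (LINT u|lebesgue_on {-T..0}. \<bar>g u - y (h + u)\<bar>) = e"
  defines "\<zeta>' \<equiv> (y h + C * e * exp ((C + 1) * T), g)"
  shows "\<zeta>' \<in> D"
    and "ext_integral_halfline (payoff c y) \<le> ereal (integral {0..h} (payoff c y) + exp (- \<rho> * h) * v \<zeta>')"
proof -
  have gi: "payoff c y absolutely_integrable_on {0..}"
    by (rule ext_integral_halfline_finite_imp_integrable[OF \<rho>_pos payoff_le borel_measurable_halfline fin])
      (use pos payoff_integrable[OF y pos, of 0] in auto)
  let ?c = "\<lambda>s. c (h + s)" and ?y = "\<lambda>s. y (h + s)"
  have sh: "delay_solution T r a f\<^sub>0 (segment y h) ?c ?y" "snd (segment y h) \<in> L2_past T"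
    by (rule solution_shift[OF y h])+
  have e0: "0 \<le> e" unfolding e[symmetric] using A_nonneg by simp
  have \<zeta>': "snd \<zeta>' \<in> L2_past T" using g by (simp add: \<zeta>'_def)
  have fst': "fst \<zeta>' = fst (segment y h) + C * e * exp ((C + 1) * T)"
    by (simp add: \<zeta>'_def segment_def)
  have e': "e = A * (LINT u|lebesgue_on {-T..0}. \<bar>snd \<zeta>' u - snd (segment y h) u\<bar>)"
    unfolding e[symmetric] by (simp add: \<zeta>'_def segment_def)
  obtain c' z where z: "delay_solution T r a f\<^sub>0 \<zeta>' c' z"
    and c': "\<And>t. 0 \<le> t \<Longrightarrow> c (h + t) \<le> c' t" and zy: "\<And>t. 0 \<le> t \<Longrightarrow> y (h + t) \<le> z t"
    by (rule dominating_solution[OF sh(1,2) \<zeta>' fst' e']) (blast intro: that)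
  have c'0: "0 \<le> c' t" if "0 \<le> t" for t using c'[OF that] pos(1)[of "h + t"] h that by linarith
  have z0: "0 < z t" if "0 \<le> t" for t using zy[OF that] pos(2)[of "h + t"] h that by linarith
  have "ext_integral_halfline (payoff ?c ?y) \<le> ext_integral_halfline (payoff c' z)"
  proof (rule ext_integral_halfline_mono)
    fix t :: real assume t: "0 \<le> t"
    show "payoff ?c ?y t \<le> payoff c' z t" unfolding payoff_def
      using U1_mono[OF _ c'[OF t]] U2_mono[OF _ zy[OF t]] pos[of "h + t"] h t
      by (intro mult_left_mono add_mono) auto
  qed
  also have "\<dots> \<le> V \<zeta>'" by (rule payoff_le_value[OF z \<zeta>' c'0 z0])
  finally have le: "ext_integral_halfline (payoff ?c ?y) \<le> V \<zeta>'" .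
  have pe: "payoff ?c ?y = (\<lambda>s. exp (\<rho> * h) * payoff c y (h + s))" by (rule ext) (rule payoff_shift)
  have shi: "(\<lambda>s. payoff c y (h + s)) absolutely_integrable_on {0..}"
    by (rule absolutely_integrable_translate_halfline(1)[OF gi h])
  then have "payoff ?c ?y absolutely_integrable_on {0..}"
    unfolding pe by (rule set_integrable_mult_right[rotated])
  from ext_integral_halfline_eq_integral[OF this]
  have eq: "ext_integral_halfline (payoff ?c ?y) = ereal (exp (\<rho> * h) * integral {0..} (\<lambda>s. payoff c y (h + s)))"
    unfolding pe by simp
  have "0 < fst \<zeta>'" using pos(2)[OF h] C_nonneg e0 by (simp add: \<zeta>'_def add_pos_nonneg)
  then show D: "\<zeta>' \<in> D"
    using le \<zeta>' unfolding value_dom_def H_plus_def eq by (cases \<zeta>') auto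
  have "exp (\<rho> * h) * integral {0..} (\<lambda>s. payoff c y (h + s)) \<le> v \<zeta>'"
    using le value_eq[OF D] unfolding eq by (metis ereal_less_eq(3))
  then have "exp (- \<rho> * h) * (exp (\<rho> * h) * integral {0..} (\<lambda>s. payoff c y (h + s))) \<le> exp (- \<rho> * h) * v \<zeta>'"
    by (intro mult_left_mono) auto
  moreover have "exp (- \<rho> * h) * (exp (\<rho> * h) * integral {0..} (\<lambda>s. payoff c y (h + s))) = integral {0..} (\<lambda>s. payoff c y (h + s))"
    by (simp add: mult_exp_exp flip: mult.assoc)
  ultimately have "integral {0..} (\<lambda>s. payoff c y (h + s)) \<le> exp (- \<rho> * h) * v \<zeta>'" by (simp only:)
  then show "ext_integral_halfline (payoff c y) \<le> ereal (integral {0..h} (payoff c y) + exp (- \<rho> * h) * v \<zeta>')"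
    unfolding ext_integral_halfline_eq_integral[OF gi] absolutely_integrable_translate_halfline(2)[OF gi h] by simp
qed

text \<open>
  The two summands bound the error of \<open>y h - x h\<close> as an integral of controls
  (\<open>solution_gap\<close>) and the lift needed by \<open>dominating_solution\<close>.
\<close>
definition \<kappa> where "\<kappa> = 2 * K + 2 * C * A * exp ((C + 1) * T)"

lemma \<kappa>_nonneg: "0 \<le> \<kappa>"
  using K_pos C_nonneg A_nonneg by (simp add: \<kappa>_def)

text \<open>The rest of the payoff is valued at a state with the past of \<open>x\<close>, where the
  tangent at \<open>segment x h\<close> applies. Consumption is thereby charged linearly at the
  price \<open>p (segment x h)\<close>, and what the comparison of trajectories misses is of order
  \<open>h * G\<close>.\<close>

lemma value_step_control:
  assumes x: "delay_solution T r a f\<^sub>0 \<zeta> k x" "snd \<zeta> \<in> L2_past T"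
    and y: "delay_solution T r a f\<^sub>0 \<zeta> c y"
    and c0: "\<And>t. 0 \<le> t \<Longrightarrow> 0 \<le> c t" and y0: "\<And>t. 0 \<le> t \<Longrightarrow> 0 < y t"
    and fin: "ext_integral_halfline (payoff c y) \<noteq> -\<infinity>"
    and h: "0 \<le> h" "2 * K * h \<le> 1" and D: "segment x h \<in> D"
  defines "G \<equiv> integral {0..h} (\<lambda>u. \<bar>c u - k u\<bar>)"
  shows "ext_integral_halfline (payoff c y) \<le> ereal (integral {0..h} (payoff c y) + exp (- \<rho> * h) *
     (v (segment x h) + p (segment x h) * (integral {0..h} k - integral {0..h} c + \<kappa> * h * G)))"
proof -
  let ?P = "p (segment x h)"
  have P: "0 < ?P" by (rule present_deriv_pos[OF D])
  have ki: "k absolutely_integrable_on {0..h}" by (rule solution_control_integrable[OF x]) simp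
  have ci: "c absolutely_integrable_on {0..h}" by (rule solution_control_integrable[OF y x(2)]) simp
  have xL: "locally_L2 T x" by (rule solution_locally_L2[OF x])
  have yL: "locally_L2 T y" by (rule solution_locally_L2[OF y x(2)])
  have "(\<lambda>u. c u - k u) absolutely_integrable_on {0..h}" by (rule set_integral_diff(1)[OF ci ki])
  then have Gi: "(\<lambda>u. \<bar>c u - k u\<bar>) integrable_on {0..h}" by (simp add: absolutely_integrable_on_def)
  have G0: "0 \<le> G" unfolding G_def by (rule integral_nonneg[OF Gi]) simp
  note gap = solution_gap[OF y x(1) x(2) x(2) refl refl h, folded G_def]
  define e where "e = A * (LINT u|lebesgue_on {-T..0}. \<bar>snd (segment x h) u - y (h + u)\<bar>)"
  have "(LINT u|lebesgue_on {-T..0}. \<bar>x (h + u) - y (h + u)\<bar>) \<le> (2 * G) * h"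
  proof (rule past_integral_le)
    show "integrable (lebesgue_on {-T..0}) (\<lambda>u. x (h + u) - y (h + u))"
      by (intro L2_past_integrable L2_past_diff locally_L2_segment xL yL h)
    show "\<bar>x (h + u) - y (h + u)\<bar> \<le> 2 * G" if "u \<in> {-T..0}" "-h \<le> u" for u
      using gap(1)[of "h + u"] that by (simp add: abs_minus_commute)
    show "x (h + u) - y (h + u) = 0" if "u \<in> {-T..0}" "u < -h" for u
      using x(1) y that h by (auto simp: delay_solution_def)
  qed (use G0 h in auto)
  then have e_le: "e \<le> A * (2 * G * h)"
    unfolding e_def segment_def using A_nonneg by (simp add: mult_left_mono)
  let ?z = "y h + C * e * exp ((C + 1) * T)"
  have seg: "snd (segment x h) \<in> L2_past T" by (rule value_domD[OF D])
  note tail = tail_le_value[OF y x(2) c0 y0 fin h(1) seg e_def[symmetric]]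
  have "v (?z, snd (segment x h)) \<le> v (segment x h) + ?P * (?z - x h)"
    using value_tangent[OF D tail(1)] by (simp add: segment_def)
  also have "\<dots> \<le> v (segment x h) + ?P * (integral {0..h} k - integral {0..h} c + \<kappa> * h * G)"
  proof -
    have "integral {0..h} (\<lambda>u. c u - k u) = integral {0..h} c - integral {0..h} k"
      using ci ki by (intro Henstock_Kurzweil_Integration.integral_diff) (auto simp: absolutely_integrable_on_def)
    then have "y h - x h \<le> integral {0..h} k - integral {0..h} c + 2 * K * h * G"
      using gap(2)[of h] h by (simp add: abs_le_iff)
    moreover have "C * e * exp ((C + 1) * T) \<le> C * (A * (2 * G * h)) * exp ((C + 1) * T)"
      using e_le C_nonneg by (intro mult_right_mono mult_left_mono) auto
    ultimately have "?z - x h \<le> integral {0..h} k - integral {0..h} c + \<kappa> * h * G"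
      by (simp add: \<kappa>_def algebra_simps)
    then show ?thesis using P by (intro add_left_mono mult_left_mono) auto
  qed
  finally have "integral {0..h} (payoff c y) + exp (- \<rho> * h) * v (?z, snd (segment x h)) \<le>
     integral {0..h} (payoff c y) + exp (- \<rho> * h) *
     (v (segment x h) + ?P * (integral {0..h} k - integral {0..h} c + \<kappa> * h * G))"
    by (intro add_left_mono mult_left_mono) auto
  then show ?thesis using tail(2) order_trans ereal_less_eq(3) by blast
qed

text \<open>\<open>q s\<close> stands for the price at time \<open>s\<close>; \<open>q0\<close>,
  \<open>\<xi>\<close> and \<open>b\<close> are left as parameters so that one choice serves all
  steps of a partition. In the bound on \<open>b\<close>, the first summand is the price of the
  error in the present value, the second the slope of \<open>U\<^sub>2\<close> applied to the
  deviation \<open>2 * G\<close>. The factor \<open>exp \<rho>\<close> compensates the discount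
  \<open>exp (- \<rho> * h)\<close>, as \<open>h \<le> 1\<close>.\<close>

lemma value_step:
  assumes x: "delay_solution T r a f\<^sub>0 \<zeta> k x" "snd \<zeta> \<in> L2_past T" and \<zeta>: "\<zeta> \<in> D"
    and k0: "\<And>t. 0 \<le> t \<Longrightarrow> 0 \<le> k t" and x0: "\<And>t. 0 \<le> t \<Longrightarrow> 0 < x t"
    and h: "0 < h" "2 * K * h \<le> 1" "h \<le> 1" and D: "segment x h \<in> D"
    and \<xi>: "0 < \<xi>" "\<And>s. 0 \<le> s \<Longrightarrow> s \<le> h \<Longrightarrow> \<xi> \<le> x s"
    and opt: "\<And>s c. 0 \<le> s \<Longrightarrow> s \<le> h \<Longrightarrow> 0 \<le> c \<Longrightarrow> U\<^sub>1 c - c * q s \<le> U\<^sub>1 (k s) - k s * q s"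
    and q: "0 < q0" "\<And>s. 0 \<le> s \<Longrightarrow> s \<le> h \<Longrightarrow> q0 \<le> q s"
    and b: "p (segment x h) * \<kappa> + 4 * (B - U\<^sub>2 (\<xi> / 2)) / \<xi> * exp \<rho> \<le> b"
    and \<delta>: "\<And>s. 0 \<le> s \<Longrightarrow> s \<le> h \<Longrightarrow> \<bar>q s - p (segment x h)\<bar> + b * h \<le> \<delta>" "2 * \<delta> \<le> q0"
    and \<epsilon>: "0 < \<epsilon>"
  shows "v \<zeta> \<le> integral {0..h} (payoff k x) + exp (- \<rho> * h) * v (segment x h)
     + h * (\<epsilon> + \<delta> * (12 * M / q0) + 2 * M * \<rho> * h)"
proof -
  let ?P = "p (segment x h)"
  define L where "L = 2 * (B - U\<^sub>2 (\<xi> / 2)) / \<xi>"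
  have L0: "0 \<le> L" unfolding L_def using U2_le[of "\<xi> / 2"] \<xi> by simp
  have P: "0 < ?P" by (rule present_deriv_pos[OF D])
  have b_ge: "?P * \<kappa> + 2 * L * exp \<rho> \<le> b" using b by (simp add: L_def)
  have b0: "0 \<le> b"
  proof -
    have "0 \<le> ?P * \<kappa> + 2 * L * exp \<rho>" using P \<kappa>_nonneg L0 by simp
    then show ?thesis using b_ge by linarith
  qed
  have \<delta>0: "0 \<le> \<delta>"
  proof -
    have "0 \<le> b * h" using b0 h by simp
    then show ?thesis using \<delta>(1)[of 0] h(1) by linarith
  qed
  \<comment> \<open>Suboptimality proportional to \<open>h\<close>, so that its sum over a partition
    remains small.\<close>
  have "ereal (v \<zeta> - \<epsilon> * h) < ereal (v \<zeta>)" using \<epsilon> h by simp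
  also have "\<dots> = V \<zeta>" by (rule value_eq[OF \<zeta>, symmetric])
  finally obtain c where c: "c \<in> admissible T r a f\<^sub>0 \<zeta>" "ereal (v \<zeta> - \<epsilon> * h) < objective T \<rho> r a f\<^sub>0 U\<^sub>1 U\<^sub>2 \<zeta> c"
    unfolding value_fun_def less_SUP_iff by blast
  obtain y where y: "delay_solution T r a f\<^sub>0 \<zeta> c y" and y0: "\<And>t. 0 \<le> t \<Longrightarrow> 0 < y t" and c0: "\<And>t. 0 \<le> t \<Longrightarrow> 0 \<le> c t"
    by (rule admissible_solution[OF c(1) x(2)]) (blast intro: that)
  have J: "ereal (v \<zeta> - \<epsilon> * h) < ext_integral_halfline (payoff c y)"
    using c(2) unfolding objective_eq[OF y x(2)] .
  then have fin: "ext_integral_halfline (payoff c y) \<noteq> -\<infinity>" by auto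
  define G where "G = integral {0..h} (\<lambda>u. \<bar>c u - k u\<bar>)"
  have h0: "0 \<le> h" using h by simp
  have "ereal (v \<zeta> - \<epsilon> * h) \<le> ereal (integral {0..h} (payoff c y) + exp (- \<rho> * h) *
     (v (segment x h) + ?P * (integral {0..h} k - integral {0..h} c + \<kappa> * h * G)))"
    unfolding G_def
    using J value_step_control[OF x y c0 y0 fin h0 h(2) D] by (meson less_imp_le less_le_trans)
  then have main: "v \<zeta> - \<epsilon> * h \<le> integral {0..h} (payoff c y) + exp (- \<rho> * h) *
     (v (segment x h) + ?P * (integral {0..h} k - integral {0..h} c + \<kappa> * h * G))" by simp
  have ki: "k absolutely_integrable_on {0..h}" by (rule solution_control_integrable[OF x]) simp
  have ci: "c absolutely_integrable_on {0..h}" by (rule solution_control_integrable[OF y x(2)]) simp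
  have cd: "(\<lambda>u. c u - k u) absolutely_integrable_on {0..h}" by (rule set_integral_diff(1)[OF ci ki])
  have Gi: "(\<lambda>u. \<bar>c u - k u\<bar>) integrable_on {0..h}" using cd by (simp add: absolutely_integrable_on_def)
  have ki': "k integrable_on {0..h}" and ci': "c integrable_on {0..h}"
    using ki ci by (auto simp: absolutely_integrable_on_def)
  have G0: "0 \<le> G" unfolding G_def by (rule integral_nonneg[OF Gi]) simp
  have G_le: "G \<le> integral {0..h} c + integral {0..h} k"
  proof -
    have "G \<le> integral {0..h} (\<lambda>u. c u + k u)"
      unfolding G_def using c0 k0
      by (intro integral_le[OF Gi integrable_add[OF ci' ki']]) (auto simp: abs_le_iff add_nonneg_nonneg)
    then show ?thesis by (simp add: Henstock_Kurzweil_Integration.integral_add[OF ci' ki'])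
  qed
  define E where "E = \<delta> * (12 * M / q0)"
  have E0: "0 \<le> E" unfolding E_def using \<delta>0 M_nonneg q by simp
  \<comment> \<open>At the cost \<open>2 * M * \<rho> * h\<close>, the utility of consumption is
    moved to the discount at \<open>h\<close>, that of the price, so that maximality applies. The
    last bracket is linear in \<open>c s\<close> and \<open>k s\<close>; its part with
    \<open>b * h\<close> is held back to pay for the errors in \<open>G\<close> after integration,
    since \<open>G\<close> is at most the integral of \<open>c + k\<close>.\<close>
  have pointwise: "payoff c y s \<le> payoff k x s + (2 * M * \<rho> * h + 2 * L * G + E)
      + (exp (- \<rho> * h) * (?P - b * h) * c s - exp (- \<rho> * h) * (?P + b * h) * k s)"
    if s: "0 \<le> s" "s \<le> h" for s
  proof -
    have es: "0 \<le> exp (- \<rho> * s)" "exp (- \<rho> * s) \<le> 1" using s \<rho>_pos by auto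
    have "\<bar>y s - x s\<bar> \<le> 2 * G"
      using solution_gap(1)[OF y x(1) x(2) x(2) refl refl h0 h(2) s] by (simp add: G_def)
    then have "U\<^sub>2 (y s) \<le> U\<^sub>2 (x s) + L * (2 * G)"
      unfolding L_def using \<xi>(1) \<xi>(2)[OF s] G0 y0[OF s(1)] by (intro U2_slope) auto
    then have "exp (- \<rho> * s) * U\<^sub>2 (y s) \<le> exp (- \<rho> * s) * (U\<^sub>2 (x s) + L * (2 * G))"
      using es by (intro mult_left_mono) auto
    also have "\<dots> \<le> exp (- \<rho> * s) * U\<^sub>2 (x s) + 1 * (L * (2 * G))"
      unfolding distrib_left using es L0 G0 by (intro add_left_mono mult_right_mono) auto
    finally have u2: "exp (- \<rho> * s) * U\<^sub>2 (y s) \<le> exp (- \<rho> * s) * U\<^sub>2 (x s) + 2 * L * G" by simp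
    have "exp (- \<rho> * h) \<le> exp (- \<rho> * s)" using s \<rho>_pos by simp
    moreover have "1 - \<rho> * h \<le> exp (- \<rho> * h)" using exp_ge_add_one_self[of "- \<rho> * h"] by simp
    ultimately have ed: "0 \<le> exp (- \<rho> * s) - exp (- \<rho> * h)" "exp (- \<rho> * s) - exp (- \<rho> * h) \<le> \<rho> * h"
      using es by linarith+
    have "U\<^sub>1 (c s) - U\<^sub>1 (k s) \<le> 2 * M" using abs_U1_le[OF c0[OF s(1)]] abs_U1_le[OF k0[OF s(1)]] by linarith
    then have "(exp (- \<rho> * s) - exp (- \<rho> * h)) * (U\<^sub>1 (c s) - U\<^sub>1 (k s)) \<le> (exp (- \<rho> * s) - exp (- \<rho> * h)) * (2 * M)"
      using ed by (intro mult_left_mono) auto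
    also have "\<dots> \<le> \<rho> * h * (2 * M)" using ed M_nonneg by (intro mult_right_mono) auto
    finally have u1: "(exp (- \<rho> * s) - exp (- \<rho> * h)) * (U\<^sub>1 (c s) - U\<^sub>1 (k s)) \<le> 2 * M * \<rho> * h" by (simp add: mult_ac)
    have "U\<^sub>1 (c s) - U\<^sub>1 (k s) - ?P * c s + ?P * k s + b * h * (c s + k s) \<le> E"
      unfolding E_def
      by (rule perturbed_optimality[OF c0[OF s(1)] k0[OF s(1)] opt[OF s] q(1) q(2)[OF s] \<delta>0 \<delta>(1)[OF s] \<delta>(2)])
    then have "exp (- \<rho> * h) * (U\<^sub>1 (c s) - U\<^sub>1 (k s) - ?P * c s + ?P * k s + b * h * (c s + k s)) \<le> exp (- \<rho> * h) * E"
      by (intro mult_left_mono) auto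
    also have "\<dots> \<le> 1 * E" using E0 \<rho>_pos h by (intro mult_right_mono) auto
    finally have u3: "exp (- \<rho> * h) * (U\<^sub>1 (c s) - U\<^sub>1 (k s) - ?P * c s + ?P * k s + b * h * (c s + k s)) \<le> E" by simp
    have "payoff c y s - payoff k x s = (exp (- \<rho> * s) * U\<^sub>2 (y s) - exp (- \<rho> * s) * U\<^sub>2 (x s))
      + (exp (- \<rho> * s) - exp (- \<rho> * h)) * (U\<^sub>1 (c s) - U\<^sub>1 (k s))
      + exp (- \<rho> * h) * (U\<^sub>1 (c s) - U\<^sub>1 (k s) - ?P * c s + ?P * k s + b * h * (c s + k s))
      + (exp (- \<rho> * h) * (?P - b * h) * c s - exp (- \<rho> * h) * (?P + b * h) * k s)"
      unfolding payoff_def by (simp add: algebra_simps)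
    then show ?thesis using u1 u2 u3 by linarith
  qed
  have pk: "payoff k x integrable_on {0..h}" and pc: "payoff c y integrable_on {0..h}"
    using payoff_integrable[OF x k0 x0, of 0 h] payoff_integrable[OF y x(2) c0 y0, of 0 h]
    by (auto simp: absolutely_integrable_on_def)
  define R where "R = 2 * M * \<rho> * h + 2 * L * G + E"
  define \<alpha> where "\<alpha> = exp (- \<rho> * h) * (?P - b * h)"
  define \<beta> where "\<beta> = exp (- \<rho> * h) * (?P + b * h)"
  have "((\<lambda>s. payoff k x s + R + (\<alpha> * c s - \<beta> * k s)) has_integral
      (integral {0..h} (payoff k x) + (h - 0) *\<^sub>R R + (\<alpha> * integral {0..h} c - \<beta> * integral {0..h} k))) {0..h}"
    using h0 by (intro has_integral_add has_integral_diff has_integral_mult_right integrable_integral pk ki' ci' has_integral_const_real[THEN has_integral_eq_rhs]) auto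
  from has_integral_le[OF integrable_integral[OF pc] this]
  have int: "integral {0..h} (payoff c y) \<le> integral {0..h} (payoff k x) + h * R + (\<alpha> * integral {0..h} c - \<beta> * integral {0..h} k)"
    using pointwise by (simp add: R_def \<alpha>_def \<beta>_def)
  have "2 * L * h * G \<le> exp (- \<rho> * h) * (2 * L * exp \<rho>) * h * G"
  proof -
    have "1 \<le> exp (- \<rho> * h) * exp \<rho>" using h \<rho>_pos by (simp add: mult_exp_exp mult_left_le)
    then have "2 * L * h * G * 1 \<le> 2 * L * h * G * (exp (- \<rho> * h) * exp \<rho>)"
      using L0 h G0 by (intro mult_left_mono) auto
    then show ?thesis by (simp add: mult_ac)
  qed
  moreover have "exp (- \<rho> * h) * (?P * \<kappa> + 2 * L * exp \<rho>) * (h * G) \<le> exp (- \<rho> * h) * b * (h * (integral {0..h} c + integral {0..h} k))"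
    using b_ge b0 G0 G_le h by (intro mult_mono mult_left_mono) auto
  ultimately have "h * R + (\<alpha> * integral {0..h} c - \<beta> * integral {0..h} k)
      + exp (- \<rho> * h) * (?P * (integral {0..h} k - integral {0..h} c + \<kappa> * h * G)) \<le> h * (E + 2 * M * \<rho> * h)"
    unfolding R_def \<alpha>_def \<beta>_def by (simp add: algebra_simps)
  with main int show ?thesis unfolding E_def[symmetric] by (simp add: algebra_simps)
qed

section \<open>Summation over a partition and the infinite horizon\<close>

lemma segment_shift: "segment (\<lambda>s. x (t + s)) h = segment x (t + h)"
  by (simp add: segment_def add.assoc)

lemma closed_loop_value_le:
  assumes x: "delay_solution T r a f\<^sub>0 \<eta> c x" "snd \<eta> \<in> L2_past T"
    and x0: "\<And>t. 0 \<le> t \<Longrightarrow> 0 < x t" and D: "\<And>t. 0 \<le> t \<Longrightarrow> segment x t \<in> D"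
    and c: "\<And>t. 0 \<le> t \<Longrightarrow> c t = feedback T \<rho> r a f\<^sub>0 U\<^sub>1 U\<^sub>2 (segment x t)"
    and t: "0 \<le> t"
  shows "v (segment x 0) \<le> integral {0..t} (payoff c x) + exp (- \<rho> * t) * v (segment x t)"
proof (cases "t = 0")
  case False
  with t have t: "0 < t" by simp
  define q where "q s = p (segment x s)" for s
  have c0: "0 \<le> c s" if "0 \<le> s" for s
    using feedback_optimal(1)[OF D[OF that]] c[OF that] by simp
  have opt: "U\<^sub>1 u - u * q s \<le> U\<^sub>1 (c s) - c s * q s" if "0 \<le> s" "0 \<le> u" for s u
    using feedback_optimal(2)[OF D[OF that(1)] that(2)] c[OF that(1)] by (simp add: q_def)
  have pay: "payoff c x absolutely_integrable_on {s..u}" if "0 \<le> s" for s u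
    by (rule payoff_integrable[OF x c0 x0 that])
  have "continuous_on {0..} q" unfolding q_def by (rule present_deriv_continuous[OF x D])
  then have qc: "continuous_on {0..t} q" by (rule continuous_on_subset) auto
  have xc: "continuous_on {0..t} x" by (rule continuous_on_subset[OF solution_continuous[OF x(1)]]) auto
  have ne: "{0..t} \<noteq> {}" using t by simp
  \<comment> \<open>Extrema over the compact interval: the same price bounds, state bound and
    constant \<open>b\<close> are valid in all steps, which makes the error uniform.\<close>
  obtain s1 where s1: "s1 \<in> {0..t}" "\<And>s. s \<in> {0..t} \<Longrightarrow> q s1 \<le> q s"
    using continuous_attains_inf[OF compact_Icc ne qc] by blast
  obtain s2 where s2: "s2 \<in> {0..t}" "\<And>s. s \<in> {0..t} \<Longrightarrow> q s \<le> q s2"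
    using continuous_attains_sup[OF compact_Icc ne qc] by blast
  obtain s3 where s3: "s3 \<in> {0..t}" "\<And>s. s \<in> {0..t} \<Longrightarrow> x s3 \<le> x s"
    using continuous_attains_inf[OF compact_Icc ne xc] by blast
  define q0 where "q0 = q s1"
  define \<xi> where "\<xi> = x s3"
  have q0: "0 < q0" using present_deriv_pos[OF D] s1 by (simp add: q0_def q_def)
  have \<xi>: "0 < \<xi>" using x0 s3 by (simp add: \<xi>_def)
  define b where "b = q s2 * \<kappa> + 4 * (B - U\<^sub>2 (\<xi> / 2)) / \<xi> * exp \<rho>"
  have b0: "0 \<le> b"
  proof -
    have "0 \<le> q s2" using present_deriv_pos[OF D, of s2] s2 by (simp add: q_def)
    then show ?thesis using \<kappa>_nonneg \<xi> U2_le[of "\<xi> / 2"] by (simp add: b_def)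
  qed
  define W where "W = 12 * M / q0"
  have W0: "0 \<le> W" using M_nonneg q0 by (simp add: W_def)
  show ?thesis
  proof (rule field_le_epsilon)
    fix e :: real assume e: "0 < e"
    \<comment> \<open>Each of the three errors per unit time will be at most
      \<open>\<epsilon>\<close>, for a total of at most three quarters of \<open>e\<close>.\<close>
    define \<epsilon> where "\<epsilon> = e / (4 * t)"
    define \<delta> where "\<delta> = min (q0 / 2) (\<epsilon> / (W + 1))"
    have \<epsilon>: "0 < \<epsilon>" using e t by (simp add: \<epsilon>_def)
    have \<delta>: "0 < \<delta>" "2 * \<delta> \<le> q0" using \<epsilon> q0 W0 by (auto simp: \<delta>_def)
    have "\<delta> \<le> \<epsilon> / (W + 1)" by (simp add: \<delta>_def)
    then have "\<delta> * (W + 1) \<le> \<epsilon>" using W0 by (simp add: pos_le_divide_eq)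
    then have \<delta>W: "\<delta> * W \<le> \<epsilon>" using \<delta> by (simp add: distrib_left)
    have "uniformly_continuous_on {0..t} q" by (rule compact_uniformly_continuous[OF qc compact_Icc])
    then obtain d where d: "0 < d" "\<And>s u. s \<in> {0..t} \<Longrightarrow> u \<in> {0..t} \<Longrightarrow> \<bar>u - s\<bar> < d \<Longrightarrow> \<bar>q u - q s\<bar> < \<delta> / 2"
      unfolding uniformly_continuous_on_def dist_real_def using \<delta>(1) by (metis half_gt_zero)
    \<comment> \<open>In this order: closeness of prices within a step,
      \<open>b * h \<le> \<delta> / 2\<close>, the smallness required by
      \<open>solution_gap\<close>, the bound 1 required by \<open>value_step\<close>, and a discount
      error of at most \<open>\<epsilon>\<close>.\<close>
    define h1 where "h1 = Min {d, \<delta> / (2 * (b + 1)), 1 / (2 * K), 1, \<epsilon> / (2 * M * \<rho> + 1)}"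
    have h1: "0 < h1" using d \<delta> b0 K_pos \<epsilon> M_nonneg \<rho>_pos by (simp add: h1_def add_nonneg_pos)
    obtain n :: nat where n: "t / h1 < real n" using reals_Archimedean2 by blast
    have n0: "0 < real n" using n t h1 by (meson divide_pos_pos less_trans)
    define h where "h = t / real n"
    have h: "0 < h" "h < h1" using n n0 t h1 by (auto simp: h_def field_simps)
    have hle: "h < d" "h \<le> \<delta> / (2 * (b + 1))" "h \<le> 1 / (2 * K)" "h \<le> 1" "h \<le> \<epsilon> / (2 * M * \<rho> + 1)"
      using h(2) unfolding h1_def by auto
    have hK: "2 * K * h \<le> 1" using hle(3) K_pos by (simp add: field_simps)
    have "h * (2 * (b + 1)) \<le> \<delta>" using hle(2) b0 by (simp add: pos_le_divide_eq)
    then have hb: "b * h \<le> \<delta> / 2" using h by (simp add: algebra_simps)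
    have "h * (2 * M * \<rho> + 1) \<le> \<epsilon>"
      using hle(5) M_nonneg \<rho>_pos by (subst (asm) pos_le_divide_eq) (auto intro: add_nonneg_pos)
    then have hM: "2 * M * \<rho> * h \<le> \<epsilon>" using h by (simp add: algebra_simps)
    define E where "E = \<epsilon> + \<delta> * W + 2 * M * \<rho> * h"
    have E: "E \<le> 3 * \<epsilon>" using \<delta>W hM by (simp add: E_def)
    have E0: "0 \<le> E" using \<epsilon> \<delta> W0 M_nonneg \<rho>_pos h by (simp add: E_def)
    \<comment> \<open>Telescoping in discounted form; the error of each step enters without its
      discount, which can only enlarge it.\<close>
    have "v (segment x 0) \<le> integral {0..real j * h} (payoff c x) + exp (- \<rho> * (real j * h)) * v (segment x (real j * h)) + real j * h * E"
      if "j \<le> n" for j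
      using that
    proof (induction j)
      case 0
      then show ?case by simp
    next
      case (Suc j)
      define s where "s = real j * h"
      have s0: "0 \<le> s" using h by (simp add: s_def)
      have sh: "real (Suc j) * h = s + h" by (simp add: s_def algebra_simps)
      have "real (Suc j) * h \<le> real n * h" using Suc.prems h by (intro mult_right_mono) auto
      also have "\<dots> = t" using n0 by (simp add: h_def)
      finally have st: "s + h \<le> t" unfolding sh .
      have in_t: "s + u \<in> {0..t}" if "0 \<le> u" "u \<le> h" for u using that s0 st by auto
      let ?c = "\<lambda>u. c (s + u)" and ?x = "\<lambda>u. x (s + u)"
      have "v (segment x s) \<le> integral {0..h} (payoff ?c ?x) + exp (- \<rho> * h) * v (segment ?x h)
         + h * (\<epsilon> + \<delta> * (12 * M / q0) + 2 * M * \<rho> * h)"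
      proof (rule value_step[where q = "\<lambda>u. q (s + u)" and \<xi> = \<xi> and b = b])
        show "delay_solution T r a f\<^sub>0 (segment x s) ?c ?x" "snd (segment x s) \<in> L2_past T"
          by (rule solution_shift[OF x s0])+
        show "segment x s \<in> D" by (rule D[OF s0])
        show "0 \<le> c (s + u)" "0 < x (s + u)" if "0 \<le> u" for u using c0 x0 s0 that by simp_all
        show "segment ?x h \<in> D" unfolding segment_shift using D s0 h by simp
        show "\<xi> \<le> x (s + u)" if "0 \<le> u" "u \<le> h" for u using s3(2)[OF in_t[OF that]] by (simp add: \<xi>_def)
        show "U\<^sub>1 w - w * q (s + u) \<le> U\<^sub>1 (c (s + u)) - c (s + u) * q (s + u)" if "0 \<le> u" "0 \<le> w" for u w
          using opt s0 that by simp
        show "q0 \<le> q (s + u)" if "0 \<le> u" "u \<le> h" for u using s1(2)[OF in_t[OF that]] by (simp add: q0_def)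
        have "p (segment ?x h) = q (s + h)" by (simp add: segment_shift q_def)
        then show "p (segment ?x h) * \<kappa> + 4 * (B - U\<^sub>2 (\<xi> / 2)) / \<xi> * exp \<rho> \<le> b"
          using s2(2)[OF in_t[of h]] h \<kappa>_nonneg by (simp add: b_def mult_right_mono)
        show "\<bar>q (s + u) - p (segment ?x h)\<bar> + b * h \<le> \<delta>" if "0 \<le> u" "u \<le> h" for u
        proof -
          have "\<bar>q (s + u) - q (s + h)\<bar> < \<delta> / 2"
            using that hle(1) h by (intro d(2) in_t) auto
          then show ?thesis using hb by (simp add: segment_shift q_def)
        qed
      qed (use h hK hle(4) \<xi> q0 \<delta> \<epsilon> in auto)
      then have "v (segment x s) \<le> integral {0..h} (payoff ?c ?x) + exp (- \<rho> * h) * v (segment x (s + h)) + h * E"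
        unfolding segment_shift E_def W_def .
      moreover have "integral {0..h} (payoff ?c ?x) = exp (\<rho> * s) * integral {s..s + h} (payoff c x)"
      proof -
        have "payoff ?c ?x = (\<lambda>u. exp (\<rho> * s) * payoff c x (s + u))" by (rule ext) (rule payoff_shift)
        then show ?thesis
          using integral_translate[where f = "payoff c x" and h = s and a = 0 and b = h] pay[OF s0] by simp
      qed
      ultimately have "exp (- \<rho> * s) * v (segment x s) \<le> exp (- \<rho> * s) *
          (exp (\<rho> * s) * integral {s..s + h} (payoff c x) + exp (- \<rho> * h) * v (segment x (s + h)) + h * E)"
        by (intro mult_left_mono) auto
      also have "\<dots> = integral {s..s + h} (payoff c x) + exp (- \<rho> * (s + h)) * v (segment x (s + h)) + exp (- \<rho> * s) * (h * E)"
        by (simp add: distrib_left mult_exp_exp right_diff_distrib flip: mult.assoc)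
      also have "exp (- \<rho> * s) * (h * E) \<le> 1 * (h * E)"
        using s0 \<rho>_pos h E0 by (intro mult_right_mono) auto
      finally have step: "exp (- \<rho> * s) * v (segment x s) \<le>
          integral {s..s + h} (payoff c x) + exp (- \<rho> * (s + h)) * v (segment x (s + h)) + h * E" by simp
      have "integral {0..s + h} (payoff c x) = integral {0..s} (payoff c x) + integral {s..s + h} (payoff c x)"
        using pay[of 0 "s + h"] s0 h by (intro Henstock_Kurzweil_Integration.integral_combine[symmetric])
          (auto simp: absolutely_integrable_on_def)
      moreover have "v (segment x 0) \<le> integral {0..s} (payoff c x) + exp (- \<rho> * s) * v (segment x s) + s * E"
        using Suc.IH Suc.prems by (simp add: s_def)
      ultimately show ?case unfolding sh distrib_right using step by linarith
    qed
    from this[OF order_refl] have "v (segment x 0) \<le> integral {0..t} (payoff c x) + exp (- \<rho> * t) * v (segment x t) + t * E"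
      using n0 by (simp add: h_def)
    moreover have "t * E \<le> e"
    proof -
      have "t * E \<le> t * (3 * \<epsilon>)" using E t by (intro mult_left_mono) auto
      also have "\<dots> \<le> e" using e t by (simp add: \<epsilon>_def)
      finally show ?thesis .
    qed
    ultimately show "v (segment x 0) \<le> integral {0..t} (payoff c x) + exp (- \<rho> * t) * v (segment x t) + e"
      by linarith
  qed
qed simp

text \<open>For optimality the terminal term must not contribute in the limit of an infinite
  horizon. An upper bound on the value along the trajectory suffices for the required inequality and
  comes from the upper bounds on the utilities; it takes the place of a transversality
  condition.\<close>

lemma closed_loop_optimal:
  assumes x: "delay_solution T r a f\<^sub>0 \<eta> c x" "snd \<eta> \<in> L2_past T"
    and x0: "\<And>t. 0 \<le> t \<Longrightarrow> 0 < x t" and D: "\<And>t. 0 \<le> t \<Longrightarrow> segment x t \<in> D"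
    and c: "\<And>t. 0 \<le> t \<Longrightarrow> c t = feedback T \<rho> r a f\<^sub>0 U\<^sub>1 U\<^sub>2 (segment x t)"
  shows "c \<in> admissible T r a f\<^sub>0 \<eta>" and "objective T \<rho> r a f\<^sub>0 U\<^sub>1 U\<^sub>2 \<eta> c = V \<eta>"
proof -
  have c0: "0 \<le> c s" if "0 \<le> s" for s
    using feedback_optimal(1)[OF D[OF that]] c[OF that] by simp
  show "c \<in> admissible T r a f\<^sub>0 \<eta>" by (rule admissibleI[OF x c0 x0])
  have "V \<eta> = V (segment x 0)"
    by (rule value_cong) (use x solution_initial[OF x] in \<open>auto simp: segment_def delay_solution_def\<close>)
  also have "\<dots> = ereal (v (segment x 0))" by (rule value_eq[OF D[OF order_refl]])
  also have "\<dots> \<le> ext_integral_halfline (payoff c x)"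
  proof (rule ext_integral_halfline_geI[OF \<rho>_pos payoff_le])
    fix t :: real assume t: "0 \<le> t"
    show "0 \<le> c t" "0 < x t" using c0 x0 t by auto
    show "payoff c x absolutely_integrable_on {0..t}" by (rule payoff_integrable[OF x c0 x0 order_refl])
    have "v (segment x t) \<le> (M + B) / \<rho>"
      using value_le[of "segment x t"] value_eq[OF D[OF t]] by (metis ereal_less_eq(3))
    then have "exp (- \<rho> * t) * v (segment x t) \<le> exp (- \<rho> * t) * ((M + B) / \<rho>)"
      by (intro mult_left_mono) auto
    then show "v (segment x 0) \<le> integral {0..t} (payoff c x) + exp (- \<rho> * t) * ((M + B) / \<rho>)"
      using closed_loop_value_le[OF x x0 D c t] by linarith
  qed
  finally have "V \<eta> \<le> objective T \<rho> r a f\<^sub>0 U\<^sub>1 U\<^sub>2 \<eta> c" unfolding objective_eq[OF x] .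
  moreover have "objective T \<rho> r a f\<^sub>0 U\<^sub>1 U\<^sub>2 \<eta> c \<le> V \<eta>"
    unfolding objective_eq[OF x] by (rule payoff_le_value[OF x c0 x0])
  ultimately show "objective T \<rho> r a f\<^sub>0 U\<^sub>1 U\<^sub>2 \<eta> c = V \<eta>" by (rule antisym[rotated])
qed

end

theorem theorem3p6:
  fixes T \<rho> r C\<^sub>f :: real
    and a U\<^sub>1 U\<^sub>2 x c :: "real \<Rightarrow> real"
    and f\<^sub>0 :: "real \<Rightarrow> real \<Rightarrow> real"
    and \<eta> :: state
  assumes "0 < T" and "0 < \<rho>" and "0 < r"
    and "dynamics_assms T a f\<^sub>0 C\<^sub>f"
    and "consumption_utility U\<^sub>1"
    and "state_utility \<rho> C\<^sub>f U\<^sub>2"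
    and known_facts: "feedback_regularity T (value_fun T \<rho> r a f\<^sub>0 U\<^sub>1 U\<^sub>2)
                        (value_dom T \<rho> r a f\<^sub>0 U\<^sub>1 U\<^sub>2)"
    and "\<eta> \<in> H_plus T"
    and c_def: "\<And>t. c t = feedback T \<rho> r a f\<^sub>0 U\<^sub>1 U\<^sub>2 (segment x t)"
    and closed_loop: "delay_solution T r a f\<^sub>0 \<eta> c x"
    and "\<And>t. 0 \<le> t \<Longrightarrow> 0 < x t"
    and "\<And>t. 0 \<le> t \<Longrightarrow> segment x t \<in> value_dom T \<rho> r a f\<^sub>0 U\<^sub>1 U\<^sub>2"
  shows "c \<in> admissible T r a f\<^sub>0 \<eta> \<and>
         objective T \<rho> r a f\<^sub>0 U\<^sub>1 U\<^sub>2 \<eta> c = value_fun T \<rho> r a f\<^sub>0 U\<^sub>1 U\<^sub>2 \<eta>"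
proof -
  interpret control_problem T r a f\<^sub>0 C\<^sub>f \<rho> U\<^sub>1 U\<^sub>2
    by unfold_locales (rule assms)+
  have "snd \<eta> \<in> L2_past T" using \<open>\<eta> \<in> H_plus T\<close> by (auto simp: H_plus_def)
  from closed_loop_optimal[OF closed_loop this assms(11,12) c_def] show ?thesis by blast
qed

end
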